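(* There exists a randomized algorithm that, given strings $X$ and $Y$ and an integer $k\ge 0$, returns YES if $\mathsf{ED}(X,Y)\le k$, and returns NO if $\mathsf{ED}(X,Y)>(3k+5)k$. With high probability, the algorithm is correct and its running time is $\tilde{\mathcal{O}}\big(\frac{1}{k+1}|X|+k^2\big)$.
   Context: Strings are finite sequences over an alphabet $\Sigma$; the algorithm has random access to the characters of $X$ and $Y$ (so its running time may be sublinear in the input length). $\mathsf{ED}(X,Y)$ denotes the edit distance (minimum number of character insertions, deletions and substitutions transforming $X$ into $Y$). The notation $\tilde{\mathcal{O}}$ hides factors polylogarithmic in the input size and in the inverse error probability; "with high probability" means with probability at least $1-1/N^{c}$ for an arbitrarily large constant $c$, where $N$ is the input size. *)

theory Defs
  imports "HOL-Probability.Probability"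
begin

section \<open>Edit distance\<close>

inductive edit_step :: "'a list \<Rightarrow> 'a list \<Rightarrow> bool" where
  insertion: "edit_step (us @ vs) (us @ [b] @ vs)"
| deletion: "edit_step (us @ [a] @ vs) (us @ vs)"
| substitution: "edit_step (us @ [a] @ vs) (us @ [b] @ vs)"

definition ED :: "'a list \<Rightarrow> 'a list \<Rightarrow> nat" where
  "ED X Y = (LEAST n. (edit_step ^^ n) X Y)"

section \<open>A randomized word RAM\<close>

text \<open>
  Algorithms are programs of a while-language over machine words, that is, naturals below
  \<open>2 ^ w\<close> for a word size \<open>w\<close> that is a parameter of the machine and not of the program.
  A program mentions finitely many variables and arrays (both named by naturals); an array is
  indexed by words, so that arrays give the random-access memory of a word RAM. The input
  strings can only be inspected one character at a time, by \<open>CharX\<close> and \<open>CharY\<close>.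
\<close>

datatype binop = Add | Sub | Mul | Div | Mod | And | Or | Xor | Shl | Shr | Less | Eq

datatype expr =
    Const nat
  | Var nat
  | Read nat expr
  | CharX expr
  | CharY expr
  | Bin binop expr expr

datatype com =
    Assign nat expr
  | Write nat expr expr
  | Rand nat expr
  | Seq com com
  | If expr com com
  | While expr com
  | Skip

record store =
  vars :: "nat \<Rightarrow> nat"
  arrs :: "nat \<Rightarrow> nat \<Rightarrow> nat"

text \<open>Arithmetic wraps around modulo \<open>2 ^ w\<close>; truth values are the words 0 and 1.\<close>

fun binop_val :: "nat \<Rightarrow> binop \<Rightarrow> nat \<Rightarrow> nat \<Rightarrow> nat" where
  "binop_val w Add a b = (a + b) mod 2 ^ w"
| "binop_val w Sub a b = (a + 2 ^ w - b) mod 2 ^ w"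
| "binop_val w Mul a b = (a * b) mod 2 ^ w"
| "binop_val w Div a b = a div b"
| "binop_val w Mod a b = a mod b"
| "binop_val w And a b = Bit_Operations.and a b"
| "binop_val w Or a b = Bit_Operations.or a b"
| "binop_val w Xor a b = Bit_Operations.xor a b"
| "binop_val w Shl a b = push_bit b a mod 2 ^ w"
| "binop_val w Shr a b = drop_bit b a"
| "binop_val w Less a b = of_bool (a < b) mod 2 ^ w"
| "binop_val w Eq a b = of_bool (a = b) mod 2 ^ w"

text \<open>Positions are counted from 0; a position outside of a string reads as 0.\<close>

definition char_at :: "nat list \<Rightarrow> nat \<Rightarrow> nat" where
  "char_at X i = (if i < length X then X ! i else 0)"

fun expr_val :: "nat \<Rightarrow> nat list \<Rightarrow> nat list \<Rightarrow> store \<Rightarrow> expr \<Rightarrow> nat" where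
  "expr_val w X Y s (Const n) = n mod 2 ^ w"
| "expr_val w X Y s (Var x) = vars s x"
| "expr_val w X Y s (Read a e) = arrs s a (expr_val w X Y s e)"
| "expr_val w X Y s (CharX e) = char_at X (expr_val w X Y s e)"
| "expr_val w X Y s (CharY e) = char_at Y (expr_val w X Y s e)"
| "expr_val w X Y s (Bin f e1 e2) = binop_val w f (expr_val w X Y s e1) (expr_val w X Y s e2)"

text \<open>
  A configuration is the stack of commands still to be executed, together with the store; the
  machine has halted when the stack is empty, and halted configurations are left unchanged.
  \<open>Rand x e\<close> stores in \<open>x\<close> a fresh uniformly random word between 0 and the value of \<open>e\<close>, inclusive.
\<close>

type_synonym config = "com list \<times> store"

fun step :: "nat \<Rightarrow> nat list \<Rightarrow> nat list \<Rightarrow> config \<Rightarrow> config pmf" where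
  "step w X Y ([], s) = return_pmf ([], s)"
| "step w X Y (Skip # cs, s) = return_pmf (cs, s)"
| "step w X Y (Assign x e # cs, s) =
     return_pmf (cs, s\<lparr>vars := (vars s)(x := expr_val w X Y s e)\<rparr>)"
| "step w X Y (Write a i e # cs, s) =
     return_pmf (cs, s\<lparr>arrs := (arrs s)(a := (arrs s a)(expr_val w X Y s i := expr_val w X Y s e))\<rparr>)"
| "step w X Y (Rand x e # cs, s) =
     map_pmf (\<lambda>v. (cs, s\<lparr>vars := (vars s)(x := v)\<rparr>)) (pmf_of_set {0..expr_val w X Y s e})"
| "step w X Y (Seq c1 c2 # cs, s) = return_pmf (c1 # c2 # cs, s)"
| "step w X Y (If e c1 c2 # cs, s) =
     return_pmf ((if expr_val w X Y s e \<noteq> 0 then c1 else c2) # cs, s)"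
| "step w X Y (While e c # cs, s) =
     return_pmf (if expr_val w X Y s e \<noteq> 0 then c # While e c # cs else cs, s)"

text \<open>
  The running time is the number of steps. A step performs a number of unit-cost word RAM
  operations that is bounded by the size of the expressions in the program text, hence by a
  constant that does not depend on the input.
\<close>

primrec run :: "nat \<Rightarrow> nat list \<Rightarrow> nat list \<Rightarrow> nat \<Rightarrow> config \<Rightarrow> config pmf" where
  "run w X Y 0 cfg = return_pmf cfg"
| "run w X Y (Suc t) cfg = bind_pmf (step w X Y cfg) (run w X Y t)"

text \<open>
  Variables 0, 1, 2 initially hold \<open>|X|\<close>, \<open>|Y|\<close> and \<open>k\<close>; everything else is 0. On
  halting, variable 0 holds the answer: 0 for NO, any other value for YES.
\<close>

definition init_config :: "com \<Rightarrow> nat list \<Rightarrow> nat list \<Rightarrow> nat \<Rightarrow> config" where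
  "init_config P X Y k =
     ([P], \<lparr>vars = (\<lambda>_. 0)(0 := length X, 1 := length Y, 2 := k), arrs = (\<lambda>_ _. 0)\<rparr>)"

definition halted :: "config \<Rightarrow> bool" where
  "halted cfg \<longleftrightarrow> fst cfg = []"

definition returns_YES :: "config \<Rightarrow> bool" where
  "returns_YES cfg \<longleftrightarrow> halted cfg \<and> vars (snd cfg) 0 \<noteq> 0"

definition returns_NO :: "config \<Rightarrow> bool" where
  "returns_NO cfg \<longleftrightarrow> halted cfg \<and> vars (snd cfg) 0 = 0"

text \<open>
  Since halted configurations are stationary, having halted after exactly \<open>t\<close> steps of
  \<^const>\<open>run\<close> means running time at most \<open>t\<close>, and the configuration then carries the
  final answer. Hence this is the probability of the joint event that \<open>P\<close> halts within
  \<open>t\<close> steps and that its final configuration is in \<open>G\<close>.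
\<close>

definition prob_halts_within ::
    "nat \<Rightarrow> com \<Rightarrow> nat list \<Rightarrow> nat list \<Rightarrow> nat \<Rightarrow> real \<Rightarrow> config set \<Rightarrow> real" where
  "prob_halts_within w P X Y k t G =
     measure_pmf.prob (run w X Y (nat \<lfloor>t\<rfloor>) (init_config P X Y k)) {cfg \<in> G. halted cfg}"

definition correct_answers :: "nat list \<Rightarrow> nat list \<Rightarrow> nat \<Rightarrow> config set" where
  "correct_answers X Y k =
     {cfg. (ED X Y \<le> k \<longrightarrow> returns_YES cfg) \<and> (ED X Y > (3 * k + 5) * k \<longrightarrow> returns_NO cfg)}"

text \<open>The input consists of the characters of both strings and the integer \<open>k\<close>, in words.\<close>

definition input_size :: "nat list \<Rightarrow> nat list \<Rightarrow> nat" where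
  "input_size X Y = length X + length Y + 1"

text \<open>
  As usual for the word RAM, a word has at least \<open>a log N\<close> bits for some constant \<open>a\<close>, and
  positions, the integer \<open>k\<close> and the characters (from an integer alphabet) fit into words.
\<close>

definition valid_word_size :: "nat \<Rightarrow> nat \<Rightarrow> nat list \<Rightarrow> nat list \<Rightarrow> nat \<Rightarrow> bool" where
  "valid_word_size a w X Y k \<longleftrightarrow>
     a * log 2 (input_size X Y + 1) \<le> w \<and> input_size X Y < 2 ^ w \<and> k < 2 ^ w \<and>
     set X \<union> set Y \<subseteq> {..<2 ^ w}"

end

theory Submission
  imports Defs
begin

text \<open>
  A position \<open>v\<close> of \<open>Y\<close> stands for the alignment of \<open>X ! (x + i)\<close> with \<open>Y ! (v + i)\<close>. The
  algorithm is greedy: in each of \<open>k + 1\<close> phases it moves from \<open>x\<close> to \<open>y + 1\<close>, where \<open>y\<close> is at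
  least as far as every alignment with \<open>\<bar>v - x\<bar> \<le> k\<close> matches exactly, and at most as far as some
  such alignment has \<open>k\<close> mismatches. An alignment with at most \<open>k\<close> edits spends an edit in every
  phase that does not reach the end of \<open>X\<close>; conversely, a phase costs at most \<open>3 * k\<close> edits, and
  one more for the skipped character.

  A phase must find \<open>y\<close> in time about \<open>(y - x) / (k + 1) + k\<close>. It splits the alignments into at most
  four groups of width \<open>h = k div 2\<close>. Within a group, the Z-function yields the candidates that
  match a window of length \<open>2 * h\<close>, and random sampling finds a mismatch of the first candidate at
  some offset \<open>i\<close> before too many mismatches have been overlooked. This mismatch breaks the
  periodicity that two other candidates \<open>v1 < v2\<close> would impose on \<open>X\<close> or on \<open>Y\<close> with period
  \<open>v2 - v1\<close>, so a binary search for the place of the break refutes one of them. A tournament of such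
  duels leaves a single candidate, which is then tested by sampling as well.
\<close>

section \<open>Edit distance as the length of a shortest edit path, and how such paths are
  cut\<close>

section \<open>Edit distance\<close>

text \<open>Sampling each of the 2k + 1 alignments separately would cost about |X| altogether, since
  a probe of length l takes about l / (k + 1) samples. The duels exist to get by with at most two
  probes per group. They rely on Fine and Wilf, which needs a window at least as long as the sum of
  two differences of candidates. The window in turn must be short enough to be skipped with at most
  k edits when no candidate exists. Groups of width h and windows of length 2h \<le> k satisfy both
  demands, and 2h is also the number of mismatches that a probe may overlook.

  The bound (3k + 5)k is exact bookkeeping: at most k phases end with a skipped character and cost
  3k + 1 each, the phase that reaches the end of X costs 3k, and k more edits correct the length of
  Y. For k = 0 no slack is left, and none is needed: h is 0, so a probe that has not failed has
  overlooked nothing.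

  A probe fails with probability at most exp (- T). Since T is a multiple of the binary length of
  the input size, a union bound over all probes yields any desired inverse polynomial.\<close>

lemma edit_step_append_right: "edit_step A B \<Longrightarrow> edit_step (A @ C) (B @ C)"
proof (induction rule: edit_step.induct)
  case (insertion us vs b) then show ?case using edit_step.insertion[of us "vs @ C" b] by simp
next
  case (deletion us a vs) then show ?case using edit_step.deletion[of us a "vs @ C"] by simp
next
  case (substitution us a vs b) then show ?case using edit_step.substitution[of us a "vs @ C" b] by simp
qed

lemma edit_step_append_left: "edit_step A B \<Longrightarrow> edit_step (C @ A) (C @ B)"
proof (induction rule: edit_step.induct)
  case (insertion us vs b) then show ?case using edit_step.insertion[of "C @ us" vs b] by simp
next
  case (deletion us a vs) then show ?case using edit_step.deletion[of "C @ us" a vs] by simp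
next
  case (substitution us a vs b) then show ?case using edit_step.substitution[of "C @ us" a vs b] by simp
qed

lemma edit_steps_append_right: "(edit_step ^^ n) A B \<Longrightarrow> (edit_step ^^ n) (A @ C) (B @ C)"
  by (induction n arbitrary: B) (auto intro: edit_step_append_right)

lemma edit_steps_append_left: "(edit_step ^^ n) A B \<Longrightarrow> (edit_step ^^ n) (C @ A) (C @ B)"
  by (induction n arbitrary: B) (auto intro: edit_step_append_left)

lemma edit_steps_append:
  assumes "(edit_step ^^ p) A B" "(edit_step ^^ q) C D"
  shows "(edit_step ^^ (p + q)) (A @ C) (B @ D)"
  using edit_steps_append_right[OF assms(1), of C] edit_steps_append_left[OF assms(2), of B]
  by (auto simp: relpowp_add)

lemma edit_steps_delete: "(edit_step ^^ length A) A []"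
proof (induction A)
  case (Cons a A)
  have "edit_step (a # A) A" using edit_step.deletion[of "[]" a A] by simp
  then show ?case using Cons relpowp_Suc_I2[of edit_step "a # A" A] by auto
qed simp

lemma edit_steps_insert: "(edit_step ^^ length A) [] A"
proof (induction A rule: rev_induct)
  case (snoc a A)
  have "edit_step A (A @ [a])" using edit_step.insertion[of A "[]" a] by simp
  then show ?case using snoc by auto
qed simp

text \<open>\<open>LEAST\<close> says nothing until some number of steps is known to suffice;
  deleting all of \<open>A\<close> and inserting all of \<open>B\<close> provides one.\<close>

lemma ED_steps: "(edit_step ^^ ED A B) A B"
proof -
  have "\<exists>n. (edit_step ^^ n) A B"
    using edit_steps_append[OF edit_steps_delete[of A] edit_steps_insert[of B]]
    edit_steps_append[OF edit_steps_insert[of B] edit_steps_delete[of A] ]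
    by (metis append_Nil append_Nil2)
  then show ?thesis unfolding ED_def by (rule LeastI_ex)
qed

lemma ED_le: "(edit_step ^^ n) A B \<Longrightarrow> ED A B \<le> n"
  unfolding ED_def by (rule Least_le)

lemma ED_append: "ED (A @ C) (B @ D) \<le> ED A B + ED C D"
  by (intro ED_le edit_steps_append ED_steps)

lemma ED_triangle: "ED A C \<le> ED A B + ED B C"
  using ED_steps[of A B] ED_steps[of B C] by (intro ED_le) (auto simp: relpowp_add)

lemma ED_self [simp]: "ED A A = 0"
  using ED_le[of 0 A A] by simp

lemma ED_eq_0D: "ED A B = 0 \<Longrightarrow> A = B"
  using ED_steps[of A B] by simp

lemma ED_Nil2: "ED A [] \<le> length A"
  by (intro ED_le edit_steps_delete)

lemma ED_Nil1: "ED [] A \<le> length A"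
  by (intro ED_le edit_steps_insert)

lemma ED_snoc: "ED (A @ [a]) (B @ [b]) \<le> ED A B + of_bool (a \<noteq> b)"
proof -
  have "edit_step [a] [b]" using edit_step.substitution[of "[]" a "[]" b] by simp
  then have "ED [a] [b] \<le> 1" by (intro ED_le) auto
  then have "ED [a] [b] \<le> of_bool (a \<noteq> b)" by (cases "a = b") auto
  then show ?thesis using ED_append[of A "[a]" B "[b]"] by linarith
qed

lemma ED_max: "ED A B \<le> max (length A) (length B)"
proof -
  have *: "length A = length B \<Longrightarrow> ED A B \<le> length A" for A B :: "'a list"
  proof (induction A arbitrary: B rule: rev_induct)
    case (snoc a A)
    then obtain B' b where B: "B = B' @ [b]" by (cases B rule: rev_cases) auto
    then show ?case using snoc.IH[of B'] snoc.prems ED_snoc[of A a B' b] by (cases "a = b") auto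
  qed simp
  let ?l = "min (length A) (length B)"
  have "ED A B \<le> ED (take ?l A) (take ?l B) + ED (drop ?l A) (drop ?l B)"
    using ED_append[of "take ?l A" "drop ?l A" "take ?l B" "drop ?l B"] by simp
  moreover have "ED (take ?l A) (take ?l B) \<le> ?l" using *[of "take ?l A" "take ?l B"] by auto
  moreover have "ED (drop ?l A) (drop ?l B) \<le> max (length A) (length B) - ?l"
  proof (cases "length A \<le> length B")
    case True then show ?thesis using ED_Nil1[of "drop ?l B"] by (simp add: min_def max_def)
  next
    case False then show ?thesis using ED_Nil2[of "drop ?l A"] by (simp add: min_def max_def)
  qed
  ultimately show ?thesis by linarith
qed

lemma edit_step_length: "edit_step A B \<Longrightarrow> length A \<le> length B + 1 \<and> length B \<le> length A + 1"
  by (induction rule: edit_step.induct) auto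

lemma edit_steps_length:
  "(edit_step ^^ n) A B \<Longrightarrow> length A \<le> length B + n \<and> length B \<le> length A + n"
proof (induction n arbitrary: B)
  case (Suc n)
  then obtain M where "(edit_step ^^ n) A M" "edit_step M B" by auto
  then show ?case using Suc.IH[of M] edit_step_length[of M B] by auto
qed simp

lemma ED_length: "length A \<le> length B + ED A B" "length B \<le> length A + ED A B"
  using edit_steps_length[OF ED_steps[of A B]] by auto

text \<open>One edit touches only one side of a cut. An insertion exactly at the cut may be
  attributed to either side.\<close>

lemma edit_step_split:
  assumes "edit_step (A1 @ A2) B"
  shows "\<exists>B1 B2. B = B1 @ B2 \<and> ((edit_step A1 B1 \<and> A2 = B2) \<or> (A1 = B1 \<and> edit_step A2 B2))"
  using assms
proof (cases rule: edit_step.cases)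
  case (insertion us vs b)
  from insertion(1) consider z where "A1 = us @ z" "vs = z @ A2" | z where "us = A1 @ z" "A2 = z @ vs"
    by (auto simp: append_eq_append_conv2)
  then show ?thesis
  proof cases
    case 1
    then show ?thesis using insertion edit_step.insertion[of us z b]
      by (intro exI[of _ "us @ [b] @ z"] exI[of _ A2]) auto
  next
    case 2
    then show ?thesis using insertion edit_step.insertion[of z vs b]
      by (intro exI[of _ A1] exI[of _ "z @ [b] @ vs"]) auto
  qed
next
  case (deletion us a vs)
  from deletion(1) consider z where "A1 = us @ [a] @ z" "vs = z @ A2" | z where "us = A1 @ z" "A2 = z @ [a] @ vs"
    by (auto simp: append_eq_append_conv2 append_eq_Cons_conv Cons_eq_append_conv)
  then show ?thesis
  proof cases
    case 1
    then show ?thesis using deletion edit_step.deletion[of us a z]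
      by (intro exI[of _ "us @ z"] exI[of _ A2]) auto
  next
    case 2
    then show ?thesis using deletion edit_step.deletion[of z a vs]
      by (intro exI[of _ A1] exI[of _ "z @ vs"]) auto
  qed
next
  case (substitution us a vs b)
  from substitution(1) consider z where "A1 = us @ [a] @ z" "vs = z @ A2" | z where "us = A1 @ z" "A2 = z @ [a] @ vs"
    by (auto simp: append_eq_append_conv2 append_eq_Cons_conv Cons_eq_append_conv)
  then show ?thesis
  proof cases
    case 1
    then show ?thesis using substitution edit_step.substitution[of us a z b]
      by (intro exI[of _ "us @ [b] @ z"] exI[of _ A2]) auto
  next
    case 2
    then show ?thesis using substitution edit_step.substitution[of z a vs b]
      by (intro exI[of _ A1] exI[of _ "z @ [b] @ vs"]) auto
  qed
qed

lemma edit_steps_split: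
  "(edit_step ^^ n) (A1 @ A2) B \<Longrightarrow>
    \<exists>B1 B2 n1 n2. B = B1 @ B2 \<and> (edit_step ^^ n1) A1 B1 \<and> (edit_step ^^ n2) A2 B2 \<and> n1 + n2 = n"
proof (induction n arbitrary: B)
  case 0
  then show ?case by (intro exI[of _ A1] exI[of _ A2] exI[of _ 0]) auto
next
  case (Suc n)
  then obtain M where M: "(edit_step ^^ n) (A1 @ A2) M" "edit_step M B" by auto
  from Suc.IH[OF M(1)] obtain M1 M2 n1 n2 where
    IH: "M = M1 @ M2" "(edit_step ^^ n1) A1 M1" "(edit_step ^^ n2) A2 M2" "n1 + n2 = n" by blast
  from edit_step_split M(2) IH(1) obtain B1 B2 where
    B: "B = B1 @ B2" "(edit_step M1 B1 \<and> M2 = B2) \<or> (M1 = B1 \<and> edit_step M2 B2)" by blast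
  from B(2) show ?case
  proof
    assume "edit_step M1 B1 \<and> M2 = B2"
    then show ?thesis using B(1) IH
      by (intro exI[of _ B1] exI[of _ B2] exI[of _ "Suc n1"] exI[of _ n2]) auto
  next
    assume "M1 = B1 \<and> edit_step M2 B2"
    then show ?thesis using B(1) IH
      by (intro exI[of _ B1] exI[of _ B2] exI[of _ n1] exI[of _ "Suc n2"]) auto
  qed
qed

text \<open>Every edit of an optimal path can be charged to one side of the cut. This is the
  substitute for an explicit alignment: it tells where an optimal edit path sends a prefix.\<close>

lemma ED_split:
  obtains B1 B2 where "B = B1 @ B2" "ED A1 B1 + ED A2 B2 \<le> ED (A1 @ A2) B"
  using edit_steps_split[OF ED_steps[of "A1 @ A2" B]] ED_le by (metis add_mono)

lemma ED_take_take: "ED (take a Y) (take b Y) \<le> (a - b) + (b - a)"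
proof (cases "a \<le> b")
  case True
  then have "take b Y = take a Y @ take (b - a) (drop a Y)" by (metis le_add_diff_inverse take_add)
  then show ?thesis
    using ED_append[of "take a Y" "[]" "take a Y" "take (b - a) (drop a Y)"]
      ED_Nil1[of "take (b - a) (drop a Y)"] by simp
next
  case False
  then have "take a Y = take b Y @ take (a - b) (drop b Y)" by (metis le_add_diff_inverse nat_le_linear take_add)
  then show ?thesis
    using ED_append[of "take b Y" "take (a - b) (drop b Y)" "take b Y" "[]"]
      ED_Nil2[of "take (a - b) (drop b Y)"] by simp
qed

section \<open>Mismatches and moves along a diagonal\<close>

definition mism :: "nat list \<Rightarrow> nat list \<Rightarrow> nat \<Rightarrow> nat \<Rightarrow> nat set" where
  "mism X Y x v = {i. char_at X (x + i) \<noteq> char_at Y (v + i)}"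

lemma ED_take_mism:
  assumes "x + l \<le> length X" "v + l \<le> length Y"
  shows "ED (take (x + l) X) (take (v + l) Y) \<le> ED (take x X) (take v Y) + card (mism X Y x v \<inter> {..<l})"
  using assms
proof (induction l)
  case (Suc l)
  have t: "take (x + Suc l) X = take (x + l) X @ [X ! (x + l)]"
    "take (v + Suc l) Y = take (v + l) Y @ [Y ! (v + l)]"
    using Suc.prems by (auto simp: take_Suc_conv_app_nth)
  have "card (mism X Y x v \<inter> {..<Suc l}) =
     card (mism X Y x v \<inter> {..<l}) + of_bool (X ! (x + l) \<noteq> Y ! (v + l))"
    using Suc.prems by (auto simp: lessThan_Suc mism_def char_at_def Int_insert_right)
  then show ?case using Suc ED_snoc[of "take (x + l) X" "X ! (x + l)" "take (v + l) Y" "Y ! (v + l)"]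
    unfolding t by linarith
qed simp

text \<open>
  The distance is measured on the main diagonal at both ends: entering the diagonal of \<open>v\<close>,
  its mismatches, and leaving it cost at most \<open>k\<close> each.
\<close>

lemma ED_diagonal_jump:
  assumes "x + l \<le> length X" "v + l \<le> length Y" "v \<le> x + k" "x \<le> v + k"
    "card (mism X Y x v \<inter> {..<l}) \<le> k"
  shows "ED (take (x + l) X) (take (x + l) Y) \<le> ED (take x X) (take x Y) + 3 * k"
proof -
  have 1: "ED (take (x + l) X) (take (x + l) Y) \<le> ED (take (x + l) X) (take (v + l) Y) + ED (take (v + l) Y) (take (x + l) Y)"
    by (rule ED_triangle)
  have 2: "ED (take x X) (take v Y) \<le> ED (take x X) (take x Y) + ED (take x Y) (take v Y)"
    by (rule ED_triangle)
  have 3: "ED (take (v + l) Y) (take (x + l) Y) \<le> k" "ED (take x Y) (take v Y) \<le> k"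
    using ED_take_take[of "v + l" Y "x + l"] ED_take_take[of x Y v] assms(3,4) by linarith+
  show ?thesis using 1 2 3 ED_take_mism[OF assms(1,2)] assms(5) by linarith
qed

text \<open>No range condition is imposed: if a string ends early, its block is merely shorter, and
  \<open>ED_max\<close> bounds the distance by the longer block.\<close>

lemma ED_diagonal_skip:
  "ED (take (x + l) X) (take (x + l) Y) \<le> ED (take x X) (take x Y) + l"
proof -
  have "ED (take (x + l) X) (take (x + l) Y) \<le>
    ED (take x X) (take x Y) + ED (take l (drop x X)) (take l (drop x Y))"
    unfolding take_add by (rule ED_append)
  also have "ED (take l (drop x X)) (take l (drop x Y)) \<le> l"
    using ED_max[of "take l (drop x X)" "take l (drop x Y)"] by auto
  finally show ?thesis by simp
qed

definition matches :: "nat list \<Rightarrow> nat list \<Rightarrow> nat \<Rightarrow> nat \<Rightarrow> nat \<Rightarrow> bool" where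
  "matches X Y x v l \<longleftrightarrow> x + l \<le> length X \<and> v + l \<le> length Y \<and> (\<forall>i<l. char_at X (x + i) = char_at Y (v + i))"

text \<open>
  Cut an optimal alignment at position \<open>Suc y\<close> of \<open>X\<close>. The part before the cut contains an edit,
  since otherwise the alignment \<open>v\<close> would match exactly beyond \<open>y\<close>.
\<close>

lemma ED_greedy_progress:
  assumes e: "ED (drop x X) (drop v Y) + e \<le> k" and v: "v \<le> x + e" "x \<le> v + e" "v \<le> length Y"
    and y: "\<And>l. matches X Y x v l \<Longrightarrow> x + l \<le> y" and lt: "y < length X" and "x \<le> y"
  shows "\<exists>v' e'. e < e' \<and> ED (drop (Suc y) X) (drop v' Y) + e' \<le> k \<and>
    v' \<le> Suc y + e' \<and> Suc y \<le> v' + e' \<and> v' \<le> length Y"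
proof -
  define l where "l = Suc y - x"
  have l: "x + l = Suc y" using \<open>x \<le> y\<close> by (simp add: l_def)
  obtain B1 B2 where B: "drop v Y = B1 @ B2"
    "ED (take l (drop x X)) B1 + ED (drop l (drop x X)) B2 \<le> ED (drop x X) (drop v Y)"
    using ED_split[of "drop v Y" "take l (drop x X)" "drop l (drop x X)"]
    by (metis append_take_drop_id)
  let ?d = "ED (take l (drop x X)) B1"
  have B2: "drop (v + length B1) Y = B2" using B(1)
    by (metis append_eq_conv_conj drop_drop add.commute)
  have lenA: "length (take l (drop x X)) = l" using l lt by auto
  have lenB: "v + length B1 \<le> length Y"
  proof -
    have "length (drop v Y) = length B1 + length B2" using B(1) by simp
    then show ?thesis using v(3) by simp
  qed
  have "?d \<noteq> 0"
  proof
    assume "?d = 0"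
    then have eq: "take l (drop x X) = B1" by (rule ED_eq_0D)
    have "matches X Y x v l" unfolding matches_def
    proof (intro conjI allI impI)
      show "x + l \<le> length X" using l lt by simp
      show "v + l \<le> length Y" using lenB lenA eq by simp
      fix i assume "i < l"
      have "X ! (x + i) = take l (drop x X) ! i" using \<open>i < l\<close> l lt by simp
      also have "\<dots> = (B1 @ B2) ! i" using eq lenA \<open>i < l\<close> by (simp add: nth_append)
      also have "\<dots> = Y ! (v + i)" using B(1) v(3) by (metis nth_drop)
      finally show "char_at X (x + i) = char_at Y (v + i)"
        using \<open>i < l\<close> l lt \<open>v + l \<le> length Y\<close> by (simp add: char_at_def)
    qed
    then show False using y[of l] l by simp
  qed
  moreover have "ED (drop (Suc y) X) (drop (v + length B1) Y) + ?d \<le> ED (drop x X) (drop v Y)"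
    using B(2) B2 l by (simp add: add.commute)
  \<comment> \<open>One edit shifts an alignment by at most one diagonal, so the distance of
    \<open>v'\<close> from \<open>Suc y\<close> stays within the edits spent.\<close>
  moreover have "l \<le> length B1 + ?d" "length B1 \<le> l + ?d"
    using ED_length(1)[of "take l (drop x X)" B1] ED_length(2)[where A = "take l (drop x X)" and B = B1] lenA
    by auto
  ultimately show ?thesis using e v lenB l
    by (intro exI[of _ "v + length B1"] exI[of _ "e + ?d"]) auto
qed

section \<open>Periodic words and the theorem of Fine and Wilf\<close>

section \<open>Periods\<close>

definition period :: "(nat \<Rightarrow> nat) \<Rightarrow> nat \<Rightarrow> nat \<Rightarrow> bool" where
  "period f l p \<longleftrightarrow> (\<forall>i. i + p < l \<longrightarrow> f i = f (i + p))"

lemma periodD: "period f l p \<Longrightarrow> i + p < l \<Longrightarrow> f i = f (i + p)"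
  unfolding period_def by (drule spec, drule mp)

text \<open>The positions \<open>i\<close> and \<open>i + (b - a)\<close> are joined by a detour:
  through \<open>i - a\<close> if that exists, and through \<open>i + b\<close> otherwise. The
  hypothesis \<open>a + b \<le> l\<close> keeps the second detour inside the word.\<close>

lemma period_diff:
  assumes that: "period f l a" "period f l b" "a \<le> b" "a + b \<le> l"
  shows "period f l (b - a)"
  unfolding period_def
  proof (intro allI impI)
    fix i assume i: "i + (b - a) < l"
    show "f i = f (i + (b - a))"
    proof (cases "a \<le> i")
      case True
      have lt: "i - a + a < l" "i - a + b < l" using that True i by linarith+
      have "f (i - a + a) = f (i - a + b)"
        using periodD[OF that(1) lt(1)] periodD[OF that(2) lt(2)] by (rule subst)
      moreover have "i - a + a = i" "i - a + b = i + (b - a)" using True that(3) by linarith+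
      ultimately show ?thesis by (simp only:)
    next
      case False
      then have lt: "i + b < l" "i + (b - a) + a < l" using that by linarith+
      have "f i = f (i + b)" by (rule periodD[OF that(2) lt(1)])
      moreover have "f (i + (b - a)) = f (i + (b - a) + a)" by (rule periodD[OF that(1) lt(2)])
      moreover have "(i + (b - a)) + a = i + b" using that by simp
      ultimately show ?thesis by (simp only:)
    qed
  qed

text \<open>Fine and Wilf with the slightly stronger length condition \<open>p + q \<le> l\<close>,
  which makes the subtractive Euclidean algorithm go through: every pair it visits still fits into
  the word.\<close>

lemma period_gcd: "period f l p \<Longrightarrow> period f l q \<Longrightarrow> p + q \<le> l \<Longrightarrow> period f l (gcd p q)"
proof (induction "p + q" arbitrary: p q rule: less_induct)
  case less
  show ?case
  proof (cases "p = 0 \<or> q = 0")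
    case True then show ?thesis using less.prems by auto
  next
    case False
    show ?thesis
    proof (cases "p \<le> q")
      case True
      then have "period f l (gcd p (q - p))" using less False period_diff[of f l p q] by auto
      then show ?thesis using True by (metis gcd.commute gcd_diff1_nat)
    next
      case False2: False
      then have "period f l (gcd (p - q) q)" using less False period_diff[of f l q p] by auto
      then show ?thesis using False2 by (metis gcd_diff1_nat nat_le_linear)
    qed
  qed
qed

lemma period_mult: "period f l p \<Longrightarrow> i + c * p < l \<Longrightarrow> f i = f (i + c * p)"
proof (induction c)
  case (Suc c)
  then have "f (i + c * p) = f (i + c * p + p)" unfolding period_def by (auto simp: algebra_simps)
  then show ?case using Suc by (auto simp: algebra_simps)
qed simp

lemma period_mod: assumes "period f l p" "i < l" shows "f i = f (i mod p)"
  using period_mult[OF assms(1), of "i mod p" "i div p"] assms(2)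
  by (metis mod_div_mult_eq)

lemma period_cong: assumes "period f l p" "i < l" "j < l" "i mod p = j mod p" shows "f i = f j"
  using period_mod[OF assms(1,2)] period_mod[OF assms(1,3)] assms(4) by simp

text \<open>Position \<open>v2 + i\<close> of \<open>Y\<close> is aligned with \<open>x + i\<close>
  by \<open>v2\<close> and with \<open>x + i + (v2 - v1)\<close> by \<open>v1\<close>, so these two
  characters of \<open>X\<close> agree.\<close>

lemma matches_period:
  assumes "matches X Y x v1 l" "matches X Y x v2 l" "v1 \<le> v2"
  shows "period (\<lambda>i. char_at X (x + i)) l (v2 - v1)"
  unfolding period_def
proof (intro allI impI)
  fix i assume i: "i + (v2 - v1) < l"
  have "char_at X (x + i) = char_at Y (v2 + i)" using assms(2) i by (simp add: matches_def)
  also have "v2 + i = v1 + (i + (v2 - v1))" using assms(3) by simp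
  also have "char_at Y \<dots> = char_at X (x + (i + (v2 - v1)))" using assms(1) i by (simp add: matches_def)
  finally show "char_at X (x + i) = char_at X (x + (i + (v2 - v1)))" .
qed

text \<open>By Fine and Wilf, the window also has the period \<open>gcd (v2 - v1) (v1 - v0)\<close>.\<close>
lemma duel_base_Y:
  assumes ex: "matches X Y x v0 (2 * h)" "matches X Y x v1 (2 * h)" "matches X Y x v2 (2 * h)"
    and ord: "v0 \<le> v1" "v1 < v2" "v2 \<le> v0 + h" and j: "v1 \<le> v0 + j"
    and ne: "char_at X (x + j) \<noteq> char_at Y (v0 + j)"
    and eq: "char_at X (x + j) = char_at X (x + j mod (v2 - v1))"
  shows "char_at Y (v1 + (v0 + j - v1)) \<noteq> char_at Y (v1 + (v0 + j - v1) mod (v2 - v1))"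
proof -
  let ?f = "\<lambda>i. char_at X (x + i)" and ?p = "v2 - v1" and ?q = "v1 - v0"
  let ?i = "(v0 + j - v1) mod (v2 - v1)" and ?g = "gcd ?p ?q"
  have "period ?f (2 * h) ?p" "period ?f (2 * h) ?q" using matches_period ex ord by auto
  then have per: "period ?f (2 * h) ?g" using period_gcd ord by auto
  have p: "0 < ?p" "?p \<le> h" using ord by auto
  have lt: "?i < ?p" "j mod ?p < ?p" using p by auto
  have "?g dvd ?p" by simp
  have "?i mod ?g = (v0 + j - v1) mod ?g" using mod_mod_cancel[OF \<open>?g dvd ?p\<close>] by simp
  \<comment> \<open>Changing the origin from \<open>v1\<close> to \<open>v0\<close> adds
    \<open>?q\<close>, a multiple of \<open>?g\<close>, and so preserves the residue. This is why
    the gcd is needed and \<open>?p\<close> alone would not do.\<close>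
  also have "\<dots> = (v0 + j - v1 + ?q) mod ?g"
    by (rule sym, subst mod_add_right_eq[symmetric]) simp
  also have "v0 + j - v1 + ?q = j" using j ord by simp
  also have "j mod ?g = (j mod ?p) mod ?g" using mod_mod_cancel[OF \<open>?g dvd ?p\<close>] by simp
  finally have "?i mod ?g = j mod ?p mod ?g" .
  moreover have lt2: "?i < 2 * h" "j mod ?p < 2 * h" using lt p by linarith+
  ultimately have "?f ?i = ?f (j mod ?p)" by (intro period_cong[OF per])
  moreover from lt2 have "char_at Y (v1 + ?i) = ?f ?i" using ex(2) unfolding matches_def by metis
  ultimately show ?thesis using ne eq j by simp
qed

section \<open>Program logic for running time and error probability\<close>

section \<open>A logic for randomized programs\<close>

lemma prob_bind_pmf_of_set:
  assumes "finite A" "A \<noteq> {}"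
  shows "measure_pmf.prob (bind_pmf (pmf_of_set A) f) S = (\<Sum>a\<in>A. measure_pmf.prob (f a) S) / card A"
proof -
  have "ennreal (measure_pmf.prob (bind_pmf (pmf_of_set A) f) S) =
      (\<Sum>a\<in>A. ennreal (measure_pmf.prob (f a) S)) / ennreal (card A)"
    using assms by (simp add: measure_pmf.emeasure_eq_measure[symmetric] nn_integral_pmf_of_set
        ennreal_of_nat_eq_real_of_nat)
  also have "\<dots> = ennreal ((\<Sum>a\<in>A. measure_pmf.prob (f a) S) / card A)"
    using assms by (subst sum_ennreal) (auto intro!: divide_ennreal sum_nonneg simp: card_gt_0_iff)
  finally show ?thesis by (subst (asm) ennreal_inj) (auto intro!: divide_nonneg_nonneg sum_nonneg)
qed

locale word_ram =
  fixes w :: nat and X Y :: "nat list" and G :: "store \<Rightarrow> bool" and tmax :: nat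
begin

text \<open>
  \<open>ok cs s t e\<close>: started after \<open>t\<close> steps in the configuration \<open>(cs, s)\<close>, the machine
  halts by time \<open>tmax\<close> in a store satisfying \<open>G\<close>, except with probability at most \<open>e\<close>.
  The error \<open>e\<close> is a budget that a random choice may redistribute between its outcomes.
\<close>

inductive ok :: "com list \<Rightarrow> store \<Rightarrow> nat \<Rightarrow> real \<Rightarrow> bool" where
  ok_halt: "G s \<Longrightarrow> t \<le> tmax \<Longrightarrow> 0 \<le> e \<Longrightarrow> ok [] s t e"
| ok_trivial: "1 \<le> e \<Longrightarrow> ok cs s t e"
| ok_det: "step w X Y (c # cs, s) = return_pmf (cs', s') \<Longrightarrow> ok cs' s' (Suc t) e \<Longrightarrow> ok (c # cs) s t e"
| ok_rand: "(\<And>v. v \<le> expr_val w X Y s a \<Longrightarrow> ok cs (s\<lparr>vars := (vars s)(x := v)\<rparr>) (Suc t) (f v)) \<Longrightarrow>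
    (\<Sum>v\<le>expr_val w X Y s a. f v) / real (Suc (expr_val w X Y s a)) \<le> e \<Longrightarrow> ok (Rand x a # cs) s t e"

lemma ok_mono: "ok cs s t e \<Longrightarrow> e \<le> e' \<Longrightarrow> ok cs s t e'"
proof (induction arbitrary: e' rule: ok.induct)
  case (ok_rand s a cs x t f e)
  have "(\<Sum>v\<le>expr_val w X Y s a. f v) / real (Suc (expr_val w X Y s a)) \<le> e'"
    using ok_rand.hyps ok_rand.prems by linarith
  then show ?case using ok_rand.IH by (intro ok.ok_rand[where f = f]) auto
qed (auto intro: ok.intros)

lemma run_halted: "run w X Y t ([], s) = return_pmf ([], s)"
  by (induction t) (auto simp: bind_return_pmf)

text \<open>The second conjunct makes the induction work: once \<open>t\<close> has reached
  \<open>tmax\<close>, \<open>tmax - t\<close> no longer decreases, so a step taken then must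
  already have an exhausted budget.\<close>

lemma ok_sound:
  "ok cs s t e \<Longrightarrow>
    1 - e \<le> measure_pmf.prob (run w X Y (tmax - t) (cs, s)) {cfg. halted cfg \<and> G (snd cfg)} \<and>
    (tmax < t \<longrightarrow> 1 \<le> e)"
proof (induction rule: ok.induct)
  case (ok_halt s t e)
  then show ?case by (simp add: run_halted halted_def)
next
  case (ok_trivial e cs s t)
  then show ?case by (auto intro: order_trans[OF _ measure_nonneg])
next
  case (ok_det c cs s cs' s' t e)
  show ?case
  proof (cases "tmax \<le> t")
    case True
    then have "1 \<le> e" using ok_det.IH by simp
    then show ?thesis by (meson diff_le_0_iff_le measure_nonneg order_trans)
  next
    case False
    then have "tmax - t = Suc (tmax - Suc t)" by simp
    then show ?thesis using ok_det False by (simp add: bind_return_pmf)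
  qed
next
  case (ok_rand s a cs x t f e)
  let ?n = "expr_val w X Y s a"
  show ?case
  proof (cases "tmax \<le> t")
    case True
    have "(\<Sum>v\<le>?n. 1) \<le> (\<Sum>v\<le>?n. f v)"
      using ok_rand.IH True by (intro sum_mono) auto
    then have "1 \<le> (\<Sum>v\<le>?n. f v) / real (Suc ?n)" by simp
    then have "1 \<le> e" using ok_rand.hyps by linarith
    then show ?thesis by (meson diff_le_0_iff_le measure_nonneg order_trans)
  next
    case False
    let ?S = "{cfg. halted cfg \<and> G (snd cfg)}"
    let ?g = "\<lambda>v. (cs, s\<lparr>vars := (vars s)(x := v)\<rparr>)"
    have "tmax - t = Suc (tmax - Suc t)" using False by simp
    then have "measure_pmf.prob (run w X Y (tmax - t) (Rand x a # cs, s)) ?S =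
       (\<Sum>v\<in>{0..?n}. measure_pmf.prob (run w X Y (tmax - Suc t) (?g v)) ?S) / card {0..?n}"
      by (simp only: run.simps step.simps bind_map_pmf prob_bind_pmf_of_set finite_atLeastAtMost) 
         (subst prob_bind_pmf_of_set; simp)
    also have "\<dots> = (\<Sum>v\<le>?n. measure_pmf.prob (run w X Y (tmax - Suc t) (?g v)) ?S) / real (Suc ?n)"
      by (simp add: atLeast0AtMost)
    also have "\<dots> \<ge> (\<Sum>v\<le>?n. 1 - f v) / real (Suc ?n)"
      using ok_rand.IH by (intro divide_right_mono sum_mono) auto
    also have "(\<Sum>v\<le>?n. 1 - f v) / real (Suc ?n) = 1 - (\<Sum>v\<le>?n. f v) / real (Suc ?n)"
      by (simp add: sum_subtractf diff_divide_distrib)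
    finally show ?thesis using ok_rand.hyps False by linarith
  qed
qed

lemma ok_det_iff:
  assumes "step w X Y (c # cs, s) = return_pmf (cs', s')" "\<And>x a. c \<noteq> Rand x a"
  shows "ok (c # cs) s t e \<longleftrightarrow> ok cs' s' (Suc t) e"
proof
  assume "ok (c # cs) s t e"
  then show "ok cs' s' (Suc t) e"
    using assms by (cases rule: ok.cases) (auto intro: ok.ok_trivial)
qed (use assms in \<open>auto intro: ok.ok_det\<close>)

text \<open>As rewrite rules these execute straight-line code symbolically. Loops are left out
  because unfolding would not terminate, random choices because the distribution of the budget has
  to be invented.\<close>

lemma ok_simps [simp]:
  "ok (Skip # cs) s t e \<longleftrightarrow> ok cs s (Suc t) e"
  "ok (Assign x a # cs) s t e \<longleftrightarrow> ok cs (s\<lparr>vars := (vars s)(x := expr_val w X Y s a)\<rparr>) (Suc t) e"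
  "ok (Write n i a # cs) s t e \<longleftrightarrow>
    ok cs (s\<lparr>arrs := (arrs s)(n := (arrs s n)(expr_val w X Y s i := expr_val w X Y s a))\<rparr>) (Suc t) e"
  "ok (Seq c1 c2 # cs) s t e \<longleftrightarrow> ok (c1 # c2 # cs) s (Suc t) e"
  "ok (If a c1 c2 # cs) s t e \<longleftrightarrow>
    (if expr_val w X Y s a \<noteq> 0 then ok (c1 # cs) s (Suc t) e else ok (c2 # cs) s (Suc t) e)"
  by (rule ok_det_iff; simp)+ (cases "expr_val w X Y s a = 0"; subst ok_det_iff; simp)

lemma ok_while_iff:
  "ok (While a c # cs) s t e \<longleftrightarrow>
    (if expr_val w X Y s a \<noteq> 0 then ok (c # While a c # cs) s (Suc t) e else ok cs s (Suc t) e)"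
  by (cases "expr_val w X Y s a = 0"; subst ok_det_iff; simp)

text \<open>Time and error budget are arguments of the invariant because an iteration changes both.
  The body is verified together with its continuation, and may re-enter the loop in any state that
  satisfies \<open>I\<close> and has a smaller measure.\<close>

lemma ok_whileI:
  fixes \<mu> :: "store \<Rightarrow> nat"
  assumes "I s t e"
    and body: "\<And>s t e. I s t e \<Longrightarrow> expr_val w X Y s a \<noteq> 0 \<Longrightarrow>
      (\<And>s' t' e'. I s' t' e' \<Longrightarrow> \<mu> s' < \<mu> s \<Longrightarrow> ok (While a c # cs) s' t' e') \<Longrightarrow>
      ok (c # While a c # cs) s (Suc t) e"
    and exit: "\<And>s t e. I s t e \<Longrightarrow> expr_val w X Y s a = 0 \<Longrightarrow> ok cs s (Suc t) e"
  shows "ok (While a c # cs) s t e"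
  using assms(1)
proof (induction "\<mu> s" arbitrary: s t e rule: less_induct)
  case less
  then show ?case using body[OF less.prems] exit[OF less.prems]
    by (subst ok_while_iff) auto
qed

section \<open>Word arithmetic in the range where nothing wraps around\<close>

definition cap :: nat where "cap = 2 ^ w"

lemma cap_pos: "0 < cap" by (simp add: cap_def)

lemma word_simps [simp]:
  "a + b < cap \<Longrightarrow> binop_val w Add a b = a + b"
  "b \<le> a \<Longrightarrow> a < cap \<Longrightarrow> binop_val w Sub a b = a - b"
  "a * b < cap \<Longrightarrow> binop_val w Mul a b = a * b"
  "1 < cap \<Longrightarrow> binop_val w Less a b = of_bool (a < b)"
  "1 < cap \<Longrightarrow> binop_val w Eq a b = of_bool (a = b)"
  "binop_val w And (of_bool P) (of_bool Q) = of_bool (P \<and> Q)"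
  "binop_val w And (of_bool P) (Suc 0) = of_bool P"
  "binop_val w And (Suc 0) (of_bool P) = of_bool P"
  "binop_val w And (Suc 0) (Suc 0) = 1"
  "binop_val w And 0 a = 0"
  "binop_val w And a 0 = 0"
proof -
  show "binop_val w Sub a b = a - b" if "b \<le> a" "a < cap"
  proof -
    have "a + 2 ^ w - b = (a - b) + 2 ^ w" using that by simp
    then have "(a + 2 ^ w - b) mod 2 ^ w = (a - b) mod 2 ^ w" by (simp only: mod_add_self2)
    then show ?thesis using that by (simp add: cap_def)
  qed
qed (auto simp: cap_def)

lemma const_simp [simp]: "n < cap \<Longrightarrow> expr_val w X Y s (Const n) = n"
  by (simp add: cap_def)

declare binop_val.simps(1-3,6,11,12) [simp del]
declare expr_val.simps(1) [simp del]

end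

section \<open>Finding a mismatch by sampling block by block\<close>

section \<open>Testing one alignment by sampling\<close>

abbreviation add_expr (infixl "+." 65) where "a +. b \<equiv> Bin Add a b"
abbreviation sub_expr (infixl "-." 65) where "a -. b \<equiv> Bin Sub a b"
abbreviation mul_expr (infixl "*." 70) where "a *. b \<equiv> Bin Mul a b"
abbreviation div_expr (infixl "'/." 70) where "a /. b \<equiv> Bin Div a b"
abbreviation mod_expr (infixl "%." 70) where "a %. b \<equiv> Bin Mod a b"
abbreviation less_expr (infix "<." 50) where "a <. b \<equiv> Bin Less a b"
abbreviation eq_expr (infix "=." 50) where "a =. b \<equiv> Bin Eq a b"
abbreviation and_expr (infixr "&." 35) where "a &. b \<equiv> Bin And a b"
abbreviation not_expr ("!. _" [80] 80) where "!. a \<equiv> Bin Eq a (Const 0)"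
abbreviation assign_com (infix ":=." 30) where "x :=. a \<equiv> Assign x a"
abbreviation seq_com (infixr ";;" 25) where "c ;; d \<equiv> Seq c d"

definition frame :: "nat set \<Rightarrow> store \<Rightarrow> store \<Rightarrow> bool" where
  "frame V s s' \<longleftrightarrow> arrs s' = arrs s \<and> (\<forall>u. u \<notin> V \<longrightarrow> vars s' u = vars s u)"

lemma frame_refl: "frame V s s" by (simp add: frame_def)
lemma frame_simps [simp]:
  "u \<in> V \<Longrightarrow> frame V s (s'\<lparr>vars := f(u := a)\<rparr>) \<longleftrightarrow> frame V s (s'\<lparr>vars := f\<rparr>)"
  "frame V s (s'\<lparr>vars := vars s'\<rparr>) \<longleftrightarrow> frame V s s'"
  by (auto simp: frame_def)

text \<open>
  Machine variables: 3 holds the number \<open>T\<close> of samples per block, 4 holds \<open>h\<close>, 6 the current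
  position \<open>x\<close> in \<open>X\<close>, 7 the position \<open>y\<close> reached so far, 8 the number of the phase, 9 the first
  alignment \<open>v0\<close> of the current group, 31 the answer. A probe tests the alignment in variable 14
  and leaves the offset it reached in 15; 16 tells whether it stopped at a mismatch.
\<close>

definition probe_body :: com where
  "probe_body =
    (Rand 19 (Var 4);;
     19 :=. Var 17 +. Var 19;;
     If ((Var 19 <. Var 20) &. !. (CharX (Var 6 +. Var 19) =. CharY (Var 14 +. Var 19)))
       (16 :=. Const 1;; 15 :=. Var 19)
       (18 :=. Var 18 +. Const 1;;
        If (Var 18 =. Var 3) (18 :=. Const 0;; 17 :=. Var 17 +. (Var 4 +. Const 1)) Skip))"

text \<open>Variables 17 to 20 hold the start of the current block, the number of samples already
  taken from it, the sampled position, and the length of the overlap of the two strings. The last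
  block may stick out of the overlap; samples outside count as matches.\<close>

definition probe :: com where
  "probe =
    (If (Var 0 -. Var 6 <. Var 1 -. Var 14) (20 :=. Var 0 -. Var 6) (20 :=. Var 1 -. Var 14);;
     17 :=. Const 0;; 18 :=. Const 0;; 16 :=. Const 0;; 15 :=. Var 20;;
     While (!. (Var 16) &. (Var 17 <. Var 20)) probe_body)"

text \<open>The input size is below \<open>2 ^ \<beta>\<close>, so \<beta> bounds the halvings of a
  binary search, and \<open>\<beta> \<le> T\<close> lets their cost be absorbed by that of sampling.
  The factor 16 is headroom for sums of several positions and window lengths.\<close>

locale gap_ram = word_ram +
  fixes k h T \<beta> :: nat
  assumes h_def: "h = k div 2" and T_pos: "0 < T" and k_less: "k \<le> length X + length Y"
    and cap_big: "16 * (length X + length Y + 1) + T < cap"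
    and beta: "length X + length Y + 1 < 2 ^ \<beta>" and beta_le: "\<beta> \<le> T"
begin

abbreviation "n \<equiv> length X"
abbreviation "m \<equiv> length Y"

text \<open>At most 12 steps per sample; the summand \<open>12 * T\<close> pays for the block in
  which the probe stops.\<close>

definition probe_cost :: "nat \<Rightarrow> nat" where
  "probe_cost i = 12 * (T * (i div (h + 1))) + 12 * T + 16"

text \<open>One sample from a block with \<open>c\<close> mismatches among \<open>B\<close> positions preserves the error budget.\<close>

lemma exp_avg:
  fixes e \<Phi> :: real
  assumes "c \<le> B" "0 < B" "0 \<le> \<Phi>"
  shows "(c * e + (B - c) * (e + \<Phi> * exp (c / B))) / B \<le> e + \<Phi>"
proof -
  have "1 - c / B \<le> exp (- (c / B))" using exp_ge_add_one_self[of "- (c / B)"] by simp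
  then have "(1 - c / B) * exp (c / B) \<le> exp (- (c / B)) * exp (c / B)"
    by (intro mult_right_mono) auto
  also have "\<dots> = 1" by (simp flip: exp_add)
  finally have "(1 - c / B) * exp (c / B) * \<Phi> \<le> 1 * \<Phi>" using assms by (intro mult_right_mono)
  moreover have "(c * e + (B - c) * (e + \<Phi> * exp (c / B))) / B = e + (1 - c / B) * exp (c / B) * \<Phi>"
    using assms by (simp add: field_simps)
  ultimately show ?thesis by simp
qed

text \<open>
  Blocks have length \<open>h + 1\<close>. Having overlooked \<open>h + 1\<close> mismatches in complete blocks has
  probability at most \<open>exp (- T)\<close>; otherwise there are at most \<open>h\<close> mismatches in complete blocks
  and at most \<open>h\<close> more in the block where the probe stops. The potential \<open>\<Phi> b r\<close> is the error
  budget after \<open>r\<close> samples from the block starting at \<open>b\<close>; it reaches 1 when the probe has failed.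
\<close>

lemma ok_probe:
  assumes s: "vars s 0 = n" "vars s 1 = m" "vars s 3 = T" "vars s 4 = h" "vars s 6 = x" "vars s 14 = v"
    and x: "x \<le> n" and v: "v \<le> m" and e: "0 \<le> e"
    and post: "\<And>s' t' i f. frame {15..20} s s' \<Longrightarrow> vars s' 15 = i \<Longrightarrow> vars s' 16 = of_bool f \<Longrightarrow>
      i \<le> min (n - x) (m - v) \<Longrightarrow> (f \<Longrightarrow> i < min (n - x) (m - v) \<and> i \<in> mism X Y x v) \<Longrightarrow>
      (\<not> f \<Longrightarrow> i = min (n - x) (m - v)) \<Longrightarrow> card (mism X Y x v \<inter> {..<i}) \<le> 2 * h \<Longrightarrow>
      t' \<le> t + probe_cost i \<Longrightarrow> ok cs s' t' e"
  shows "ok (probe # cs) s t (e + exp (- real T))"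
proof -
  define E where "E = min (n - x) (m - v)"
  note post' = post[folded E_def]
  define A where "A = mism X Y x v \<inter> {..<E}"
  define B where "B = h + 1"
  define H where "H b = {q. q \<le> h \<and> b + q \<in> A}" for b
  define M where "M b = card (A \<inter> {..<b})" for b
  define \<Phi> where "\<Phi> b r = exp (- real T + (real T * M b + real r * card (H b)) / B)" for b r
  have finA: "finite A" by (simp add: A_def)
  have finH: "finite (H b)" "card (H b) \<le> B" for b
    using card_mono[of "{..h}" "H b"] by (auto simp: H_def B_def)
  have hB: "h < cap" "1 < cap" "E \<le> n" "E \<le> m" "x + E \<le> n" "v + E \<le> m" "h \<le> n + m"
    using cap_big k_less h_def x v by (auto simp: E_def)
  have M_step: "M (b + B) = M b + card (H b)" for b
  proof -
    have "i \<in> (\<lambda>q. b + q) ` H b" if "i \<in> A" "i < b + B" "\<not> i < b" for i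
      using that by (intro image_eqI[of _ _ "i - b"]) (auto simp: H_def B_def)
    then have "A \<inter> {..<b + B} = (A \<inter> {..<b}) \<union> (\<lambda>q. b + q) ` H b"
      by (auto simp: H_def B_def)
    moreover have "card ((A \<inter> {..<b}) \<union> (\<lambda>q. b + q) ` H b) = card (A \<inter> {..<b}) + card ((\<lambda>q. b + q) ` H b)"
      using finA finH by (intro card_Un_disjoint) auto
    ultimately show ?thesis by (simp add: M_def card_image)
  qed
  have \<Phi>_ge: "1 \<le> \<Phi> b r" if "B \<le> M b" for b r
  proof -
    have "T * B \<le> T * M b + r * card (H b)" using that by (simp add: trans_le_add1)
    then have "real T * B \<le> real T * M b + r * card (H b)" by (metis of_nat_mono of_nat_mult of_nat_add)
    then have "real T \<le> (real T * M b + r * card (H b)) / B"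
      by (simp add: pos_le_divide_eq B_def)
    then show ?thesis by (simp add: \<Phi>_def)
  qed
  have \<Phi>_Suc: "\<Phi> b (Suc r) = \<Phi> b r * exp (card (H b) / B)" for b r
    by (simp add: \<Phi>_def add_divide_distrib algebra_simps flip: exp_add)
  have \<Phi>_next: "\<Phi> (b + B) 0 = \<Phi> b T" for b
    by (simp add: \<Phi>_def M_step distrib_left)
  define I where "I = (\<lambda>s' t' e'. frame {15..20} s s' \<and> vars s' 20 = E \<and>
    (let b = vars s' 17; r = vars s' 18; i = vars s' 15 in
      (vars s' 16 = 0 \<and> i = E \<and> r < T \<and> (E \<le> b \<longrightarrow> r = 0) \<and> B dvd b \<and> b \<le> E + h \<and> e + \<Phi> b r \<le> e' \<and>
         t' \<le> t + 13 + 12 * (T * (b div B)) + 12 * r) \<or>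
      (vars s' 16 = 1 \<and> i \<in> A \<and> card (mism X Y x v \<inter> {..<i}) \<le> 2 * h \<and> e \<le> e' \<and>
         t' \<le> t + 13 + 12 * (T * (i div B)) + 12 * T)))"
  \<comment> \<open>A lexicographic measure flattened into one number: remaining blocks have weight
    \<open>Suc T\<close>, which exceeds the number of samples within a block.\<close>
  define \<mu> where "\<mu> s' = (if vars s' 16 = 0 then Suc ((E + B - vars s' 17) * Suc T - vars s' 18) else 0)" for s' :: store
  have loop: "ok (While (!. (Var 16) &. (Var 17 <. Var 20)) probe_body # cs) s' t' e'" if "I s' t' e'" for s' t' e'
  proof (rule ok_whileI[where I = I and \<mu> = \<mu>, OF that])
    fix s' t' e' assume I: "I s' t' e'" and "expr_val w X Y s' (!. (Var 16) &. (Var 17 <. Var 20)) = 0"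
    then have c: "vars s' 16 \<noteq> 0 \<or> E \<le> vars s' 17" using hB by (simp add: I_def not_less)
    show "ok cs s' (Suc t') e'"
    proof (cases "vars s' 16 = 0")
      case True
      then have I': "frame {15..20} s s'" "vars s' 15 = E" "E \<le> vars s' 17" "vars s' 18 = 0" "B dvd vars s' 17"
        "vars s' 17 \<le> E + h" "e + \<Phi> (vars s' 17) (vars s' 18) \<le> e'"
        "t' \<le> t + 13 + 12 * (T * (vars s' 17 div B)) + 12 * vars s' 18"
        using I c by (auto simp: I_def Let_def)
      show ?thesis
      proof (cases "B \<le> M (vars s' 17)")
        case True
        then show ?thesis using \<Phi>_ge[of "vars s' 17" "vars s' 18"] I' e by (intro ok_trivial) linarith
      next
        case False
        have "A \<inter> {..<vars s' 17} = mism X Y x v \<inter> {..<E}" using I' by (auto simp: A_def)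
        then have "card (mism X Y x v \<inter> {..<E}) \<le> 2 * h" using False by (simp add: M_def B_def)
        moreover have "vars s' 17 div B \<le> E div B + 1"
        proof -
          have "vars s' 17 div B \<le> (E + B) div B" using I' by (intro div_le_mono) (simp add: B_def)
          moreover have "0 < B" by (simp add: B_def)
          ultimately show ?thesis by simp
        qed
        then have "T * (vars s' 17 div B) \<le> T * (E div B + 1)" by (rule mult_le_mono2)
        then have "Suc t' \<le> t + probe_cost E"
          using I' by (simp add: probe_cost_def B_def)
        ultimately have "ok cs s' (Suc t') e"
          using True I' by (intro post'[of s' E False "Suc t'"]) auto
        moreover have "e \<le> e'" using I' exp_ge_zero[of "- real T + (real T * M (vars s' 17) + real (vars s' 18) * card (H (vars s' 17))) / B"]
          unfolding \<Phi>_def by linarith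
        ultimately show ?thesis by (rule ok_mono)
      qed
    next
      case False
      then have I': "frame {15..20} s s'" "vars s' 16 = 1" "vars s' 15 \<in> A" 
        "card (mism X Y x v \<inter> {..<vars s' 15}) \<le> 2 * h" "e \<le> e'"
        "t' \<le> t + 13 + 12 * (T * (vars s' 15 div B)) + 12 * T"
        using I by (auto simp: I_def Let_def)
      have "ok cs s' (Suc t') e"
        using I' by (intro post'[of s' "vars s' 15" True "Suc t'"]) (auto simp: A_def probe_cost_def B_def)
      then show ?thesis using I'(5) by (rule ok_mono)
    qed
  next
    fix s' t' e' assume I: "I s' t' e'" and "expr_val w X Y s' (!. (Var 16) &. (Var 17 <. Var 20)) \<noteq> 0"
      and IH: "\<And>s'' t'' e''. I s'' t'' e'' \<Longrightarrow> \<mu> s'' < \<mu> s' \<Longrightarrow>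
        ok (While (!. (Var 16) &. (Var 17 <. Var 20)) probe_body # cs) s'' t'' e''"
    then have c: "vars s' 16 = 0" "vars s' 17 < E" using hB by (auto simp: I_def)
    define b where "b = vars s' 17"
    define r where "r = vars s' 18"
    have I': "frame {15..20} s s'" "vars s' 20 = E" "vars s' 15 = E" "r < T" "B dvd b"
        "b < E" "e + \<Phi> b r \<le> e'"
        "t' \<le> t + 13 + 12 * (T * (b div B)) + 12 * r"
        using I c by (auto simp: I_def Let_def b_def r_def)
    have vs: "vars s' 3 = T" "vars s' 4 = h" "vars s' 6 = x" "vars s' 14 = v" 
      using I'(1) s by (auto simp: frame_def)
    show "ok (probe_body # While (!. (Var 16) &. (Var 17 <. Var 20)) probe_body # cs) s' (Suc t') e'"
    proof (cases "B \<le> M b")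
      case True
      then have "1 \<le> \<Phi> b r" by (rule \<Phi>_ge)
      then show ?thesis using I' e by (intro ok_trivial) linarith
    next
      case False0: False
      have fin: "ok (While (!. (Var 16) &. (Var 17 <. Var 20)) probe_body # cs) s'' t'' e''"
        if "I s'' t'' e''" "\<mu> s'' < \<mu> s'" for s'' t'' e'' using IH that by blast
      show ?thesis
        apply (subst probe_body_def)
        apply (simp)
        \<comment> \<open>A sample that hits a mismatch carries no further risk beyond
          \<open>e\<close>, so its share of the potential is handed to the samples that
          miss.\<close>
        apply (rule ok_rand[where f = "\<lambda>q. if q \<in> H b then e else e + \<Phi> b (Suc r)"])
        subgoal premises q for q
        proof -
          from q have q: "q \<le> h" using vs by simp
          have lt: "b + q < cap" "Suc h < cap" "b + Suc h < cap" "x + (b + q) < cap" "v + (b + q) < cap" "r + 1 < cap" "T < cap"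
            using cap_big hB \<open>r < T\<close> \<open>b < E\<close> q x v by auto
          have H: "(b + q < E \<and> char_at X (x + (b + q)) \<noteq> char_at Y (v + (b + q))) = (q \<in> H b)"
            using q by (simp add: H_def A_def mism_def conj_commute)
          show ?thesis
          proof (cases "q \<in> H b")
            case True
            have "card (mism X Y x v \<inter> {..<b + q}) \<le> card ((A \<inter> {..<b}) \<union> {b..<b + q})"
              using True finA by (intro card_mono) (auto simp: A_def H_def)
            also have "\<dots> \<le> M b + q" using card_Un_le[of "A \<inter> {..<b}" "{b..<b + q}"] by (simp add: M_def)
            also have "\<dots> \<le> 2 * h" using False0 q by (simp add: B_def)
            finally have card: "card (mism X Y x v \<inter> {..<b + q}) \<le> 2 * h" .
            have "T * (b div B) \<le> T * ((b + q) div B)" by (intro mult_le_mono2 div_le_mono) simp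
            then have time: "t' \<le> 4 + (t + (12 * T + 12 * (T * ((b + q) div B))))"
              using I'(4,8) by linarith
            have "b + q \<in> A" using True by (simp add: H_def)
            then show ?thesis
              using vs I'(2,3) lt hB H True
              apply (simp flip: b_def r_def)
              apply (rule fin)
               using card time I'(1,2) e apply (simp_all add: I_def \<mu>_def c)
              done
          next
            case False
            have B: "Suc (b + h) = b + B" "0 < B" by (auto simp: B_def)
            have \<mu>': "\<mu> s' = Suc ((E + B - b) * Suc T - r)" using c by (simp add: \<mu>_def b_def r_def)
            have "E + B - (b + B) + B = E + B - b" using I' by simp
            then have "(E + B - b) * Suc T = (E + B - (b + B)) * Suc T + B * Suc T" by (metis distrib_right)
            moreover have "r < B * Suc T" using I'(4) B by (cases B) auto
            ultimately have \<mu>1: "(E + B - (b + B)) * Suc T < (E + B - b) * Suc T - r" "r < (E + B - b) * Suc T" by linarith+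
            have dvd: "B dvd Suc (b + h)" unfolding B(1) using I' by simp
            have next\<Phi>: "\<Phi> (Suc (b + h)) 0 = \<Phi> b T" unfolding B(1) by (rule \<Phi>_next)
            have "12 * (T * (Suc (b + h) div B)) = 12 * (T * (b div B)) + 12 * T" unfolding B(1) using B(2) by simp
            then have time: "t' \<le> Suc (t + 12 * (T * (Suc (b + h) div B)))" if "Suc r = T"
              using I'(8) that by linarith
            show ?thesis
              using vs I'(2,3) lt hB H False
              apply (simp flip: b_def r_def)
              apply (intro conjI impI fin)
              subgoal
                using I'(1-3,6) dvd time c(1) next\<Phi> by (simp add: I_def Let_def)
              subgoal
                unfolding \<mu>' using \<mu>1 c by (simp add: \<mu>_def B(1))
              subgoal
                using I' by (simp add: I_def Let_def c flip: b_def)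
              subgoal
                unfolding \<mu>' using \<mu>1(2) c by (simp add: \<mu>_def flip: b_def)
              done
          qed
        qed
        subgoal
        proof -
          have "(\<Sum>q\<le>h. if q \<in> H b then e else e + \<Phi> b (Suc r)) =
            (\<Sum>q\<in>H b. e) + (\<Sum>q\<in>{..h} - H b. e + \<Phi> b (Suc r))"
            by (subst sum.subset_diff[of "H b"]) (auto simp: H_def)
          also have "\<dots> = card (H b) * e + (real B - card (H b)) * (e + \<Phi> b (Suc r))"
          proof -
            have "card ({..h} - H b) = B - card (H b)"
              by (subst card_Diff_subset) (auto simp: H_def B_def)
            then show ?thesis using finH[of b] by (simp add: of_nat_diff)
          qed
          finally have "(\<Sum>q\<le>h. if q \<in> H b then e else e + \<Phi> b (Suc r)) / real (Suc h) \<le> e + \<Phi> b r"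
            using exp_avg[of "card (H b)" B "\<Phi> b r" e] finH[of b] by (simp add: \<Phi>_Suc B_def) (simp add: \<Phi>_def)
          then show ?thesis using I' vs by simp
        qed
        done
    qed
  qed
  have init: "\<Phi> 0 0 = exp (- real T)" by (simp add: \<Phi>_def M_def)
  have E: "(if n - x < m - v then n - x else m - v) = E" by (simp add: E_def)
  have "I (s\<lparr>vars := (vars s)(20 := E, 17 := 0, 18 := 0, 16 := 0, 15 := E)\<rparr>) t' (e + exp (- real T))"
    if "t' \<le> t + 13" for t'
    using that T_pos by (simp add: I_def init frame_refl)
  from loop[OF this] show ?thesis
    unfolding probe_def using s hB x v cap_big E by (simp split: if_splits)
qed

end

section \<open>Exact pattern matching by the Z-function\<close>

section \<open>Exact occurrences of a window\<close>

definition vframe :: "nat set \<Rightarrow> store \<Rightarrow> store \<Rightarrow> bool" where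
  "vframe V s s' \<longleftrightarrow> (\<forall>u. u \<notin> V \<longrightarrow> vars s' u = vars s u)"

lemma vframe_simps [simp]:
  "u \<in> V \<Longrightarrow> vframe V s (s'\<lparr>vars := f(u := a)\<rparr>) \<longleftrightarrow> vframe V s (s'\<lparr>vars := f\<rparr>)"
  "vframe V s (s'\<lparr>vars := vars s'\<rparr>) \<longleftrightarrow> vframe V s s'"
  "u \<in> V \<Longrightarrow> vframe V s (s'\<lparr>vars := f(u := a), arrs := g\<rparr>) \<longleftrightarrow> vframe V s (s'\<lparr>vars := f, arrs := g\<rparr>)"
  "vframe V s (s'\<lparr>vars := vars s', arrs := g\<rparr>) \<longleftrightarrow> vframe V s s'"
  "vframe V s (s'\<lparr>arrs := g, vars := vars s'\<rparr>) \<longleftrightarrow> vframe V s s'"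
  "vframe V s (s'\<lparr>arrs := g\<rparr>) \<longleftrightarrow> vframe V s s'"
  by (auto simp: vframe_def)

lemma vframe_refl: "vframe V s s" by (simp add: vframe_def)
lemma frame_vframe: "frame V s s' \<Longrightarrow> vframe V s s'" by (simp add: vframe_def frame_def)

text \<open>The window of \<open>X\<close> is followed by the \<open>3 * h\<close> characters that
  the \<open>h + 1\<close> windows of \<open>Y\<close> cover together. There is no separator, so a
  Z-value may exceed \<open>2 * h\<close>, and an occurrence is recognized by an inequality.\<close>

definition fill_array_body :: com where
  "fill_array_body =
    (If (Var 10 <. Var 4 +. Var 4) (Write 1 (Var 10) (CharX (Var 6 +. Var 10))) Skip;;
     Write 1 (Var 4 +. Var 4 +. Var 10) (CharY (Var 9 +. Var 10));;
     10 :=. Var 10 +. Const 1)"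

definition fill_array :: com where
  "fill_array = (10 :=. Const 0;; While (Var 10 <. Var 4 +. Var 4 +. Var 4) fill_array_body)"

text \<open>The value at \<open>j\<close> of the Z-function of the word
  \<open>f 0, ..., f (N - 1)\<close>: the length of the longest common prefix of the word and its
  suffix at \<open>j\<close>.\<close>

definition is_Z :: "(nat \<Rightarrow> nat) \<Rightarrow> nat \<Rightarrow> nat \<Rightarrow> nat \<Rightarrow> bool" where
  "is_Z f N j z \<longleftrightarrow> j + z \<le> N \<and> (\<forall>i<z. f i = f (j + i)) \<and> (j + z < N \<longrightarrow> f z \<noteq> f (j + z))"

abbreviation "zlen \<equiv> Var 4 +. Var 4 +. Var 4 +. Var 4 +. Var 4"

text \<open>Variables 10 to 13 hold the index, the box given by its start and end, and the tentative
  Z-value. The usual inner comparison loop is merged into the outer one, so that an iteration either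
  extends the value by one or stores it.\<close>

definition zalg_body :: com where
  "zalg_body =
    (If (!. (Var 10 +. Var 13 <. Var 12) &. (Var 10 +. Var 13 <. zlen) &.
         (Read 1 (Var 13) =. Read 1 (Var 10 +. Var 13)))
      (13 :=. Var 13 +. Const 1)
      (Write 0 (Var 10) (Var 13);;
       If (Var 12 <. Var 10 +. Var 13) (11 :=. Var 10;; 12 :=. Var 10 +. Var 13) Skip;;
       10 :=. Var 10 +. Const 1;;
       If (Var 10 <. Var 12)
         (13 :=. Read 0 (Var 10 -. Var 11);; If (Var 12 -. Var 10 <. Var 13) (13 :=. Var 12 -. Var 10) Skip)
         (13 :=. Const 0)))"

definition zalg :: com where
  "zalg = (10 :=. Const 1;; 11 :=. Const 0;; 12 :=. Const 0;; 13 :=. Const 0;;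
     While (Var 10 <. zlen) zalg_body)"

definition scan :: com where
  "scan = (fill_array;; zalg)"

context gap_ram
begin

lemma small_numbers: "h \<le> n + m" "15 * n + 15 * m + 15 < cap" "2 * h \<le> k"
  using cap_big k_less h_def by auto

declare cap_pos [simp]

lemma ok_fill_array:
  assumes s: "vars s 4 = h" "vars s 6 = x" "vars s 9 = v0"
    and x: "x \<le> n" and v0: "v0 \<le> x + k"
    and post: "\<And>s' t'. vframe {10} s s' \<Longrightarrow> (\<And>i. i < 2 * h \<Longrightarrow> arrs s' 1 i = char_at X (x + i)) \<Longrightarrow>
      (\<And>i. i < 3 * h \<Longrightarrow> arrs s' 1 (2 * h + i) = char_at Y (v0 + i)) \<Longrightarrow> t' \<le> t + 24 * h + 10 \<Longrightarrow> ok cs s' t' e"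
  shows "ok (fill_array # cs) s t e"
proof -
  define I where "I = (\<lambda>s' t' e'. vframe {10} s s' \<and> vars s' 10 \<le> 3 * h \<and> e' = e \<and>
     (\<forall>i<2 * h. i < vars s' 10 \<longrightarrow> arrs s' 1 i = char_at X (x + i)) \<and>
     (\<forall>i<vars s' 10. arrs s' 1 (2 * h + i) = char_at Y (v0 + i)) \<and> t' \<le> t + 3 + 8 * vars s' 10)"
  have *: "h + h < cap" "h + h + h < cap" "1 < cap" 
    "i \<le> 3 * h \<Longrightarrow> i + 1 < cap" "i \<le> 3 * h \<Longrightarrow> x + i < cap" "i \<le> 3 * h \<Longrightarrow> v0 + i < cap" "i \<le> 3 * h \<Longrightarrow> h + h + i < cap" for i
    using small_numbers x v0 k_less by auto
  have "ok (While (Var 10 <. Var 4 +. Var 4 +. Var 4) fill_array_body # cs) s' t' e'" if "I s' t' e'" for s' t' e'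
  proof (rule ok_whileI[where I = I and \<mu> = "\<lambda>s'. 3 * h - vars s' 10", OF that])
    fix s' t' e' assume I: "I s' t' e'" and c: "expr_val w X Y s' (Var 10 <. Var 4 +. Var 4 +. Var 4) = 0"
    have "vars s' 4 = h" using I s by (auto simp: I_def vframe_def)
    then have "vars s' 10 = 3 * h" using I c * by (auto simp: I_def)
    then show "ok cs s' (Suc t') e'" using I by (auto simp: I_def intro!: post)
  next
    fix s' t' e' assume I: "I s' t' e'" and c: "expr_val w X Y s' (Var 10 <. Var 4 +. Var 4 +. Var 4) \<noteq> 0"
      and IH: "\<And>s'' t'' e''. I s'' t'' e'' \<Longrightarrow> 3 * h - vars s'' 10 < 3 * h - vars s' 10 \<Longrightarrow>
        ok (While (Var 10 <. Var 4 +. Var 4 +. Var 4) fill_array_body # cs) s'' t'' e''"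
    have vs: "vars s' 4 = h" "vars s' 6 = x" "vars s' 9 = v0" using I s by (auto simp: I_def vframe_def)
    then have c: "vars s' 10 < 3 * h" using c * by auto
    show "ok (fill_array_body # While (Var 10 <. Var 4 +. Var 4 +. Var 4) fill_array_body # cs) s' (Suc t') e'"
      apply (subst fill_array_body_def)
      using *(1-3) *(4-7)[of "vars s' 10"] vs c I
      apply simp
      apply (intro conjI impI IH)
      apply (simp_all add: I_def less_Suc_eq)
      done
  qed
  moreover have "I (s\<lparr>vars := (vars s)(10 := 0)\<rparr>) t' e" if "t' \<le> t + 3" for t' 
    using that by (simp add: I_def vframe_refl)
  ultimately show ?thesis unfolding fill_array_def using * by simp
qed

text \<open>
  The last conjunct about \<open>z\<close> in the invariant says that a value copied from inside the box
  \<open>{l..<r}\<close> needs no comparison. So every comparison that succeeds moves \<open>max r (i + z)\<close>.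
\<close>

lemma ok_zalg:
  assumes s: "vars s 4 = h"
    and post: "\<And>s' t'. vframe {10..13} s s' \<Longrightarrow> 
      (\<And>j. 1 \<le> j \<Longrightarrow> j < 5 * h \<Longrightarrow> is_Z (arrs s 1) (5 * h) j (arrs s' 0 j)) \<Longrightarrow>
      t' \<le> t + 200 * h + 60 \<Longrightarrow> ok cs s' t' e"
  shows "ok (zalg # cs) s t e"
proof -
  define f where "f = arrs s 1"
  define N where "N = 5 * h"
  \<comment> \<open>Every iteration increases this quantity, whether it extends or stores. It is
    bounded by about \<open>2 * N\<close>, and thus serves as termination measure and, at 18 steps
    per unit, as clock.\<close>
  define \<phi> where "\<phi> s' = vars s' 10 + max (vars s' 12) (vars s' 10 + vars s' 13)" for s' :: store
  define box where "box l r \<longleftrightarrow> (\<forall>a. l \<le> a \<longrightarrow> a < r \<longrightarrow> f (a - l) = f a)" for l r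
  define pre where "pre i z \<longleftrightarrow> (\<forall>a<z. f a = f (i + a))" for i z
  \<comment> \<open>The case \<open>N < i\<close> arises only for \<open>h = 0\<close>, where the
    initial index 1 already lies beyond the empty word.\<close>
  define I where "I = (\<lambda>s' t' e'. vframe {10..13} s s' \<and> arrs s' 1 = f \<and> e' = e \<and>
     (let i = vars s' 10; l = vars s' 11; r = vars s' 12; z = vars s' 13 in
     1 \<le> i \<and> l < i \<and> (l = 0 \<longrightarrow> r = 0) \<and> r \<le> N \<and> (i \<le> N \<longrightarrow> i + z \<le> N) \<and> (N < i \<longrightarrow> i = 1 \<and> z = 0) \<and>
     (\<forall>j. 1 \<le> j \<longrightarrow> j < i \<longrightarrow> j < N \<longrightarrow> is_Z f N j (arrs s' 0 j)) \<and>
     box l r \<and> pre i z \<and>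
     (i + z < r \<longrightarrow> f z \<noteq> f (i + z)) \<and> 
     t' \<le> t + 9 + 18 * (i + max r (i + z))))"
  have small': "5 * h + 1 < cap" using small_numbers k_less by linarith
  have *: "h + h < cap" "h + h + h < cap" "h + h + h + h < cap" "h + h + h + h + h < cap" "1 < cap"
    "h + h + h + h + h = N" "N < cap" "i \<le> N \<Longrightarrow> i < cap" "i \<le> N \<Longrightarrow> Suc i < cap" for i
    using small' by (auto simp: N_def)
  have "ok (While (Var 10 <. zlen) zalg_body # cs) s' t' e'" if "I s' t' e'" for s' t' e'
  proof (rule ok_whileI[where I = I and \<mu> = "\<lambda>s'. 2 * N - \<phi> s'", OF that])
    fix s' t' e' assume I: "I s' t' e'" and c: "expr_val w X Y s' (Var 10 <. zlen) = 0"
    have "vars s' 4 = h" using I s by (auto simp: I_def vframe_def)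
    then have "N \<le> vars s' 10" using I c * by (auto simp: I_def)
    moreover have "vars s' 10 + max (vars s' 12) (vars s' 10 + vars s' 13) \<le> 2 * N + 2"
      using I by (auto simp: I_def Let_def)
    ultimately show "ok cs s' (Suc t') e'" using I unfolding I_def Let_def
      by (auto simp: f_def N_def intro!: post)
  next
    fix s' t' e' assume I: "I s' t' e'" and c: "expr_val w X Y s' (Var 10 <. zlen) \<noteq> 0"
      and IH: "\<And>s'' t'' e''. I s'' t'' e'' \<Longrightarrow> 2 * N - \<phi> s'' < 2 * N - \<phi> s' \<Longrightarrow>
        ok (While (Var 10 <. zlen) zalg_body # cs) s'' t'' e''"
    define i where "i = vars s' 10"
    define l where "l = vars s' 11"
    define r where "r = vars s' 12"
    define z where "z = vars s' 13"
    define Z where "Z = arrs s' 0"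
    have vs: "vars s' 4 = h" using I s by (auto simp: I_def vframe_def)
    then have c: "i < N" using c * by (auto simp: i_def)
    have I': "vframe {10..13} s s'" "arrs s' 1 = f" "e' = e" "1 \<le> i" "l < i" "l = 0 \<Longrightarrow> r = 0" "r \<le> N" "i + z \<le> N"
      "\<And>j. 1 \<le> j \<Longrightarrow> j < i \<Longrightarrow> is_Z f N j (Z j)"
      "box l r" "pre i z"
      "i + z < r \<Longrightarrow> f z \<noteq> f (i + z)"
      "t' \<le> t + 9 + 18 * (i + max r (i + z))"
      using I c by (auto simp: I_def Let_def i_def l_def r_def z_def Z_def)
    have phi: "\<phi> s' = i + max r (i + z)" by (simp add: \<phi>_def i_def r_def z_def)
    have lt: "i + z < cap" "Suc z < cap" "Suc i < cap" "r < cap" "Suc i < r \<Longrightarrow> l \<le> Suc i"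
      using I' c *(8,9) by auto
    show "ok (zalg_body # While (Var 10 <. zlen) zalg_body # cs) s' (Suc t') e'"
    proof (cases "\<not> i + z < r \<and> i + z < N \<and> f z = f (i + z)")
      case True
      have "pre i (Suc z)" using I'(11) True by (auto simp: pre_def less_Suc_eq)
      then have "I (s'\<lparr>vars := (vars s')(13 := Suc z)\<rparr>) t'' e" if "t'' \<le> t' + 10" for t''
        using that I' c True by (auto simp: I_def simp flip: i_def l_def r_def z_def Z_def)
      moreover have "\<phi> (s'\<lparr>vars := (vars s')(13 := Suc z)\<rparr>) = Suc (\<phi> s')"
        using True by (auto simp: phi \<phi>_def simp flip: i_def r_def z_def)
      moreover have "\<phi> s' < 2 * N" using True c I' by (auto simp: phi)
      ultimately show ?thesis
        apply (subst zalg_body_def)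
        using *(1-7) lt(1,2) vs I'(2,3) True
        by (simp flip: i_def l_def r_def z_def Z_def) (intro IH; simp)
    next
      case False
      have Z: "is_Z f N i z" unfolding is_Z_def using I'(8,11,12) False unfolding pre_def by blast
      define l' where "l' = (if r < i + z then i else l)"
      define r' where "r' = (if r < i + z then i + z else r)"
      define Z' where "Z' = Z(i := z)"
      define z' where "z' = (if Suc i < r' then min (r' - Suc i) (Z' (Suc i - l')) else 0)"
      have Z': "is_Z f N j (Z' j)" if "1 \<le> j" "j < Suc i" for j
        using that I'(9) Z by (auto simp: Z'_def less_Suc_eq)
      have box': "box l' r'" using I'(10,11) unfolding l'_def r'_def box_def pre_def by auto
      have lr: "l' < Suc i" "r' \<le> N" "l' = 0 \<Longrightarrow> r' = 0" using I'(4-8) by (auto simp: l'_def r'_def split: if_splits)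
      have z': "Suc i + z' \<le> N" "pre (Suc i) z'" "Suc i + z' < r' \<Longrightarrow> f z' \<noteq> f (Suc i + z')" "z' = 0 \<or> Suc i + z' \<le> r'"
      proof -
        show "z' = 0 \<or> Suc i + z' \<le> r'" by (auto simp: z'_def)
        then show "Suc i + z' \<le> N" using lr c by auto
        define d where "d = Suc i - l'"
        have box1: "f (d + a) = f (Suc i + a)" if "Suc i + a < r'" for a
          using box' that lr unfolding box_def d_def by (metis Suc_leI Suc_diff_le add_Suc diff_Suc_Suc diff_add_assoc2 le_add1 le_trans less_imp_le)
        have d: "is_Z f N d (Z' d)" if "Suc i < r'"
        proof (rule Z')
          \<comment> \<open>Only the empty initial box starts at 0. Any other start makes the copied
            entry \<open>d\<close> an earlier one, which is already stored.\<close>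
          have "l' \<noteq> 0" using lr(3) that by auto
          then show "1 \<le> d" "d < Suc i" using lr(1) unfolding d_def by linarith+
        qed
        show "pre (Suc i) z'" unfolding pre_def
        proof (intro allI impI)
          fix a assume a: "a < z'"
          then have r': "Suc i < r'" by (auto simp: z'_def split: if_splits)
          then have "Suc i + a < r'" "a < Z' d" using a by (auto simp: z'_def d_def)
          then have "f a = f (d + a)" using d[OF r'] unfolding is_Z_def by blast
          then show "f a = f (Suc i + a)" using box1[OF \<open>Suc i + a < r'\<close>] by (rule trans)
        qed
        assume a: "Suc i + z' < r'"
        then have "z' = Z' d" by (auto simp: z'_def d_def split: if_splits)
        moreover have "d + z' < N" using a lr by (auto simp: d_def)
        ultimately have "f z' \<noteq> f (d + z')" using d a unfolding is_Z_def by simp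
        then show "f z' \<noteq> f (Suc i + z')" using box1[OF a] by metis
      qed
      have I'': "I s'' t'' e" if s'': "vframe {10..13} s s''" "arrs s'' 1 = f" "arrs s'' 0 = Z'" "vars s'' 10 = Suc i"
        "vars s'' 11 = l'" "vars s'' 12 = r'" "vars s'' 13 = z'" "t'' \<le> t' + 18" for s'' t''
      proof -
        have time: "t'' \<le> t + 9 + 18 * Q" if "P + 1 \<le> Q" "t' \<le> t + 9 + 18 * P" for P Q
          using that \<open>t'' \<le> t' + 18\<close> by linarith
        have "i + max r (i + z) + 1 \<le> Suc i + max r' (Suc i + z')" by (auto simp: r'_def)
        from time[OF this I'(13)] have "t'' \<le> t + 9 + 18 * (Suc i + max r' (Suc i + z'))" .
        then show ?thesis using s'' c lr box' z' Z'
          by (simp add: I_def)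
      qed
      have fin: "ok (While (Var 10 <. zlen) zalg_body # cs) s'' t'' e"
        if s'': "vframe {10..13} s s''" "arrs s'' 1 = f" "arrs s'' 0 = Z'" "vars s'' 10 = Suc i"
        "vars s'' 11 = l'" "vars s'' 12 = r'" "vars s'' 13 = z'" "t'' \<le> t' + 18" for s'' t''
      proof (rule IH[OF I''[OF s'']])
        have "\<phi> s' < \<phi> s''" unfolding phi using s'' by (auto simp: \<phi>_def r'_def z'_def)
        moreover have "\<phi> s' < 2 * N" using c I' by (auto simp: phi)
        ultimately show "2 * N - \<phi> s'' < 2 * N - \<phi> s'" by linarith
      qed
      have lt': "r' < cap" "Suc i < r' \<Longrightarrow> l' \<le> Suc i" "l \<le> i" "l < cap" using I' c lr *(8) by auto
      have Z'_eq: "(arrs s' 0)(vars s' 10 := vars s' 13) = Z'" by (simp add: Z'_def Z_def i_def z_def)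
      show ?thesis
      proof (cases "r < i + z")
        case True
        then have r': "r' = i + z" "l' = i" by (auto simp: r'_def l'_def)
        show ?thesis
        proof (cases "Suc i < r'")
          case True2: True
          show ?thesis
            apply (subst zalg_body_def)
            using *(1-7) lt vs I'(2,3) False True True2 Z'_eq lt'
            apply (simp add: r' flip: i_def l_def r_def z_def Z_def)
            apply (intro conjI impI fin)
            apply (simp_all add: r' z'_def I'(1) flip: l_def r_def)
            done
        next
          case False2: False
          show ?thesis
            apply (subst zalg_body_def)
            using *(1-7) lt vs I'(2,3) False True False2 Z'_eq lt'
            apply (simp add: r' flip: i_def l_def r_def z_def Z_def)
            apply (intro conjI impI fin)
            apply (simp_all add: r' z'_def I'(1) flip: l_def r_def)
            done
        qed
      next
        case False1: False
        then have r': "r' = r" "l' = l" by (auto simp: r'_def l'_def)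
        show ?thesis
        proof (cases "Suc i < r'")
          case True2: True
          show ?thesis
            apply (subst zalg_body_def)
            using *(1-7) lt vs I'(2,3) False False1 True2 Z'_eq lt'
            apply (simp add: r' flip: i_def l_def r_def z_def Z_def)
            apply (intro conjI impI fin)
            apply (simp_all add: r' z'_def I'(1) flip: l_def r_def)
            done
        next
          case False2: False
          show ?thesis
            apply (subst zalg_body_def)
            using *(1-7) lt vs I'(2,3) False False1 False2 Z'_eq lt'
            apply (simp add: r' flip: i_def l_def r_def z_def Z_def)
            apply (intro conjI impI fin)
            apply (simp_all add: r' z'_def I'(1) flip: l_def r_def)
            done
        qed
      qed
    qed
  qed
  moreover have "I (s\<lparr>vars := (vars s)(10 := 1, 11 := 0, 12 := 0, 13 := 0)\<rparr>) t' e" if "t' \<le> t + 9" for t' 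
    using that by (auto simp: I_def vframe_refl f_def box_def pre_def)
  ultimately show ?thesis unfolding zalg_def using * by simp
qed

lemma ok_scan:
  assumes s: "vars s 4 = h" "vars s 6 = x" "vars s 9 = v0"
    and x: "x + 2 * h \<le> n" and v0: "v0 \<le> x + k"
    and post: "\<And>s' t'. vframe {10..13} s s' \<Longrightarrow> 
      (\<And>j. j \<le> h \<Longrightarrow> (v0 + j + 2 * h \<le> m \<and> 2 * h \<le> arrs s' 0 (2 * h + j)) = matches X Y x (v0 + j) (2 * h)) \<Longrightarrow>
      t' \<le> t + 250 * h + 100 \<Longrightarrow> ok cs s' t' e"
  shows "ok (scan # cs) s t e"
proof (simp add: scan_def, rule ok_fill_array[OF s _ v0])
  show "x \<le> n" using x by simp
  fix s1 t1 assume 1: "vframe {10} s s1" "(\<And>i. i < 2 * h \<Longrightarrow> arrs s1 1 i = char_at X (x + i))"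
    "\<And>i. i < 3 * h \<Longrightarrow> arrs s1 1 (2 * h + i) = char_at Y (v0 + i)" "t1 \<le> Suc t + 24 * h + 10"
  show "ok (zalg # cs) s1 t1 e"
  proof (rule ok_zalg)
    show "vars s1 4 = h" using 1(1) s by (simp add: vframe_def)
    fix s2 t2 assume 2: "vframe {10..13} s1 s2" "t2 \<le> t1 + 200 * h + 60"
      "\<And>j. 1 \<le> j \<Longrightarrow> j < 5 * h \<Longrightarrow> is_Z (arrs s1 1) (5 * h) j (arrs s2 0 j)"
    show "ok cs s2 t2 e"
    proof (rule post)
      show "vframe {10..13} s s2" using 1(1) 2(1) by (auto simp: vframe_def)
      show "t2 \<le> t + 250 * h + 100" using 1 2 by simp
      fix j assume j: "j \<le> h"
      show "(v0 + j + 2 * h \<le> m \<and> 2 * h \<le> arrs s2 0 (2 * h + j)) = matches X Y x (v0 + j) (2 * h)"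
      proof (cases "h = 0")
        case True then show ?thesis using x by (simp add: matches_def)
      next
        case False
        let ?z = "arrs s2 0 (2 * h + j)"
        have Z: "is_Z (arrs s1 1) (5 * h) (2 * h + j) ?z" using 2(3) False j by simp
        have "2 * h \<le> ?z \<longleftrightarrow> (\<forall>i<2 * h. arrs s1 1 i = arrs s1 1 (2 * h + j + i))" 
          using Z j False unfolding is_Z_def by (cases "2 * h \<le> ?z") (auto simp: not_le)
        also have "\<dots> \<longleftrightarrow> (\<forall>i<2 * h. char_at X (x + i) = char_at Y (v0 + j + i))"
          using 1(2) 1(3)[of "j + _"] j by (auto simp: add.assoc)
        finally show ?thesis using x by (auto simp: matches_def)
      qed
    qed
  qed
qed

end

section \<open>Refuting one of two candidates by locating a break of periodicity\<close>

section \<open>Duels\<close>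

text \<open>Rounding the midpoint to a multiple of the period in variable 26 keeps the search within
  one residue class. Variable 30 is the character at the lower end, to which all others are
  compared.\<close>

definition bsearch_body :: "(expr \<Rightarrow> expr) \<Rightarrow> com" where
  "bsearch_body g =
    (29 :=. Var 27 +. (Var 28 -. Var 27) /. (Var 26 +. Var 26) *. Var 26;;
     If (g (Var 29) =. Var 30) (27 :=. Var 29) (28 :=. Var 29))"

definition bsearch :: "(expr \<Rightarrow> expr) \<Rightarrow> com" where
  "bsearch g = While (Var 26 <. Var 28 -. Var 27) (bsearch_body g)"

text \<open>Variable 21 is the current champion, 14 the challenger, 23 the first candidate and 22
  the offset of its mismatch. If the characters of \<open>X\<close> at the two ends of the residue
  class differ, \<open>X\<close> contains a break; if they agree, \<open>duel_base_Y\<close> moves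
  the break to \<open>Y\<close>.\<close>

definition duel :: com where
  "duel =
    (26 :=. Var 14 -. Var 21;;
     If (CharX (Var 6 +. Var 22) =. CharX (Var 6 +. Var 22 %. Var 26))
       (28 :=. Var 23 +. Var 22 -. Var 21;; 27 :=. Var 28 %. Var 26;; 30 :=. CharY (Var 21 +. Var 27);;
        bsearch (\<lambda>a. CharY (Var 21 +. a));;
        If (CharX (Var 6 +. (Var 28 -. Var 26)) =. CharY (Var 21 +. (Var 28 -. Var 26))) Skip (21 :=. Var 14))
       (28 :=. Var 22;; 27 :=. Var 28 %. Var 26;; 30 :=. CharX (Var 6 +. Var 27);;
        bsearch (\<lambda>a. CharX (Var 6 +. a));;
        If (CharX (Var 6 +. Var 28) =. CharY (Var 21 +. Var 28)) Skip (21 :=. Var 14)))"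

text \<open>
  Out-of-range positions of \<open>Y\<close> read as 0, so equality of characters alone would not certify a
  match; \<^term>\<open>matches\<close> includes the range conditions.
\<close>

definition dead :: "nat list \<Rightarrow> nat list \<Rightarrow> nat \<Rightarrow> nat \<Rightarrow> nat \<Rightarrow> bool" where
  "dead X Y x i v \<longleftrightarrow> (\<forall>l. matches X Y x v l \<longrightarrow> l \<le> i)"

text \<open>An out-of-range offset is as good as any other: a match longer than \<open>i\<close>
  would force the characters read at \<open>i\<close> to be equal.\<close>

lemma dead_mism: "i \<in> mism X Y x v \<Longrightarrow> dead X Y x i v"
  unfolding dead_def matches_def mism_def by (auto simp: not_le[symmetric])

lemma dead_mono: "dead X Y x i v \<Longrightarrow> i \<le> j \<Longrightarrow> dead X Y x j v"
  unfolding dead_def by (meson order_trans)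

text \<open>
  If \<open>X\<close> breaks the period \<open>v - c\<close> at \<open>i\<close>, the alignments \<open>c\<close> and \<open>v\<close> contradict each other,
  since they match \<open>x + i\<close> and \<open>x + (i - p)\<close> with the same position of \<open>Y\<close>.
\<close>

lemma duel_break:
  assumes "p = v - c" "c < v" "p \<le> i" "i \<le> j"
    and "char_at X (x + i) \<noteq> char_at X (x + (i - p))"
  shows "if char_at X (x + i) = char_at Y (c + i) then dead X Y x j v else dead X Y x j c"
proof (cases "char_at X (x + i) = char_at Y (c + i)")
  case True
  have "v + (i - p) = c + i" using assms by simp
  then have "i - p \<in> mism X Y x v" using True assms(5) unfolding mism_def mem_Collect_eq by metis
  then show ?thesis using True dead_mism dead_mono assms by (metis diff_le_self le_trans)
next
  case False
  then have "i \<in> mism X Y x c" by (simp add: mism_def)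
  then show ?thesis using False dead_mism dead_mono assms by metis
qed

text \<open>The character of \<open>X\<close> at \<open>x + (i - p)\<close> is aligned by
  \<open>c\<close> and by \<open>v\<close> with two different characters of \<open>Y\<close>, so it
  disagrees with at least one of them.\<close>

lemma duel_break_Y:
  assumes "p = v - c" "c < v" "p \<le> i" "i \<le> j"
    and "char_at Y (c + i) \<noteq> char_at Y (c + (i - p))"
  shows "if char_at X (x + (i - p)) = char_at Y (c + (i - p)) then dead X Y x j v else dead X Y x j c"
proof -
  have "v + (i - p) = c + i" using assms by simp
  then have "i - p \<in> mism X Y x (if char_at X (x + (i - p)) = char_at Y (c + (i - p)) then v else c)"
    using assms(5) unfolding mism_def mem_Collect_eq by (simp split: if_split)
  moreover have "i - p \<le> j" using assms by simp
  ultimately show ?thesis using dead_mono[OF dead_mism] by (auto split: if_splits)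
qed

context gap_ram
begin

text \<open>No monotonicity is required: either half keeps a lower end with value \<open>a\<close>
  and an upper end with another value. When the ends are one period apart, they exhibit the
  break.\<close>

lemma ok_bsearch:
  assumes s: "vars s 26 = p" "vars s 27 = lo" "vars s 28 = hi" "vars s 30 = a"
    and p: "0 < p" "p dvd hi - lo" "lo \<le> hi" "2 * p < cap" "hi < cap" "hi \<le> 2 ^ \<beta>"
    and g: "g lo = a" "g hi \<noteq> a"
    and ge: "\<And>s'. frame {27..29} s s' \<Longrightarrow> vars s' 29 \<le> hi \<Longrightarrow> expr_val w X Y s' (ge (Var 29)) = g (vars s' 29)"
    and post: "\<And>s' t' u. frame {27..29} s s' \<Longrightarrow> vars s' 28 = u \<Longrightarrow> u \<le> hi \<Longrightarrow> p \<le> u \<Longrightarrow> g u \<noteq> g (u - p) \<Longrightarrow>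
      t' \<le> t + 5 * \<beta> + 5 \<Longrightarrow> ok cs s' t' e"
  shows "ok (bsearch ge # cs) s t e"
proof -
  define I where "I = (\<lambda>s' t' e'. frame {27..29} s s' \<and> e' = e \<and> 
     (let l = vars s' 27; u = vars s' 28 in l < u \<and> u \<le> hi \<and> g l = a \<and> g u \<noteq> a \<and>
       (\<exists>q j. u = l + q * p \<and> q \<le> 2 ^ j \<and> j \<le> \<beta> \<and> t' + 5 * j \<le> t + 5 * \<beta>)))"
  have "1 < cap" using p by linarith
  have "I s t e"
  proof -
    obtain q where q: "hi - lo = p * q" using p(2) by blast
    have "lo \<noteq> hi" using g by auto
    have "q \<le> hi - lo" using q p(1) by simp
    then have "q \<le> 2 ^ \<beta>" using p(6) by linarith
    then have "hi = lo + q * p \<and> q \<le> 2 ^ \<beta> \<and> \<beta> \<le> \<beta> \<and> t + 5 * \<beta> \<le> t + 5 * \<beta>"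
      using p q by (auto simp: mult.commute)
    then have "\<exists>q j. hi = lo + q * p \<and> q \<le> 2 ^ j \<and> j \<le> \<beta> \<and> t + 5 * j \<le> t + 5 * \<beta>" by blast
    then show ?thesis using s p g \<open>lo \<noteq> hi\<close> by (simp add: I_def frame_refl)
  qed
  then show ?thesis unfolding bsearch_def
  proof (rule ok_whileI[where I = I and \<mu> = "\<lambda>s'. vars s' 28 - vars s' 27"])
    fix s' t' e' assume I: "I s' t' e'" and c: "expr_val w X Y s' (Var 26 <. Var 28 -. Var 27) = 0"
    define l where "l = vars s' 27"
    define u where "u = vars s' 28"
    obtain q j where I': "frame {27..29} s s'" "e' = e" "l < u" "u \<le> hi" "g l = a" "g u \<noteq> a"
      "u = l + q * p" "q \<le> 2 ^ j" "j \<le> \<beta>" "t' + 5 * j \<le> t + 5 * \<beta>"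
      using I unfolding I_def l_def u_def Let_def by blast
    have "vars s' 26 = p" using I' s by (auto simp: frame_def)
    then have "u - l \<le> p" using c I' \<open>1 < cap\<close> p by (simp add: not_less flip: l_def u_def)
    moreover have "1 \<le> q" using I' by (cases q) auto
    then have "p \<le> q * p" by simp
    ultimately have "l = u - p" "p \<le> u" using I'(7) by linarith+
    then have "ok cs s' (Suc t') e"
      using I' by (intro post[of s' u]) (auto simp: u_def)
    then show "ok cs s' (Suc t') e'" using I' by simp
  next
    fix s' t' e' assume I: "I s' t' e'" and c: "expr_val w X Y s' (Var 26 <. Var 28 -. Var 27) \<noteq> 0"
      and IH: "\<And>s'' t'' e''. I s'' t'' e'' \<Longrightarrow> vars s'' 28 - vars s'' 27 < vars s' 28 - vars s' 27 \<Longrightarrow>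
        ok (While (Var 26 <. Var 28 -. Var 27) (bsearch_body ge) # cs) s'' t'' e''"
    define l where "l = vars s' 27"
    define u where "u = vars s' 28"
    obtain q j where I': "frame {27..29} s s'" "e' = e" "l < u" "u \<le> hi" "g l = a" "g u \<noteq> a"
      "u = l + q * p" "q \<le> 2 ^ j" "j \<le> \<beta>" "t' + 5 * j \<le> t + 5 * \<beta>"
      using I unfolding I_def l_def u_def Let_def by blast
    have vs: "vars s' 26 = p" "vars s' 30 = a" using I' s by (auto simp: frame_def)
    then have "p < u - l" using c I' \<open>1 < cap\<close> p by (simp flip: l_def u_def)
    then have "1 * p < q * p" using I'(7) by simp
    then have q: "2 \<le> q" unfolding mult_less_cancel2 by simp
    then have j: "1 \<le> j" using I'(8) by (cases j) auto
    define mid where "mid = l + q div 2 * p"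
    have "(u - l) div (p + p) = q div 2"
    proof -
      have "u - l = p * q" using I'(7) by (simp add: mult.commute)
      then have "(u - l) div (p + p) = (p * q) div (p * 2)" by (simp only: mult_2_right)
      also have "\<dots> = q div 2" using p(1) by (intro div_mult_mult1) simp
      finally show ?thesis .
    qed
    moreover have mid: "l < mid" "mid < u"
    proof -
      show "l < mid" using q p(1) by (auto simp: mid_def div_greater_zero_iff)
      have "q div 2 * p < q * p" using q p(1) by simp
      then show "mid < u" using I'(7) by (simp add: mid_def)
    qed
    moreover have "q div 2 * p < cap" "l + q div 2 * p < cap" using mid(2) I'(4) p(5) unfolding mid_def by linarith+
    moreover have "p + p < cap" "l \<le> u" "u < cap" using p(4,5) I'(3,4) by linarith+
    ultimately have midv: "expr_val w X Y s' (Var 27 +. (Var 28 -. Var 27) /. (Var 26 +. Var 26) *. Var 26) = mid"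
      using vs by (simp add: mid_def flip: l_def u_def)
    have gv: "expr_val w X Y (s'\<lparr>vars := (vars s')(29 := mid)\<rparr>) (ge (Var 29)) = g mid"
      using ge[of "s'\<lparr>vars := (vars s')(29 := mid)\<rparr>"] I' mid by simp
    have *: "I s'' t'' e" if "frame {27..29} s s''" "vars s'' 28 = (if g mid = a then u else mid)"
      "vars s'' 27 = (if g mid = a then mid else l)" "t'' \<le> t' + 5" for s'' t''
    proof -
      let ?q = "if g mid = a then q - q div 2 else q div 2"
      have "q = q div 2 + (q - q div 2)" by simp
      then have "q * p = q div 2 * p + (q - q div 2) * p" by (metis distrib_right)
      then have 1: "vars s'' 28 = vars s'' 27 + ?q * p" using that I'(7) by (simp add: mid_def)
      obtain j' where j': "j = Suc j'" using j by (cases j) auto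
      \<comment> \<open>The upper half is rounded up, but \<open>2 ^ j\<close> is even here, so the
        bound still halves.\<close>
      then have 2: "?q \<le> 2 ^ j'" using I'(8) by auto
      have 3: "t'' + 5 * j' \<le> t + 5 * \<beta>" "j' \<le> \<beta>" using that I'(9,10) j' by auto
      have "\<exists>q j. vars s'' 28 = vars s'' 27 + q * p \<and> q \<le> 2 ^ j \<and> j \<le> \<beta> \<and> t'' + 5 * j \<le> t + 5 * \<beta>"
        using 1 2 3 by blast
      moreover have "vars s'' 27 < vars s'' 28" "vars s'' 28 \<le> hi" "g (vars s'' 27) = a" "g (vars s'' 28) \<noteq> a"
        using that(2,3) mid I'(3-6) by auto
      ultimately show ?thesis unfolding I_def Let_def using that(1) by simp
    qed
    show "ok (bsearch_body ge # While (Var 26 <. Var 28 -. Var 27) (bsearch_body ge) # cs) s' (Suc t') e'"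
    proof (cases "g mid = a")
      case True
      show ?thesis
        apply (subst bsearch_body_def)
        using gv vs midv True I'(1,2) \<open>1 < cap\<close> mid
        apply (simp del: expr_val.simps(6))
        apply (simp)
        apply (intro IH *)
        apply (simp_all flip: u_def l_def)
        done
    next
      case False
      show ?thesis
        apply (subst bsearch_body_def)
        using gv vs midv False I'(1,2) \<open>1 < cap\<close> mid
        apply (simp del: expr_val.simps(6))
        apply (simp)
        apply (intro IH *)
        apply (simp_all flip: u_def l_def)
        done
    qed
  qed
qed

text \<open>The loser is refuted at an offset of at most \<open>i\<close>, which the probe of the
  first candidate has reached already; hence the loser needs no probe of its own.\<close>

lemma ok_duel:
  assumes s: "vars s 6 = x" "vars s 14 = v" "vars s 21 = c" "vars s 22 = i" "vars s 23 = v0"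
    and ex: "matches X Y x v0 (2 * h)" "matches X Y x c (2 * h)" "matches X Y x v (2 * h)"
    and ord: "v0 < c" "c < v" "v \<le> v0 + h"
    and i: "i \<in> mism X Y x v0" "x + i < n" "v0 + i < m"
    and post: "\<And>s' t' c'. frame ({21} \<union> {26..30}) s s' \<Longrightarrow> vars s' 21 = c' \<Longrightarrow> 
      (c' = c \<and> dead X Y x i v \<or> c' = v \<and> dead X Y x i c) \<Longrightarrow> t' \<le> t + 5 * \<beta> + 30 \<Longrightarrow> ok cs s' t' e"
  shows "ok (duel # cs) s t e"
proof -
  let ?p = "v - c"
  have "2 * h \<le> i"
    using ex(1) i(1) unfolding matches_def mism_def by (meson mem_Collect_eq not_le)
  have b: "v - c \<le> h" "0 < v - c" using ord by auto
  have lt: "x + i < cap" "i < cap" "v < cap" "c < cap" "v0 + i < cap" "1 < cap" "x + i mod ?p < cap" "2 * ?p < cap" 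
    "i \<le> 2 ^ \<beta>" "v0 + i - c \<le> 2 ^ \<beta>" "c + (v0 + i - c) mod ?p < cap" "u \<le> v0 + i - c \<Longrightarrow> c + u < cap"
    "u \<le> i \<Longrightarrow> x + u < cap" "u \<le> i \<Longrightarrow> c + u < cap" "u \<le> i \<Longrightarrow> u - ?p < cap" "u \<le> i \<Longrightarrow> u < cap" for u
  proof -
    have "(v0 + i - c) mod ?p < ?p" "i mod ?p < ?p" using b by auto
    moreover have "n + m + 1 < 2 ^ \<beta>" by (rule beta)
    ultimately show "x + i < cap" "i < cap" "v < cap" "c < cap" "v0 + i < cap" "1 < cap" "x + i mod ?p < cap" "2 * ?p < cap" 
      "i \<le> 2 ^ \<beta>" "v0 + i - c \<le> 2 ^ \<beta>" "c + (v0 + i - c) mod ?p < cap" "u \<le> v0 + i - c \<Longrightarrow> c + u < cap"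
      "u \<le> i \<Longrightarrow> x + u < cap" "u \<le> i \<Longrightarrow> c + u < cap" "u \<le> i \<Longrightarrow> u - ?p < cap" "u \<le> i \<Longrightarrow> u < cap" for u
      using small_numbers i ord b by linarith+
  qed
  have le: "c \<le> v0 + i" "v0 + i - c \<le> i" using ord \<open>2 * h \<le> i\<close> by auto
  show ?thesis
  proof (cases "char_at X (x + i) = char_at X (x + i mod ?p)")
    case True
    \<comment> \<open>Position \<open>v0 + i\<close> of \<open>Y\<close>, where the first candidate
      fails, as an offset from \<open>c\<close>. The subtraction is exact because \<open>i\<close>
      lies beyond the window.\<close>
    let ?hi = "v0 + i - c"
    let ?s = "s\<lparr>vars := (vars s)(26 := ?p, 28 := ?hi, 27 := ?hi mod ?p, 30 := char_at Y (c + ?hi mod ?p))\<rparr>"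
    have base: "char_at Y (c + ?hi) \<noteq> char_at Y (c + ?hi mod ?p)"
      using ex ord i True le(1) by (intro duel_base_Y[where x = x and h = h]) (auto simp: mism_def)
    have "ok (bsearch (\<lambda>a. CharY (Var 21 +. a)) #
        If (CharX (Var 6 +. (Var 28 -. Var 26)) =. CharY (Var 21 +. (Var 28 -. Var 26))) Skip (21 :=. Var 14) # cs) ?s t' e"
      if t': "t' \<le> t + 20" for t'
    proof (rule ok_bsearch[where p = ?p and g = "\<lambda>u. char_at Y (c + u)" and lo = "?hi mod ?p" and hi = ?hi])
      show "?p dvd ?hi - ?hi mod ?p" by (rule dvd_minus_mod)
    next
      fix s' t'' u
      assume s': "frame {27..29} ?s s'" "vars s' 28 = u" "u \<le> ?hi" "?p \<le> u"
        and br: "char_at Y (c + u) \<noteq> char_at Y (c + (u - ?p))" and t'': "t'' \<le> t' + 5 * \<beta> + 5"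
      have vs: "vars s' 6 = x" "vars s' 14 = v" "vars s' 21 = c" "vars s' 26 = ?p"
        using s' s by (auto simp: frame_def)
      have fr: "frame ({21} \<union> {26..30}) s s'" using s'(1) by (auto simp: frame_def)
      have "u \<le> i" using s' le by linarith
      have lt': "x + (u - ?p) < cap" "c + (u - ?p) < cap" "u < cap" 
        using lt(13)[of "u - ?p"] lt(14)[of "u - ?p"] lt(16)[of u] \<open>u \<le> i\<close> by auto
      note d = duel_break_Y[OF refl ord(2) s'(4) \<open>u \<le> i\<close> br, of X x]
      show "ok (If (CharX (Var 6 +. (Var 28 -. Var 26)) =. CharY (Var 21 +. (Var 28 -. Var 26))) Skip (21 :=. Var 14) # cs) s' t'' e"
      proof (cases "char_at X (x + (u - ?p)) = char_at Y (c + (u - ?p))")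
        case True
        have "ok cs s' (Suc (Suc t'')) e" using d True fr vs t' t''
          by (intro post[of s' c]) auto
        then show ?thesis using vs s'(2,4) lt' lt(6) True by simp
      next
        case False
        have "ok cs (s'\<lparr>vars := (vars s')(21 := v)\<rparr>) (Suc (Suc t'')) e" using d False fr vs t' t''
          by (intro post[of _ v]) auto
        then show ?thesis using vs s'(2,4) lt' lt(6) False by simp
      qed
    next
      fix s' assume s': "frame {27..29} ?s s'" "vars s' 29 \<le> ?hi"
      then have "vars s' 21 = c" using s by (auto simp: frame_def)
      then show "expr_val w X Y s' (CharY (Var 21 +. Var 29)) = char_at Y (c + vars s' 29)"
        using lt(12) s' by simp
    qed (use b lt le base in auto)
    then show ?thesis unfolding duel_def using s lt(1-11) le True ord by simp
  next
    case False
    let ?s = "s\<lparr>vars := (vars s)(26 := ?p, 28 := i, 27 := i mod ?p, 30 := char_at X (x + i mod ?p))\<rparr>"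
    have "ok (bsearch (\<lambda>a. CharX (Var 6 +. a)) #
        If (CharX (Var 6 +. Var 28) =. CharY (Var 21 +. Var 28)) Skip (21 :=. Var 14) # cs) ?s t' e"
      if t': "t' \<le> t + 20" for t'
    proof (rule ok_bsearch[where p = ?p and g = "\<lambda>u. char_at X (x + u)" and lo = "i mod ?p" and hi = i])
      show "?p dvd i - i mod ?p" by (rule dvd_minus_mod)
    next
      fix s' t'' u
      assume s': "frame {27..29} ?s s'" "vars s' 28 = u" "u \<le> i" "?p \<le> u"
        and br: "char_at X (x + u) \<noteq> char_at X (x + (u - ?p))" and t'': "t'' \<le> t' + 5 * \<beta> + 5"
      have vs: "vars s' 6 = x" "vars s' 14 = v" "vars s' 21 = c"
        using s' s by (auto simp: frame_def)
      have fr: "frame ({21} \<union> {26..30}) s s'" using s'(1) by (auto simp: frame_def)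
      have lt': "x + u < cap" "c + u < cap" 
        using lt(13)[of u] lt(14)[of u] \<open>u \<le> i\<close> by auto
      note d = duel_break[OF refl ord(2) s'(4) \<open>u \<le> i\<close> br, of Y]
      show "ok (If (CharX (Var 6 +. Var 28) =. CharY (Var 21 +. Var 28)) Skip (21 :=. Var 14) # cs) s' t'' e"
      proof (cases "char_at X (x + u) = char_at Y (c + u)")
        case True
        have "ok cs s' (Suc (Suc t'')) e" using d True fr vs t' t''
          by (intro post[of s' c]) auto
        then show ?thesis using vs s'(2,4) lt' lt(6) True by simp
      next
        case False
        have "ok cs (s'\<lparr>vars := (vars s')(21 := v)\<rparr>) (Suc (Suc t'')) e" using d False fr vs t' t''
          by (intro post[of _ v]) auto
        then show ?thesis using vs s'(2,4) lt' lt(6) False by simp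
      qed
    next
      fix s' assume s': "frame {27..29} ?s s'" "vars s' 29 \<le> i"
      then have "vars s' 6 = x" using s by (auto simp: frame_def)
      then show "expr_val w X Y s' (CharX (Var 6 +. Var 29)) = char_at X (x + vars s' 29)"
        using lt(13) s' by simp
    qed (use b lt False in auto)
    then show ?thesis unfolding duel_def using s lt(1-11) le False ord by simp
  qed
qed

end

section \<open>Tournament of the candidates within a group\<close>

section \<open>Searching a group of alignments\<close>

text \<open>The Z-value alone would accept windows that run past the end of \<open>Y\<close>, and
  the last group may extend beyond \<open>x + k\<close>; the other two tests exclude this.\<close>

definition member_expr :: expr where
  "member_expr = (!. (Read 0 (Var 4 +. Var 4 +. Var 24) <. Var 4 +. Var 4) &.
    (!. (Var 1 <. Var 9 +. Var 24 +. (Var 4 +. Var 4)) &. !. (Var 6 +. Var 2 <. Var 9 +. Var 24)))"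

definition raise_y :: "expr \<Rightarrow> com" where
  "raise_y a = If (Var 7 <. Var 6 +. a) (7 :=. Var 6 +. a) Skip"

definition first_candidate_body :: com where
  "first_candidate_body = (24 :=. Var 24 +. Const 1)"

definition first_candidate :: com where
  "first_candidate = While (!. (Var 4 <. Var 24) &. !. member_expr) first_candidate_body"

definition tournament_body :: com where
  "tournament_body =
    (If member_expr
       (14 :=. Var 9 +. Var 24;; If (Var 25) duel (21 :=. Var 14;; 25 :=. Const 1))
       Skip;;
     24 :=. Var 24 +. Const 1)"

definition tournament :: com where
  "tournament = While (!. (Var 4 <. Var 24)) tournament_body"

text \<open>
  If the probe of the first candidate ends without a mismatch, no further probe is needed: the
  later candidates reach the end of \<open>Y\<close> earlier.
\<close>

definition search_group :: com where
  "search_group =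
    (((scan;; 24 :=. Const 0);; first_candidate);;
     If (Var 4 <. Var 24)
       (raise_y (Var 4 +. Var 4))
       (14 :=. Var 9 +. Var 24;; 23 :=. Var 14;; (probe;; raise_y (Var 15));;
        If (Var 16)
          (22 :=. Var 15;; 25 :=. Const 0;; 24 :=. Var 24 +. Const 1;; tournament;;
           If (Var 25) (14 :=. Var 21;; probe;; raise_y (Var 15)) Skip)
          Skip))"

lemma matches_mono: "matches X Y x v l \<Longrightarrow> l' \<le> l \<Longrightarrow> matches X Y x v l'"
  by (auto simp: matches_def)

context gap_ram
begin

definition cand :: "nat \<Rightarrow> nat \<Rightarrow> bool" where
  "cand x v \<longleftrightarrow> v \<le> x + k \<and> matches X Y x v (2 * h)"

definition ready :: "nat \<Rightarrow> nat \<Rightarrow> store \<Rightarrow> bool" where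
  "ready x v0 s \<longleftrightarrow> vars s 0 = n \<and> vars s 1 = m \<and> vars s 2 = k \<and> vars s 3 = T \<and> vars s 4 = h \<and> vars s 6 = x \<and> vars s 9 = v0"

definition table :: "nat \<Rightarrow> nat \<Rightarrow> store \<Rightarrow> bool" where
  "table x v0 s \<longleftrightarrow> (\<forall>j\<le>h. (v0 + j + 2 * h \<le> m \<and> 2 * h \<le> arrs s 0 (2 * h + j)) = matches X Y x (v0 + j) (2 * h))"

lemma ready_frame: "ready x v0 s \<Longrightarrow> vframe V s s' \<Longrightarrow> V \<inter> {0, 1, 2, 3, 4, 6, 9} = {} \<Longrightarrow> ready x v0 s'"
  by (auto simp: ready_def vframe_def)

lemma table_frame: "table x v0 s \<Longrightarrow> arrs s' = arrs s \<Longrightarrow> table x v0 s'"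
  by (simp add: table_def)

lemma member_expr_val:
  assumes "ready x v0 s" "table x v0 s" "vars s 24 = j" "j \<le> h" "x \<le> n" "v0 \<le> x + k"
  shows "expr_val w X Y s member_expr = of_bool (cand x (v0 + j))"
proof -
  have "h + h < cap" "h + h + j < cap" "v0 + j < cap" "v0 + j + (h + h) < cap" "1 < cap" "x + k < cap"
    using assms small_numbers k_less by linarith+
  moreover have "(v0 + j + (h + h) \<le> m \<and> h + h \<le> arrs s 0 (h + h + j)) = matches X Y x (v0 + j) (2 * h)"
    using assms(2,4) by (simp add: table_def mult_2)
  ultimately show ?thesis using assms by (simp add: member_expr_def ready_def cand_def not_less conj_ac flip: of_bool_conj)
qed

lemma ok_first_candidate:
  assumes s: "ready x v0 s" "table x v0 s" "vars s 24 = 0" and x: "x \<le> n" and v0: "v0 \<le> x + k"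
    and post: "\<And>s' t' j. frame {24} s s' \<Longrightarrow> vars s' 24 = j \<Longrightarrow> j \<le> h + 1 \<Longrightarrow>
      (\<And>j'. j' < j \<Longrightarrow> \<not> cand x (v0 + j')) \<Longrightarrow> (j \<le> h \<Longrightarrow> cand x (v0 + j)) \<Longrightarrow> t' \<le> t + 2 * h + 4 \<Longrightarrow> ok cs s' t' e"
  shows "ok (first_candidate # cs) s t e"
proof -
  define I where "I = (\<lambda>s' t' e'. frame {24} s s' \<and> e' = e \<and> vars s' 24 \<le> h + 1 \<and>
    (\<forall>j'<vars s' 24. \<not> cand x (v0 + j')) \<and> t' \<le> t + 2 * vars s' 24)"
  have cap: "1 < cap" "h + 2 < cap" using small_numbers by linarith+
  have "I s t e" using s by (simp add: I_def frame_refl)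
  then show ?thesis unfolding first_candidate_def
  proof (rule ok_whileI[where I = I and \<mu> = "\<lambda>s'. h + 1 - vars s' 24"])
    fix s' t' e' assume I: "I s' t' e'" and c: "expr_val w X Y s' (!. (Var 4 <. Var 24) &. !. member_expr) = 0"
    have fr: "frame {24} s s'" "ready x v0 s'" "table x v0 s'" 
      using I s ready_frame[of x v0 s "{24}" s'] table_frame[of x v0 s s'] frame_vframe[of "{24}" s s']
      by (auto simp: I_def frame_def)
    have "cand x (v0 + vars s' 24)" if "vars s' 24 \<le> h"
      using c that member_expr_val[OF fr(2,3) refl that x v0] cap fr(2) by (simp add: ready_def not_less)
    then show "ok cs s' (Suc t') e'" using I by (auto simp: I_def intro!: post)
  next
    fix s' t' e' assume I: "I s' t' e'" and c: "expr_val w X Y s' (!. (Var 4 <. Var 24) &. !. member_expr) \<noteq> 0"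
      and IH: "\<And>s'' t'' e''. I s'' t'' e'' \<Longrightarrow> h + 1 - vars s'' 24 < h + 1 - vars s' 24 \<Longrightarrow>
        ok (While (!. (Var 4 <. Var 24) &. !. member_expr) first_candidate_body # cs) s'' t'' e''"
    have fr: "frame {24} s s'" "ready x v0 s'" "table x v0 s'" 
      using I s ready_frame[of x v0 s "{24}" s'] table_frame[of x v0 s s'] frame_vframe[of "{24}" s s']
      by (auto simp: I_def frame_def)
    have j: "vars s' 24 \<le> h" using c fr(2) cap by (cases "vars s' 24 \<le> h") (auto simp: ready_def)
    then have "\<not> cand x (v0 + vars s' 24)"
      using c member_expr_val[OF fr(2,3) refl j x v0] cap fr(2) by (auto simp: ready_def not_less)
    then have "I (s'\<lparr>vars := (vars s')(24 := Suc (vars s' 24))\<rparr>) (Suc (Suc t')) e'"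
      using I j by (auto simp: I_def less_Suc_eq)
    then show "ok (first_candidate_body # While (!. (Var 4 <. Var 24) &. !. member_expr) first_candidate_body # cs) s' (Suc t') e'"
      using j cap
      by (subst first_candidate_body_def) (simp, intro IH; simp)
  qed
qed

text \<open>Each duel leaves one champion and refutes the other candidate at offset
  \<open>i\<close>, so a single alignment above the first candidate remains to be probed. The flag
  \<open>f\<close> tells whether there is one.\<close>

lemma ok_tournament:
  assumes s: "ready x v0 s" "table x v0 s" "vars s 24 = j0 + 1" "vars s 25 = 0" "vars s 23 = v0 + j0" "vars s 22 = i"
    and j0: "j0 \<le> h" "cand x (v0 + j0)"
    and i: "i \<in> mism X Y x (v0 + j0)" "x + i < n" "v0 + j0 + i < m"
    and x: "x \<le> n" and v0: "v0 \<le> x + k"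
    and post: "\<And>s' t' f. frame ({14, 21, 24, 25} \<union> {26..30}) s s' \<Longrightarrow> vars s' 25 = of_bool f \<Longrightarrow>
      (f \<Longrightarrow> cand x (vars s' 21) \<and> v0 \<le> vars s' 21) \<Longrightarrow>
      (\<And>v. v0 + j0 < v \<Longrightarrow> v \<le> v0 + h \<Longrightarrow> cand x v \<Longrightarrow> f \<and> v = vars s' 21 \<or> dead X Y x i v) \<Longrightarrow>
      t' \<le> t + 5 * (\<beta> * h) + 45 * h + 4 \<Longrightarrow> ok cs s' t' e"
  shows "ok (tournament # cs) s t e"
proof -
  let ?V = "{14, 21, 24, 25} \<union> {26..30 :: nat}"
  define I where "I = (\<lambda>s' t' e'. frame ?V s s' \<and> e' = e \<and>
    (let j = vars s' 24; c = vars s' 21; f = vars s' 25 in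
      j0 < j \<and> j \<le> h + 1 \<and> (f = 0 \<or> f = 1) \<and>
     (f = 1 \<longrightarrow> cand x c \<and> v0 + j0 < c \<and> c < v0 + j) \<and>
     (\<forall>v. v0 + j0 < v \<longrightarrow> v < v0 + j \<longrightarrow> cand x v \<longrightarrow> f = 1 \<and> v = c \<or> dead X Y x i v) \<and>
     t' + 5 * (\<beta> * (h + 1 - j)) + 45 * (h + 1 - j) \<le> t + 5 * (\<beta> * h) + 45 * h))"
  have cap: "1 < cap" "h + 2 < cap" "v0 + h < cap" using small_numbers x v0 k_less by linarith+
  have "\<beta> * (h - j0) \<le> \<beta> * h" by simp
  then have "5 * (\<beta> * (h - j0)) + 45 * (h - j0) \<le> 5 * (\<beta> * h) + 45 * h" by linarith
  then have "I s t e" using s j0 by (simp add: I_def frame_refl)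
  then show ?thesis unfolding tournament_def
  proof (rule ok_whileI[where I = I and \<mu> = "\<lambda>s'. h + 1 - vars s' 24"])
    fix s' t' e' assume I: "I s' t' e'" and c: "expr_val w X Y s' (!. (Var 4 <. Var 24)) = 0"
    have "vars s' 4 = h" using I s by (auto simp: I_def frame_def ready_def)
    then have "vars s' 24 = h + 1" using I c cap by (auto simp: I_def Let_def)
    then have "ok cs s' (Suc t') e" using I
      by (intro post[of s' "vars s' 25 = 1"]) (auto simp: I_def Let_def)
    then show "ok cs s' (Suc t') e'" using I by (simp add: I_def)
  next
    fix s' t' e' assume I: "I s' t' e'" and c: "expr_val w X Y s' (!. (Var 4 <. Var 24)) \<noteq> 0"
      and IH: "\<And>s'' t'' e''. I s'' t'' e'' \<Longrightarrow> h + 1 - vars s'' 24 < h + 1 - vars s' 24 \<Longrightarrow>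
        ok (While (!. (Var 4 <. Var 24)) tournament_body # cs) s'' t'' e''"
    define j where "j = vars s' 24"
    define c where "c = vars s' 21"
    define f where "f = vars s' 25"
    have fr: "frame ?V s s'" "ready x v0 s'" "table x v0 s'" "vars s' 23 = v0 + j0" "vars s' 22 = i"
      using I s ready_frame[of x v0 s ?V s'] table_frame[of x v0 s s'] frame_vframe[of ?V s s']
      by (auto simp: I_def frame_def)
    have j: "j \<le> h" using c fr(2) cap by (auto simp: ready_def j_def)
    have I': "e' = e" "j0 < j" "f = 0 \<or> f = 1" "f = 1 \<Longrightarrow> cand x c \<and> v0 + j0 < c \<and> c < v0 + j"
      "\<And>v. v0 + j0 < v \<Longrightarrow> v < v0 + j \<Longrightarrow> cand x v \<Longrightarrow> f = 1 \<and> v = c \<or> dead X Y x i v"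
      "t' + 5 * (\<beta> * (h + 1 - j)) + 45 * (h + 1 - j) \<le> t + 5 * (\<beta> * h) + 45 * h"
      using I by (auto simp: I_def Let_def j_def c_def f_def)
    have "h + 1 - j = Suc (h - j)" using j by simp
    then have time: "t' + 5 * (\<beta> * (h - j)) + 5 * \<beta> + 45 * (h - j) + 45 \<le> t + 5 * (\<beta> * h) + 45 * h"
      using I'(6) by simp
    have mv: "expr_val w X Y s' member_expr = of_bool (cand x (v0 + j))"
      using member_expr_val[OF fr(2,3) j_def[symmetric] j x v0] .
    have vs: "vars s' 9 = v0" using fr(2) by (simp add: ready_def)
    have fin: "ok (While (!. (Var 4 <. Var 24)) tournament_body # cs) s'' t'' e"
      if s'': "frame ?V s s''" "vars s'' 24 = Suc j" "vars s'' 25 = f'" "vars s'' 21 = c'" "f' = 0 \<or> f' = 1"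
        "f' = 1 \<Longrightarrow> cand x c' \<and> v0 + j0 < c' \<and> c' < v0 + Suc j"
        "\<And>v. v0 + j0 < v \<Longrightarrow> v < v0 + j \<Longrightarrow> cand x v \<Longrightarrow> f' = 1 \<and> v = c' \<or> dead X Y x i v"
        "cand x (v0 + j) \<Longrightarrow> f' = 1 \<and> v0 + j = c' \<or> dead X Y x i (v0 + j)"
        "t'' \<le> t' + 5 * \<beta> + 45" for s'' t'' f' c'
    proof (rule IH)
      have "\<And>v. v0 + j0 < v \<Longrightarrow> v < v0 + Suc j \<Longrightarrow> cand x v \<Longrightarrow> f' = 1 \<and> v = c' \<or> dead X Y x i v"
        using s''(7,8) by (metis add_Suc_right less_Suc_eq)
      then show "I s'' t'' e" using s'' I' j time by (simp add: I_def)
      show "h + 1 - vars s'' 24 < h + 1 - vars s' 24" using s'' j by (simp add: j_def[symmetric])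
    qed
    show "ok (tournament_body # While (!. (Var 4 <. Var 24)) tournament_body # cs) s' (Suc t') e'"
    proof (cases "cand x (v0 + j)")
      case False
      show ?thesis
        apply (subst tournament_body_def)
        using False mv I'(1) cap j
        apply (simp flip: j_def)
        apply (rule fin[of _ f c])
        using fr(1) I' apply (simp_all flip: j_def c_def f_def)
        done
    next
      case True
      show ?thesis
      proof (cases "f = 0")
        case f: True
        show ?thesis
          apply (subst tournament_body_def)
          using True mv I'(1) cap j f vs
          apply (simp flip: j_def f_def)
          apply (rule fin[of _ 1 "v0 + j"])
          using fr(1) I' apply (simp_all flip: j_def c_def f_def)
          done
      next
        case f: False
        then have f1: "f = 1" using I' by simp
        let ?s = "s'\<lparr>vars := (vars s')(14 := v0 + j)\<rparr>"
        have "ok (duel # (24 :=. Var 24 +. Const 1) # While (!. (Var 4 <. Var 24)) tournament_body # cs) ?s t'' e"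
          if t'': "t'' \<le> t' + 6" for t''
        proof (rule ok_duel[where ?v0.0 = "v0 + j0" and v = "v0 + j" and c = c and x = x and i = i])
          show "vars ?s 6 = x" "vars ?s 14 = v0 + j" "vars ?s 21 = c" "vars ?s 22 = i" "vars ?s 23 = v0 + j0"
            using fr by (auto simp: ready_def c_def)
          show "matches X Y x (v0 + j0) (2 * h)" "matches X Y x c (2 * h)" "matches X Y x (v0 + j) (2 * h)"
            using j0 I'(4) f1 True by (auto simp: cand_def)
          show "v0 + j0 < c" "c < v0 + j" "v0 + j \<le> v0 + j0 + h" using I'(4) f1 j by auto
          fix s2 t2 c' assume 2: "frame ({21} \<union> {26..30}) ?s s2" "vars s2 21 = c'" 
            "c' = c \<and> dead X Y x i (v0 + j) \<or> c' = v0 + j \<and> dead X Y x i c" "t2 \<le> t'' + 5 * \<beta> + 30"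
          have fr2: "frame ?V s s2" using fr(1) 2(1) by (auto simp: frame_def)
          have vs2: "vars s2 24 = j" "vars s2 25 = f" using 2(1) by (auto simp: frame_def j_def f_def)
          have "ok (While (!. (Var 4 <. Var 24)) tournament_body # cs) (s2\<lparr>vars := (vars s2)(24 := Suc j)\<rparr>) (Suc t2) e"
          proof (rule fin[of _ 1 c'])
            show "cand x c' \<and> v0 + j0 < c' \<and> c' < v0 + Suc j"
              using 2(3) I'(2,4) f1 True by auto
          qed (use fr2 vs2 2 f1 I' t'' in auto)
          then show "ok ((24 :=. Var 24 +. Const 1) # While (!. (Var 4 <. Var 24)) tournament_body # cs) s2 t2 e"
            using vs2 cap j by simp
        qed (use i in auto)
        then show ?thesis
          apply (subst tournament_body_def)
          using True mv I'(1) cap j f vs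
          apply (simp flip: j_def f_def)
          done
      qed
    qed
  qed
qed


lemma probe_cost_mono: "i \<le> j \<Longrightarrow> probe_cost i \<le> probe_cost j"
  unfolding probe_cost_def by (intro add_mono mult_le_mono div_le_mono) auto

text \<open>The quantity in which the cost of a YES answer is accumulated. If \<open>x\<close>
  exceeds the length of \<open>Y\<close>, the second prefix is all of \<open>Y\<close>.\<close>

definition prefix_ED :: "nat \<Rightarrow> nat" where "prefix_ED x = ED (take x X) (take x Y)"

lemma ok_probe_raise:
  assumes s: "ready x v0 s" "vars s 14 = v" "vars s 7 = y"
    and v: "matches X Y x v (2 * h)" "v \<le> x + k" "x \<le> v + k" and e: "0 \<le> e"
    and post: "\<And>s' t' i f. frame ({7} \<union> {15..20}) s s' \<Longrightarrow> vars s' 7 = max y (x + i) \<Longrightarrow> vars s' 15 = i \<Longrightarrow>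
      vars s' 16 = of_bool f \<Longrightarrow> dead X Y x i v \<Longrightarrow> 2 * h \<le> i \<Longrightarrow> x + i \<le> n \<Longrightarrow> 
      (f \<Longrightarrow> i \<in> mism X Y x v \<and> x + i < n \<and> v + i < m) \<Longrightarrow> (\<not> f \<Longrightarrow> i = min (n - x) (m - v)) \<Longrightarrow>
      prefix_ED (x + i) \<le> prefix_ED x + 3 * k \<Longrightarrow> t' \<le> t + probe_cost i + 5 \<Longrightarrow> ok cs s' t' e"
  shows "ok (probe # raise_y (Var 15) # cs) s t (e + exp (- real T))"
proof (rule ok_probe[where x = x and v = v])
  show "vars s 0 = n" "vars s 1 = m" "vars s 3 = T" "vars s 4 = h" "vars s 6 = x" "vars s 14 = v"
    using s by (auto simp: ready_def)
  show x: "x \<le> n" "v \<le> m" using v by (auto simp: matches_def)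
  fix s' t' i f
  assume s': "frame {15..20} s s'" "vars s' 15 = i" "vars s' 16 = of_bool f" "i \<le> min (n - x) (m - v)"
    and f: "f \<Longrightarrow> i < min (n - x) (m - v) \<and> i \<in> mism X Y x v" "\<not> f \<Longrightarrow> i = min (n - x) (m - v)"
    and card: "card (mism X Y x v \<inter> {..<i}) \<le> 2 * h" and t': "t' \<le> t + probe_cost i"
  have i: "x + i \<le> n" "v + i \<le> m" using s'(4) x by auto
  have cap: "x + i < cap" "1 < cap" using i small_numbers by linarith+
  have "dead X Y x i v"
  proof (cases f)
    case True then show ?thesis using f dead_mism by blast
  next
    case False then show ?thesis using f(2) unfolding dead_def matches_def by auto
  qed
  moreover have "2 * h \<le> i" using \<open>dead X Y x i v\<close> v(1) by (simp add: dead_def)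
  moreover have "prefix_ED (x + i) \<le> prefix_ED x + 3 * k" unfolding prefix_ED_def
    using ED_diagonal_jump[OF i v(2,3)] card small_numbers(3) by simp
  ultimately have "ok cs s'' t'' e"
    if "frame ({7} \<union> {15..20}) s s''" "vars s'' 7 = max y (x + i)" "vars s'' 15 = i" "vars s'' 16 = of_bool f"
      "t'' \<le> t' + 5" for s'' t''
    using that f i t' by (intro post[of s'' i f t'']) auto
  moreover have "vars s' 7 = y" "vars s' 6 = x" using s s'(1) by (auto simp: frame_def ready_def)
  moreover have "frame ({7} \<union> {15..20}) s s'" using s'(1) by (auto simp: frame_def)
  ultimately show "ok (raise_y (Var 15) # cs) s' t' e"
    using s'(2,3) cap by (simp add: raise_y_def max_def)
qed (use e in simp)

definition group_cost :: nat where "group_cost = 5 * (\<beta> * h) + 300 * h + 200"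

text \<open>Taking the maximum of the reached positions preserves both guarantees: refutation is
  monotone in the offset, and the largest position brings the certificate of the alignment that
  reached it. The budget covers the two probes.\<close>

lemma ok_search_group:
  assumes s: "ready x v0 s" "vars s 7 = y"
    and x: "x + 2 * h \<le> n" and v0: "v0 \<le> x + k" "x \<le> v0 + k" and e: "0 \<le> e"
    and post: "\<And>s' t' y'. vframe ({7} \<union> {10..30}) s s' \<Longrightarrow> vars s' 7 = y' \<Longrightarrow> y \<le> y' \<Longrightarrow> x \<le> y' \<Longrightarrow>
      (\<And>v. v0 \<le> v \<Longrightarrow> v \<le> v0 + h \<Longrightarrow> v \<le> x + k \<Longrightarrow> dead X Y x (y' - x) v) \<Longrightarrow>
      y' = y \<or> y' \<le> n \<and> prefix_ED y' \<le> prefix_ED x + 3 * k \<Longrightarrow> t' \<le> t + group_cost + 2 * probe_cost (y' - x) \<Longrightarrow> ok cs s' t' e"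
  shows "ok (search_group # cs) s t (e + 2 * exp (- real T))"
proof -
  have cap: "1 < cap" "x + 2 * h < cap" "v0 + h < cap" "h + 2 < cap" "h + h < cap" using small_numbers x v0 k_less by linarith+
  let ?V = "{7} \<union> {10..30 :: nat}"
  \<comment> \<open>A non-candidate fails inside the window, so it cannot match beyond any
    \<open>i \<ge> 2 * h\<close>.\<close>
  have outside: "dead X Y x i v" if "2 * h \<le> i" "v \<le> x + k" "\<not> cand x v" for i v
    unfolding dead_def using that matches_mono[of X Y x v _ "2 * h"] by (meson cand_def linear order_trans)
  define rest where "rest = [If (Var 4 <. Var 24)
       (raise_y (Var 4 +. Var 4))
       (14 :=. Var 9 +. Var 24;; 23 :=. Var 14;; (probe;; raise_y (Var 15));;
        If (Var 16)
          (22 :=. Var 15;; 25 :=. Const 0;; 24 :=. Var 24 +. Const 1;; tournament;;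
           If (Var 25) (14 :=. Var 21;; probe;; raise_y (Var 15)) Skip)
          Skip)]"
  have "ok (scan # (24 :=. Const 0) # first_candidate # rest @ cs) s t' (e + 2 * exp (- real T))" if t': "t' \<le> t + 3" for t'
  proof (rule ok_scan[where x = x and ?v0.0 = v0])
    show "vars s 4 = h" "vars s 6 = x" "vars s 9 = v0" using s by (auto simp: ready_def)
    show "x + 2 * h \<le> n" "v0 \<le> x + k" by fact+
    fix s1 t1 assume 1: "vframe {10..13} s s1"
      "\<And>j. j \<le> h \<Longrightarrow> (v0 + j + 2 * h \<le> m \<and> 2 * h \<le> arrs s1 0 (2 * h + j)) = matches X Y x (v0 + j) (2 * h)"
      "t1 \<le> t' + 250 * h + 100"
    let ?s1 = "s1\<lparr>vars := (vars s1)(24 := 0)\<rparr>"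
    have V1: "vframe ?V s ?s1" using 1(1) by (auto simp: vframe_def)
    have tab1: "table x v0 ?s1" using 1(2) by (simp add: table_def)
    have rdy: "ready x v0 s'" if "vframe ?V s s'" for s' using ready_frame[OF s(1) that] by simp
    have "ok (first_candidate # rest @ cs) ?s1 (Suc t1) (e + 2 * exp (- real T))"
    proof (rule ok_first_candidate[where x = x and ?v0.0 = v0])
      show "ready x v0 ?s1" "table x v0 ?s1" using rdy[OF V1] tab1 by auto
      fix s2 t2 j assume 2: "frame {24} ?s1 s2" "vars s2 24 = j" "j \<le> h + 1"
        "\<And>j'. j' < j \<Longrightarrow> \<not> cand x (v0 + j')" "j \<le> h \<Longrightarrow> cand x (v0 + j)" "t2 \<le> Suc t1 + 2 * h + 4"
      have V2: "vframe ?V s s2" using V1 2(1) by (auto simp: vframe_def frame_def)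
      have tab2: "table x v0 s2" using tab1 2(1) by (simp add: table_def frame_def)
      have vs2: "vars s2 4 = h" "vars s2 6 = x" "vars s2 9 = v0" using rdy[OF V2] by (auto simp: ready_def)
      have y2: "vars s2 7 = y" using 1(1) 2(1) s(2) by (auto simp: vframe_def frame_def)
      have t2: "t2 \<le> t + 252 * h + 110" using 2(6) 1(3) t' by linarith
      show "ok (rest @ cs) s2 t2 (e + 2 * exp (- real T))"
      proof (cases "j \<le> h")
        case False
        then have none: "\<not> cand x v" if "v0 \<le> v" "v \<le> v0 + h" for v using 2(4)[of "v - v0"] that by simp
        \<comment> \<open>Without a candidate all alignments fail inside the window. Moving to its
          end is paid for by replacing its \<open>2 * h \<le> k\<close> characters, without a
          probe.\<close>
        have "ok cs s' t'' e" if "vframe ?V s s'" "vars s' 7 = max y (x + 2 * h)" "t'' \<le> t2 + 10" for s' t''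
        proof (rule post[OF that(1,2)])
          show "max y (x + 2 * h) = y \<or> max y (x + 2 * h) \<le> n \<and> prefix_ED (max y (x + 2 * h)) \<le> prefix_ED x + 3 * k"
            using x ED_diagonal_skip[of x "2 * h" X Y] small_numbers(3) by (auto simp: max_def prefix_ED_def)
          show "t'' \<le> t + group_cost + 2 * probe_cost (max y (x + 2 * h) - x)"
            using that(3) t2 by (simp add: group_cost_def)
          fix v assume "v0 \<le> v" "v \<le> v0 + h" "v \<le> x + k"
          then show "dead X Y x (max y (x + 2 * h) - x) v" using none by (intro outside) auto
        qed auto
        then have fin: "ok cs s' t'' (e + 2 * exp (- real T))"
          if "vframe ?V s s'" "vars s' 7 = max y (x + 2 * h)" "t'' \<le> t2 + 10" for s' t''
          using ok_mono[of cs s' t'' e "e + 2 * exp (- real T)"] that by simp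
        have j: "vars s2 24 = Suc h" using 2(2,3) False by simp
        show ?thesis
        proof (cases "y < x + 2 * h")
          case True
          have "ok cs (s2\<lparr>vars := (vars s2)(7 := x + (h + h))\<rparr>) t'' (e + 2 * exp (- real T))" if "t'' \<le> t2 + 10" for t''
            using V2 True that by (intro fin) auto
          then show ?thesis using True cap vs2 y2 j by (simp add: rest_def raise_y_def)
        next
          case F: False
          have "ok cs s2 t'' (e + 2 * exp (- real T))" if "t'' \<le> t2 + 10" for t''
            using V2 F y2 that by (intro fin) auto
          then show ?thesis using F cap vs2 y2 j by (simp add: rest_def raise_y_def)
        qed
      next
        case j: True
        let ?v = "v0 + j"
        let ?s2 = "s2\<lparr>vars := (vars s2)(14 := ?v, 23 := ?v)\<rparr>"
        have "\<not> cand x v" if "v0 \<le> v" "v < ?v" for v using 2(4)[of "v - v0"] that by simp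
        then have below: "dead X Y x i v" if "2 * h \<le> i" "v \<le> x + k" "v0 \<le> v" "v < ?v" for i v
          using outside that by blast
        define rest2 where "rest2 = [If (Var 16)
          (22 :=. Var 15;; 25 :=. Const 0;; 24 :=. Var 24 +. Const 1;; tournament;;
           If (Var 25) (14 :=. Var 21;; probe;; raise_y (Var 15)) Skip)
          Skip]"
        have "ok (probe # raise_y (Var 15) # rest2 @ cs) ?s2 t'' ((e + exp (- real T)) + exp (- real T))"
          if t'': "t'' \<le> t2 + 12" for t''
        proof (rule ok_probe_raise[where x = x and ?v0.0 = v0 and v = ?v and y = y])
          show "ready x v0 ?s2" using V2 by (intro rdy) simp
          show "vars ?s2 14 = ?v" "vars ?s2 7 = y" using y2 by auto
          show "matches X Y x ?v (2 * h)" "?v \<le> x + k" using 2(5) j by (auto simp: cand_def)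
          show "x \<le> ?v + k" using v0 by simp
          show "0 \<le> e + exp (- real T)" using e by simp
          fix s3 t3 i f assume 3: "frame ({7} \<union> {15..20}) ?s2 s3" "vars s3 7 = max y (x + i)" "vars s3 15 = i"
            "vars s3 16 = of_bool f" "dead X Y x i ?v" "2 * h \<le> i" "x + i \<le> n"
            "f \<Longrightarrow> i \<in> mism X Y x ?v \<and> x + i < n \<and> ?v + i < m" "\<not> f \<Longrightarrow> i = min (n - x) (m - ?v)"
            "prefix_ED (x + i) \<le> prefix_ED x + 3 * k" "t3 \<le> t'' + probe_cost i + 5"
          have V3: "vframe ?V s s3" using V2 3(1) by (auto simp: vframe_def frame_def)
          have tab3: "table x v0 s3" using tab2 3(1) by (simp add: table_def frame_def)
          have vs3: "vars s3 24 = j" "vars s3 23 = ?v" using 3(1) 2(2) by (auto simp: frame_def)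
          have good3: "max y (x + i) = y \<or> max y (x + i) \<le> n \<and> prefix_ED (max y (x + i)) \<le> prefix_ED x + 3 * k"
            using 3(7,10) by (auto simp: max_def)
          have t3: "t3 \<le> t + 252 * h + 127 + probe_cost i" using 3(11) t'' t2 by linarith
          have done3: "ok cs s' t4 (e + exp (- real T))" if "vframe ?V s s'" "vars s' 7 = max y (x + i)"
            "\<And>v. v0 \<le> v \<Longrightarrow> v \<le> v0 + h \<Longrightarrow> v \<le> x + k \<Longrightarrow> dead X Y x i v" 
            "t4 \<le> t + 5 * (\<beta> * h) + 300 * h + 150 + probe_cost i" for s' t4
          proof -
            have "ok cs s' t4 e"
            proof (rule post[OF that(1,2)])
              show "t4 \<le> t + group_cost + 2 * probe_cost (max y (x + i) - x)"
              proof -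
                have "i \<le> max y (x + i) - x" by linarith
                from probe_cost_mono[OF this] show ?thesis using that(4) by (simp add: group_cost_def)
              qed
              fix v assume "v0 \<le> v" "v \<le> v0 + h" "v \<le> x + k"
              from that(3)[OF this] show "dead X Y x (max y (x + i) - x) v" by (rule dead_mono) auto
            qed (use good3 in auto)
            then show ?thesis by (rule ok_mono) simp
          qed
          show "ok (rest2 @ cs) s3 t3 (e + exp (- real T))"
          proof (cases f)
            case False
            have "dead X Y x i v" if "v0 \<le> v" "v \<le> v0 + h" "v \<le> x + k" for v
            proof (cases "v < ?v")
              case True then show ?thesis using below 3(6) that by blast
            next
              case False2: False
              then show ?thesis using 3(9) False unfolding dead_def matches_def by auto
            qed
            then have "ok cs s3 t4 (e + exp (- real T))" if "t4 \<le> t3 + 2" for t4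
              using V3 3(2) t3 that by (intro done3) auto
            then show ?thesis using 3(4) False by (simp add: rest2_def)
          next
            case f: True
            let ?s3 = "s3\<lparr>vars := (vars s3)(22 := i, 25 := 0, 24 := Suc j)\<rparr>"
            define rest3 where "rest3 = [If (Var 25) (14 :=. Var 21;; probe;; raise_y (Var 15)) Skip]"
            have "ok (tournament # rest3 @ cs) ?s3 t4 (e + exp (- real T))" if t4: "t4 \<le> t3 + 9" for t4
            proof (rule ok_tournament[where x = x and ?v0.0 = v0 and ?j0.0 = j and i = i])
              show "ready x v0 ?s3" using V3 by (intro rdy) simp
              show "table x v0 ?s3" using tab3 by (simp add: table_def)
              show "j \<le> h" "cand x ?v" using j 2(5) by auto
              show "i \<in> mism X Y x ?v" "x + i < n" "?v + i < m" using 3(8) f by auto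
              fix s4 t5 g assume 4: "frame ({14, 21, 24, 25} \<union> {26..30}) ?s3 s4" "vars s4 25 = of_bool g"
                "g \<Longrightarrow> cand x (vars s4 21) \<and> v0 \<le> vars s4 21"
                "\<And>v. ?v < v \<Longrightarrow> v \<le> v0 + h \<Longrightarrow> cand x v \<Longrightarrow> g \<and> v = vars s4 21 \<or> dead X Y x i v"
                "t5 \<le> t4 + 5 * (\<beta> * h) + 45 * h + 4"
              have V4: "vframe ?V s s4" using V3 4(1) by (auto simp: vframe_def frame_def)
              have y4: "vars s4 7 = max y (x + i)" using 4(1) 3(2) by (auto simp: frame_def)
              have dead4: "g \<and> v = vars s4 21 \<or> dead X Y x i v" if "v0 \<le> v" "v \<le> v0 + h" "v \<le> x + k" for v
              proof (cases v ?v rule: linorder_cases)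
                case less then show ?thesis using below 3(6) that by blast
              next
                case equal then show ?thesis using 3(5) by blast
              next
                case greater then show ?thesis using 4(4) outside 3(6) that by blast
              qed
              have t5: "t5 \<le> t + 5 * (\<beta> * h) + 297 * h + 140 + probe_cost i" using 4(5) t4 t3 by linarith
              show "ok (rest3 @ cs) s4 t5 (e + exp (- real T))"
              proof (cases g)
                case False
                have "ok cs s4 t6 (e + exp (- real T))" if "t6 \<le> t5 + 2" for t6
                  using V4 y4 dead4 False t5 that by (intro done3) auto
                then show ?thesis using 4(2) False by (simp add: rest3_def)
              next
                case g: True
                let ?c = "vars s4 21"
                let ?s4 = "s4\<lparr>vars := (vars s4)(14 := ?c)\<rparr>"
                have c: "matches X Y x ?c (2 * h)" "?c \<le> x + k" "x \<le> ?c + k"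
                  using 4(3) g v0(2) by (auto simp: cand_def)
                have "ok (probe # raise_y (Var 15) # cs) ?s4 t6 (e + exp (- real T))" if t6: "t6 \<le> t5 + 5" for t6
                proof (rule ok_probe_raise[where x = x and ?v0.0 = v0 and v = ?c and y = "max y (x + i)"])
                  show "ready x v0 ?s4" using V4 by (intro rdy) simp
                  show "vars ?s4 14 = ?c" "vars ?s4 7 = max y (x + i)" using y4 by auto
                  fix s5 t7 i2 f2 assume 5: "frame ({7} \<union> {15..20}) ?s4 s5" "vars s5 7 = max (max y (x + i)) (x + i2)"
                    "dead X Y x i2 ?c" "x + i2 \<le> n" "prefix_ED (x + i2) \<le> prefix_ED x + 3 * k" "t7 \<le> t6 + probe_cost i2 + 5"
                  let ?y = "max (max y (x + i)) (x + i2)"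
                  have V5: "vframe ?V s s5" using V4 5(1) by (auto simp: vframe_def frame_def)
                  have le: "i \<le> ?y - x" "i2 \<le> ?y - x" by linarith+
                  show "ok cs s5 t7 e"
                  proof (rule post[OF V5 5(2)])
                    show "t7 \<le> t + group_cost + 2 * probe_cost (?y - x)"
                      using probe_cost_mono[OF le(1)] probe_cost_mono[OF le(2)] 5(6) t6 t5
                      by (simp add: group_cost_def)
                    show "?y = y \<or> ?y \<le> n \<and> prefix_ED ?y \<le> prefix_ED x + 3 * k"
                      using 5(4,5) 3(7,10) by (auto simp: max_def)
                    fix v assume "v0 \<le> v" "v \<le> v0 + h" "v \<le> x + k"
                    from dead4[OF this] show "dead X Y x (?y - x) v"
                      using dead_mono[OF _ le(1)] dead_mono[OF 5(3) le(2)] by blast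
                  qed auto
                qed (use c e in auto)
                then show ?thesis using 4(2) g by (simp add: rest3_def)
              qed
            qed (use vs3 x v0 in auto)
            then show ?thesis using 3(3,4) f vs3 cap j by (simp add: rest2_def rest3_def)
          qed
        qed
        moreover have "e + exp (- real T) + exp (- real T) = e + 2 * exp (- real T)" by simp
        ultimately have "ok (probe # raise_y (Var 15) # rest2 @ cs) ?s2 t'' (e + 2 * exp (- real T))"
          if "t'' \<le> t2 + 12" for t'' using that by metis
        then show ?thesis
          using j cap vs2 2(2) by (simp add: rest_def rest2_def)
      qed
    qed (use x v0 in auto)
    then show "ok ((24 :=. Const 0) # first_candidate # rest @ cs) s1 t1 (e + 2 * exp (- real T))" by simp
  qed
  then show ?thesis by (simp add: search_group_def rest_def)
qed

end

section \<open>The greedy phases and their accounting\<close>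

section \<open>Phases\<close>

definition search_groups_body :: com where
  "search_groups_body = (search_group;; 9 :=. Var 9 +. (Var 4 +. Const 1))"

definition search_groups :: com where
  "search_groups = While (!. (Var 6 +. Var 2 <. Var 9)) search_groups_body"

text \<open>If at most \<open>2 * h\<close> characters of \<open>X\<close> are left, skipping them
  all costs at most \<open>k\<close> edits; otherwise the window fits into \<open>X\<close>.\<close>

definition phase :: com where
  "phase =
    If (Var 0 -. Var 6 <. Var 4 +. Var 4 +. Const 1)
      (7 :=. Var 0)
      (7 :=. Var 6;; If (Var 6 <. Var 2) (9 :=. Const 0) (9 :=. Var 6 -. Var 2);; search_groups)"

definition phases_body :: com where
  "phases_body = (phase;; If (Var 7 <. Var 0) (6 :=. Var 7 +. Const 1;; 8 :=. Var 8 +. Const 1) (31 :=. Const 1))"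

definition phases :: com where
  "phases = While (!. (Var 2 <. Var 8) &. !. (Var 31)) phases_body"

context gap_ram
begin

definition phase_cost :: "nat \<Rightarrow> nat" where
  "phase_cost l = 8 * probe_cost l + 4 * group_cost + 60"

lemma ok_search_groups:
  assumes s: "vars s 0 = n" "vars s 1 = m" "vars s 2 = k" "vars s 3 = T" "vars s 4 = h" "vars s 6 = x" "vars s 7 = x" "vars s 9 = x - k"
    and x: "x + 2 * h \<le> n" and e: "0 \<le> e"
    and post: "\<And>s' t' y. vframe ({7, 9} \<union> {10..30}) s s' \<Longrightarrow> vars s' 7 = y \<Longrightarrow> x \<le> y \<Longrightarrow> y \<le> n \<Longrightarrow>
      prefix_ED y \<le> prefix_ED x + 3 * k \<Longrightarrow> (\<And>v. x \<le> v + k \<Longrightarrow> v \<le> x + k \<Longrightarrow> dead X Y x (y - x) v) \<Longrightarrow>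
      t' \<le> t + 8 * probe_cost (y - x) + 4 * group_cost + 50 \<Longrightarrow> ok cs s' t' e"
  shows "ok (search_groups # cs) s t (e + 2 * (2 * k + 1) * exp (- real T))"
proof -
  let ?V = "{7, 9} \<union> {10..30 :: nat}"
  define \<epsilon> where "\<epsilon> = exp (- real T)"
  have \<epsilon>: "0 \<le> \<epsilon>" by (simp add: \<epsilon>_def)
  \<comment> \<open>The error budget is charged per alignment not yet covered instead of per group.
    This is generous, but the budget then depends only on the start of the next group.\<close>
  define I where "I = (\<lambda>s' t' e'. vframe ?V s s' \<and>
    (let v0 = vars s' 9; y = vars s' 7 in
      x \<le> v0 + k \<and> x \<le> y \<and> y \<le> n \<and> prefix_ED y \<le> prefix_ED x + 3 * k \<and> e + 2 * real (x + k + 1 - v0) * \<epsilon> \<le> e' \<and>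
      (\<forall>v. x \<le> v + k \<longrightarrow> v < v0 \<longrightarrow> v \<le> x + k \<longrightarrow> dead X Y x (y - x) v) \<and>
      (\<exists>g\<le>4. v0 = (x - k) + g * (h + 1) \<and> t' \<le> t + g * (group_cost + 10) + 2 * (g * probe_cost (y - x)))))"
  have cap: "1 < cap" "x + k < cap" "h + 1 < cap" "v0 \<le> x + k \<Longrightarrow> v0 + (h + 1) < cap" for v0
    using small_numbers x k_less by linarith+
  have "x + k + 1 - (x - k) \<le> 2 * k + 1" by linarith
  then have "real (x + k + 1 - (x - k)) \<le> 2 * k + 1" by linarith
  then have "2 * real (x + k + 1 - (x - k)) * \<epsilon> \<le> 2 * (2 * k + 1) * \<epsilon>"
    using \<epsilon> by (intro mult_right_mono) auto
  then have "I s t (e + 2 * (2 * k + 1) * \<epsilon>)"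
    using s x by (auto simp: I_def Let_def vframe_refl intro!: exI[of _ 0])
  then show ?thesis unfolding search_groups_def \<epsilon>_def[symmetric]
  proof (rule ok_whileI[where I = I and \<mu> = "\<lambda>s'. x + k + 1 - vars s' 9"])
    fix s' t' e' assume I: "I s' t' e'" and c: "expr_val w X Y s' (!. (Var 6 +. Var 2 <. Var 9)) = 0"
    obtain g where I': "vframe ?V s s'" "x \<le> vars s' 7" "vars s' 7 \<le> n" "prefix_ED (vars s' 7) \<le> prefix_ED x + 3 * k"
      "e + 2 * real (x + k + 1 - vars s' 9) * \<epsilon> \<le> e'"
      "\<And>v. x \<le> v + k \<Longrightarrow> v < vars s' 9 \<Longrightarrow> v \<le> x + k \<Longrightarrow> dead X Y x (vars s' 7 - x) v"
      "g \<le> 4" "t' \<le> t + g * (group_cost + 10) + 2 * (g * probe_cost (vars s' 7 - x))"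
      using I unfolding I_def Let_def by blast
    have "vars s' 6 = x" "vars s' 2 = k" using I'(1) s by (auto simp: vframe_def)
    then have c: "x + k < vars s' 9" using c cap by (auto split: if_splits)
    have "g * (group_cost + 10) \<le> 4 * group_cost + 40"
      using mult_le_mono1[OF I'(7), of "group_cost + 10"] by simp
    moreover have "g * probe_cost (vars s' 7 - x) \<le> 4 * probe_cost (vars s' 7 - x)"
      using I'(7) by (intro mult_le_mono1)
    ultimately have "Suc t' \<le> t + 8 * probe_cost (vars s' 7 - x) + 4 * group_cost + 50" using I'(8) by linarith
    then have "ok cs s' (Suc t') e" using I' c by (intro post[OF I'(1) refl]) auto
    moreover have "e \<le> e'" using I'(5) \<epsilon> c by simp
    ultimately show "ok cs s' (Suc t') e'" by (rule ok_mono)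
  next
    fix s' t' e' assume I: "I s' t' e'" and c: "expr_val w X Y s' (!. (Var 6 +. Var 2 <. Var 9)) \<noteq> 0"
      and IH: "\<And>s'' t'' e''. I s'' t'' e'' \<Longrightarrow> x + k + 1 - vars s'' 9 < x + k + 1 - vars s' 9 \<Longrightarrow>
        ok (While (!. (Var 6 +. Var 2 <. Var 9)) search_groups_body # cs) s'' t'' e''"
    define v0 where "v0 = vars s' 9"
    define y where "y = vars s' 7"
    obtain g where I': "vframe ?V s s'" "x \<le> y" "y \<le> n" "prefix_ED y \<le> prefix_ED x + 3 * k" "x \<le> v0 + k"
      "e + 2 * real (x + k + 1 - v0) * \<epsilon> \<le> e'"
      "\<And>v. x \<le> v + k \<Longrightarrow> v < v0 \<Longrightarrow> v \<le> x + k \<Longrightarrow> dead X Y x (y - x) v"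
      "g \<le> 4" "v0 = (x - k) + g * (h + 1)" "t' \<le> t + g * (group_cost + 10) + 2 * (g * probe_cost (y - x))"
      using I unfolding I_def Let_def v0_def y_def by blast
    have vs: "vars s' 0 = n" "vars s' 1 = m" "vars s' 2 = k" "vars s' 3 = T" "vars s' 4 = h" "vars s' 6 = x"
      using I'(1) s by (auto simp: vframe_def)
    then have v0: "v0 \<le> x + k" using c cap by (auto simp: v0_def)
    have g: "g \<le> 3"
    proof (rule ccontr)
      assume "\<not> g \<le> 3"
      then have "4 * (h + 1) \<le> g * (h + 1)" by (intro mult_le_mono1) simp
      \<comment> \<open>Four groups of \<open>h + 1\<close> alignments cover all
        \<open>2 * k + 1\<close> of them, for either parity of \<open>k\<close>.\<close>
      moreover have "2 * k < 4 * (h + 1)" using h_def by presburger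
      ultimately show False using I'(9) v0 by linarith
    qed
    define e1 where "e1 = e + 2 * real (x + k + 1 - (v0 + (h + 1))) * \<epsilon>"
    have "real (x + k + 1 - (v0 + (h + 1))) + 1 \<le> real (x + k + 1 - v0)" using v0 by linarith
    then have "2 * (real (x + k + 1 - (v0 + (h + 1))) + 1) * \<epsilon> \<le> 2 * real (x + k + 1 - v0) * \<epsilon>"
      using \<epsilon> by (intro mult_right_mono) auto
    then have e1: "e1 + 2 * \<epsilon> \<le> e'" using I'(6) unfolding e1_def by (simp add: distrib_right distrib_left)
    have "0 \<le> e1" using e \<epsilon> by (simp add: e1_def)
    have "ok (search_group # (9 :=. Var 9 +. (Var 4 +. Const 1)) # While (!. (Var 6 +. Var 2 <. Var 9)) search_groups_body # cs) s' t'' (e1 + 2 * exp (- real T))"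
      if t'': "t'' \<le> t' + 4" for t''
    proof (rule ok_search_group[where x = x and ?v0.0 = v0 and y = y])
      show "ready x v0 s'" "vars s' 7 = y" using vs by (auto simp: ready_def v0_def y_def)
      fix s2 t2 y' assume 2: "vframe ({7} \<union> {10..30}) s' s2" "vars s2 7 = y'" "y \<le> y'" "x \<le> y'"
        "\<And>v. v0 \<le> v \<Longrightarrow> v \<le> v0 + h \<Longrightarrow> v \<le> x + k \<Longrightarrow> dead X Y x (y' - x) v"
        "y' = y \<or> y' \<le> n \<and> prefix_ED y' \<le> prefix_ED x + 3 * k" "t2 \<le> t'' + group_cost + 2 * probe_cost (y' - x)"
      let ?s2 = "s2\<lparr>vars := (vars s2)(9 := v0 + (h + 1))\<rparr>"
      have V2: "vframe ?V s ?s2" using I'(1) 2(1) by (auto simp: vframe_def)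
      have vs2: "vars s2 9 = v0" "vars s2 4 = h" using 2(1) vs by (auto simp: vframe_def v0_def)
      have "I ?s2 t3 e1" if t3: "t3 \<le> t2 + 4" for t3
      proof -
        have dead: "dead X Y x (y' - x) v" if "x \<le> v + k" "v < v0 + (h + 1)" "v \<le> x + k" for v
        proof (cases "v < v0")
          case True
          then have "dead X Y x (y - x) v" using I'(7) that by blast
          then show ?thesis by (rule dead_mono) (use 2(3) in simp)
        next
          case False then show ?thesis using 2(5) that by simp
        qed
        have "y' - x \<ge> y - x" using 2(3) by simp
        from probe_cost_mono[OF this] have "g * probe_cost (y - x) \<le> g * probe_cost (y' - x)" by simp
        then have time: "t3 \<le> t + (g + 1) * (group_cost + 10) + 2 * ((g + 1) * probe_cost (y' - x))"
        proof -
          have "(g + 1) * (group_cost + 10) = g * (group_cost + 10) + group_cost + 10"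
            "(g + 1) * probe_cost (y' - x) = g * probe_cost (y' - x) + probe_cost (y' - x)" by simp_all
          then show ?thesis using \<open>g * probe_cost (y - x) \<le> _\<close> I'(10) t3 t'' 2(7) by linarith
        qed
        have "v0 + (h + 1) = (x - k) + (g + 1) * (h + 1)" using I'(9) by simp
        then have "\<exists>g\<le>4. v0 + (h + 1) = (x - k) + g * (h + 1) \<and>
           t3 \<le> t + g * (group_cost + 10) + 2 * (g * probe_cost (y' - x))"
          using time g by (intro exI[of _ "g + 1"]) simp
        moreover have "y' \<le> n \<and> prefix_ED y' \<le> prefix_ED x + 3 * k" using 2(6) I'(3,4) by auto
        moreover have "x \<le> v0 + (h + 1) + k" using I'(5) by simp
        ultimately show ?thesis unfolding I_def Let_def using V2 2(2,4) dead by (simp add: e1_def)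
      qed
      then have "ok (While (!. (Var 6 +. Var 2 <. Var 9)) search_groups_body # cs) ?s2 t3 e1" if "t3 \<le> t2 + 4" for t3
        using v0 that by (intro IH) (auto simp flip: v0_def)
      then show "ok ((9 :=. Var 9 +. (Var 4 +. Const 1)) # While (!. (Var 6 +. Var 2 <. Var 9)) search_groups_body # cs) s2 t2 e1"
        using vs2 cap(1,3) cap(4)[OF v0] by simp
    qed (use x v0 I' \<open>0 \<le> e1\<close> in auto)
    from ok_mono[OF this e1[unfolded \<epsilon>_def]]
    show "ok (search_groups_body # While (!. (Var 6 +. Var 2 <. Var 9)) search_groups_body # cs) s' (Suc t') e'"
      by (subst search_groups_body_def) simp
  qed
qed

lemma ok_phase:
  assumes s: "vars s 0 = n" "vars s 1 = m" "vars s 2 = k" "vars s 3 = T" "vars s 4 = h" "vars s 6 = x"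
    and x: "x \<le> n" and e: "0 \<le> e"
    and post: "\<And>s' t' y. vframe ({7, 9} \<union> {10..30}) s s' \<Longrightarrow> vars s' 7 = y \<Longrightarrow> x \<le> y \<Longrightarrow> y \<le> n \<Longrightarrow>
      prefix_ED y \<le> prefix_ED x + 3 * k \<Longrightarrow> (\<And>v. x \<le> v + k \<Longrightarrow> v \<le> x + k \<Longrightarrow> dead X Y x (y - x) v) \<Longrightarrow>
      t' \<le> t + phase_cost (y - x) \<Longrightarrow> ok cs s' t' e"
  shows "ok (phase # cs) s t (e + 2 * (2 * k + 1) * exp (- real T))"
proof -
  have cap: "1 < cap" "h + h < cap" "h + h + 1 < cap" "n < cap" "x < cap" using small_numbers x by linarith+
  show ?thesis
  proof (cases "n - x < h + h + 1")
    case True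
    have "n = x + (n - x)" using x by simp
    then have "prefix_ED n \<le> prefix_ED x + (n - x)" using ED_diagonal_skip[of x "n - x" X Y] unfolding prefix_ED_def by metis
    then have "prefix_ED n \<le> prefix_ED x + 3 * k" using True small_numbers(3) by linarith
    then have "ok cs (s\<lparr>vars := (vars s)(7 := n)\<rparr>) t' e" if "t' \<le> t + 3" for t'
      using that x by (intro post[of _ n]) (auto simp: vframe_def phase_cost_def dead_def matches_def)
    from ok_mono[OF this, of _ "e + 2 * (2 * k + 1) * exp (- real T)"] show ?thesis
      unfolding phase_def using s True cap x by simp
  next
    case False
    let ?s = "s\<lparr>vars := (vars s)(7 := x, 9 := x - k)\<rparr>"
    have "ok (search_groups # cs) ?s t' (e + 2 * (2 * k + 1) * exp (- real T))" if "t' \<le> t + 10" for t'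
    proof (rule ok_search_groups[where x = x])
      fix s' t'' y assume 1: "vframe ({7, 9} \<union> {10..30}) ?s s'" "vars s' 7 = y" "x \<le> y" "y \<le> n"
        "prefix_ED y \<le> prefix_ED x + 3 * k" "\<And>v. x \<le> v + k \<Longrightarrow> v \<le> x + k \<Longrightarrow> dead X Y x (y - x) v"
        "t'' \<le> t' + 8 * probe_cost (y - x) + 4 * group_cost + 50"
      show "ok cs s' t'' e"
      proof (rule post[OF _ 1(2-6)])
        show "vframe ({7, 9} \<union> {10..30}) s s'" using 1(1) by (auto simp: vframe_def)
        show "t'' \<le> t + phase_cost (y - x)" using 1(7) that by (simp add: phase_cost_def)
      qed
    qed (use s x e False in auto)
    then show ?thesis unfolding phase_def using s False cap x by (auto simp: not_less)
  qed
qed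

text \<open>The alignment \<open>v\<close> is the one that an optimal alignment uses at \<open>x\<close>, after \<open>e\<close> edits.\<close>

definition yes_inv :: "nat \<Rightarrow> nat \<Rightarrow> bool" where
  "yes_inv p x \<longleftrightarrow> (\<exists>v e. p \<le> e \<and> ED (drop x X) (drop v Y) + e \<le> k \<and> v \<le> x + e \<and> x \<le> v + e \<and> v \<le> m)"

text \<open>The optimal alignment has drifted by at most \<open>e \<le> k\<close>, so it is among
  those refuted by the phase, and passing beyond \<open>y\<close> costs it another edit.\<close>

lemma yes_inv_step:
  assumes "yes_inv p x" "x \<le> y" "y < n" "\<And>v. x \<le> v + k \<Longrightarrow> v \<le> x + k \<Longrightarrow> dead X Y x (y - x) v"
  shows "yes_inv (Suc p) (Suc y)"
proof -
  obtain v e where v: "p \<le> e" "ED (drop x X) (drop v Y) + e \<le> k" "v \<le> x + e" "x \<le> v + e" "v \<le> m"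
    using assms(1) by (auto simp: yes_inv_def)
  have "dead X Y x (y - x) v" using v by (intro assms(4)) auto
  then have "\<And>l. matches X Y x v l \<Longrightarrow> x + l \<le> y" using assms(2) unfolding dead_def by fastforce
  from ED_greedy_progress[OF v(2-5) this assms(3,2)] obtain v' e' where
    "e < e'" "ED (drop (Suc y) X) (drop v' Y) + e' \<le> k" "v' \<le> Suc y + e'" "Suc y \<le> v' + e'" "v' \<le> m" by blast
  then show ?thesis unfolding yes_inv_def using v(1) by (intro exI[of _ v'] exI[of _ e']) auto
qed

text \<open>The 96 is 12 steps per sample times two probes in each of four groups. The phases cover
  disjoint stretches of \<open>X\<close>, so their complete blocks number at most
  \<open>n div (h + 1)\<close>.\<close>

definition total_cost :: nat where
  "total_cost = 96 * (T * (n div (h + 1))) + (k + 1) * (96 * T + 4 * group_cost + 250) + 10"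

lemma ok_phases:
  assumes s: "vars s 0 = n" "vars s 1 = m" "vars s 2 = k" "vars s 3 = T" "vars s 4 = h" "vars s 6 = 0" "vars s 8 = 0" "vars s 31 = 0"
    and nm: "n \<le> m + k" "m \<le> n + k" and e: "0 \<le> e"
    and post: "\<And>s' t' f. vars s' 31 = of_bool f \<Longrightarrow> (ED X Y \<le> k \<Longrightarrow> f) \<Longrightarrow> (f \<Longrightarrow> ED X Y \<le> (3 * k + 5) * k) \<Longrightarrow>
      t' \<le> t + total_cost \<Longrightarrow> ok cs s' t' e"
  shows "ok (phases # cs) s t (e + (k + 1) * (2 * (2 * k + 1) * exp (- real T)))"
proof -
  define \<epsilon> where "\<epsilon> = 2 * (2 * k + 1) * exp (- real T)"
  have \<epsilon>: "0 \<le> \<epsilon>" by (simp add: \<epsilon>_def)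
  let ?V = "{6, 7, 8, 9} \<union> {10..31 :: nat}"
  define Q where "Q = 96 * T + 4 * group_cost + 250"
  have tc: "total_cost = 96 * (T * (n div (h + 1))) + (k + 1) * Q + 10" by (simp add: total_cost_def Q_def)
  have cap: "1 < cap" "k + 1 < cap" "n + 1 < cap" using small_numbers k_less by linarith+
  define I where "I = (\<lambda>s' t' e'. vframe ?V s s' \<and>
    (let x = vars s' 6; p = vars s' 8 in
      x \<le> n \<and> p \<le> k + 1 \<and>
      (vars s' 31 = 0 \<and> prefix_ED x \<le> p * (3 * k + 1) \<and> (ED X Y \<le> k \<longrightarrow> yes_inv p x) \<and> 
        e + real (k + 1 - p) * \<epsilon> \<le> e' \<and> t' \<le> t + p * Q + 96 * (T * (x div (h + 1))) \<or>
       vars s' 31 = 1 \<and> ED X Y \<le> (3 * k + 5) * k \<and> e \<le> e' \<and> t' \<le> t + (k + 1) * Q + 96 * (T * (n div (h + 1))))))"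
  have "yes_inv 0 0" if "ED X Y \<le> k" unfolding yes_inv_def using that by (intro exI[of _ 0]) simp
  then have "I s t (e + (k + 1) * \<epsilon>)" using s by (simp add: I_def vframe_refl prefix_ED_def)
  then show ?thesis unfolding phases_def \<epsilon>_def[symmetric]
  proof (rule ok_whileI[where I = I and \<mu> = "\<lambda>s'. (k + 1 - vars s' 8) + (1 - vars s' 31)"])
    fix s' t' e' assume I: "I s' t' e'" and c: "expr_val w X Y s' (!. (Var 2 <. Var 8) &. !. (Var 31)) = 0"
    have k: "vars s' 2 = k" using I s by (auto simp: I_def vframe_def)
    show "ok cs s' (Suc t') e'"
    proof (cases "vars s' 31 = 0")
      case False
      then have 1: "vars s' 31 = 1" "ED X Y \<le> (3 * k + 5) * k" "e \<le> e'" "t' \<le> t + (k + 1) * Q + 96 * (T * (n div (h + 1)))"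
        using I by (auto simp: I_def Let_def)
      have "Suc t' \<le> t + total_cost" using 1(4) by (simp add: total_cost_def Q_def)
      then have "ok cs s' (Suc t') e" using 1(1,2) by (intro post[of s' True]) simp_all
      from this 1(3) show ?thesis by (rule ok_mono)
    next
      case True
      have "vars s' 8 \<le> k + 1" using I by (simp add: I_def Let_def)
      moreover have "k < vars s' 8" using c k cap True by (simp split: if_splits)
      ultimately have p: "vars s' 8 = k + 1" by simp
      then have 1: "vars s' 6 \<le> n" "ED X Y \<le> k \<Longrightarrow> yes_inv (k + 1) (vars s' 6)" "e \<le> e'"
        "t' \<le> t + (k + 1) * Q + 96 * (T * (vars s' 6 div (h + 1)))"
        using I True by (auto simp: I_def Let_def)
      have "T * (vars s' 6 div (h + 1)) \<le> T * (n div (h + 1))" using 1(1) by (intro mult_le_mono2 div_le_mono)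
      then have "Suc t' \<le> t + total_cost" using 1(4) unfolding tc by linarith
      \<comment> \<open>After \<open>k + 1\<close> phases the invariant would demand
        \<open>k + 1\<close> edits out of at most \<open>k\<close>.\<close>
      moreover have "\<not> ED X Y \<le> k" using 1(2) by (auto simp: yes_inv_def)
      ultimately have "ok cs s' (Suc t') e" using True by (intro post[of s' False]) auto
      from this 1(3) show ?thesis by (rule ok_mono)
    qed
  next
    fix s' t' e' assume I: "I s' t' e'" and c: "expr_val w X Y s' (!. (Var 2 <. Var 8) &. !. (Var 31)) \<noteq> 0"
      and IH: "\<And>s'' t'' e''. I s'' t'' e'' \<Longrightarrow> (k + 1 - vars s'' 8) + (1 - vars s'' 31) < (k + 1 - vars s' 8) + (1 - vars s' 31) \<Longrightarrow>
        ok (While (!. (Var 2 <. Var 8) &. !. (Var 31)) phases_body # cs) s'' t'' e''"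
    define x where "x = vars s' 6"
    define p where "p = vars s' 8"
    have vs: "vars s' 0 = n" "vars s' 1 = m" "vars s' 2 = k" "vars s' 3 = T" "vars s' 4 = h"
      using I s by (auto simp: I_def vframe_def)
    have a: "vars s' 31 = 0" "p \<le> k" using c I vs cap by (auto simp: I_def Let_def not_less p_def)
    then have I': "vframe ?V s s'" "x \<le> n" "prefix_ED x \<le> p * (3 * k + 1)" "ED X Y \<le> k \<Longrightarrow> yes_inv p x"
      "e + real (k + 1 - p) * \<epsilon> \<le> e'" "t' \<le> t + p * Q + 96 * (T * (x div (h + 1)))"
      using I by (auto simp: I_def Let_def x_def p_def)
    define e1 where "e1 = e + real (k + 1 - Suc p) * \<epsilon>"
    have "real (k + 1 - p) = real (k + 1 - Suc p) + 1" using a(2) by linarith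
    then have e1: "e1 + \<epsilon> \<le> e'" using I'(5) by (simp add: e1_def distrib_right)
    have e1': "0 \<le> e1" "e \<le> e1" using e \<epsilon> by (auto simp: e1_def)
    let ?r = "If (Var 7 <. Var 0) (6 :=. Var 7 +. Const 1;; 8 :=. Var 8 +. Const 1) (31 :=. Const 1)"
    have "ok (phase # ?r # While (!. (Var 2 <. Var 8) &. !. (Var 31)) phases_body # cs) s' t'' (e1 + 2 * (2 * k + 1) * exp (- real T))"
      if t'': "t'' \<le> t' + 3" for t''
    proof (rule ok_phase[where x = x])
      show "vars s' 6 = x" by (simp add: x_def)
      fix s2 t2 y assume 2: "vframe ({7, 9} \<union> {10..30}) s' s2" "vars s2 7 = y" "x \<le> y" "y \<le> n" "prefix_ED y \<le> prefix_ED x + 3 * k"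
        "\<And>v. x \<le> v + k \<Longrightarrow> v \<le> x + k \<Longrightarrow> dead X Y x (y - x) v" "t2 \<le> t'' + phase_cost (y - x)"
      have V2: "vframe ?V s s2" using I'(1) 2(1) by (auto simp: vframe_def)
      have vs2: "vars s2 0 = n" "vars s2 6 = x" "vars s2 8 = p" "vars s2 31 = 0"
        using 2(1) vs a by (auto simp: vframe_def x_def p_def)
      have "(x div (h + 1)) + ((y - x) div (h + 1)) \<le> y div (h + 1)"
      proof -
        have "(x div (h + 1)) * (h + 1) + ((y - x) div (h + 1)) * (h + 1) \<le> x + (y - x)"
          by (intro add_mono div_times_less_eq_dividend)
        then have "((x div (h + 1)) + ((y - x) div (h + 1))) * (h + 1) \<le> y" using 2(3) unfolding distrib_right by simp
        then show ?thesis by (simp add: less_eq_div_iff_mult_less_eq)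
      qed
      then have "T * ((x div (h + 1)) + ((y - x) div (h + 1))) \<le> T * (y div (h + 1))" by (rule mult_le_mono2)
      then have Ty: "T * (x div (h + 1)) + T * ((y - x) div (h + 1)) \<le> T * (y div (h + 1))" by (simp only: distrib_left)
      have Suc: "Suc p * Q = p * Q + Q" by simp
      \<comment> \<open>The 40 steps held back pay for the commands that follow the phase.\<close>
      have t2: "t2 \<le> t + Suc p * Q + 96 * (T * (y div (h + 1))) - 40"
        unfolding Suc using Ty 2(7) t'' I'(6) by (simp add: phase_cost_def probe_cost_def Q_def)
      have Q: "40 \<le> Suc p * Q" by (simp add: Q_def)
      show "ok (?r # While (!. (Var 2 <. Var 8) &. !. (Var 31)) phases_body # cs) s2 t2 e1"
      proof (cases "y < n")
        case True
        let ?s2 = "s2\<lparr>vars := (vars s2)(6 := Suc y, 8 := Suc p)\<rparr>"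
        have "I ?s2 t3 e1" if t3: "t3 \<le> t2 + 10" for t3
        proof -
          have "prefix_ED (Suc y) \<le> prefix_ED y + 1" using ED_diagonal_skip[of y 1 X Y] by (simp add: prefix_ED_def)
          then have "prefix_ED (Suc y) \<le> Suc p * (3 * k + 1)" using 2(5) I'(3) by simp
          moreover have "ED X Y \<le> k \<Longrightarrow> yes_inv (Suc p) (Suc y)" using yes_inv_step[OF _ 2(3) True 2(6)] I'(4) by blast
          moreover have "T * (y div (h + 1)) \<le> T * (Suc y div (h + 1))" by (intro mult_le_mono2 div_le_mono) simp
          then have "t3 \<le> t + Suc p * Q + 96 * (T * (Suc y div (h + 1)))" using t3 t2 Q by linarith
          ultimately show ?thesis using V2 True a vs2 by (simp add: I_def e1_def del: mult_Suc)
        qed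
        then have "ok (While (!. (Var 2 <. Var 8) &. !. (Var 31)) phases_body # cs) ?s2 t3 e1" if "t3 \<le> t2 + 10" for t3
          using that a vs2 by (intro IH) (auto simp flip: p_def)
        then show ?thesis using vs2 2(2) cap True a by simp
      next
        case False
        then have y: "y = n" using 2(4) by simp
        let ?s2 = "s2\<lparr>vars := (vars s2)(31 := 1)\<rparr>"
        have "I ?s2 t3 e1" if t3: "t3 \<le> t2 + 10" for t3
        proof -
          have "p * (3 * k + 1) \<le> k * (3 * k + 1)" using a(2) by (rule mult_le_mono1)
          then have "ED X (take n Y) \<le> k * (3 * k + 1) + 3 * k" using 2(5) I'(3) y by (simp add: prefix_ED_def)
          moreover have "ED X Y \<le> ED X (take n Y) + ED (take n Y) (take m Y)" using ED_triangle[of X Y "take n Y"] by simp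
          moreover have "ED (take n Y) (take m Y) \<le> k" using ED_take_take[of n Y m] nm by linarith
          ultimately have "ED X Y \<le> (3 * k + 5) * k" by (simp add: algebra_simps)
          moreover have "Suc p * Q \<le> (k + 1) * Q" using a(2) by (intro mult_le_mono1) simp
          then have "t3 \<le> t + (k + 1) * Q + 96 * (T * (n div (h + 1)))" using t3 t2[unfolded y] Q by linarith
          ultimately show ?thesis using V2 a vs2 e1' I'(2) by (simp add: I_def)
        qed
        then have "ok (While (!. (Var 2 <. Var 8) &. !. (Var 31)) phases_body # cs) ?s2 t3 e1" if "t3 \<le> t2 + 10" for t3
          using that a vs2 by (intro IH) (auto simp flip: p_def)
        then show ?thesis using vs2 2(2) cap False a by simp
      qed
    qed (use vs I'(2) e1' in auto)
    then have "ok (phase # ?r # While (!. (Var 2 <. Var 8) &. !. (Var 31)) phases_body # cs) s' t'' e'" if "t'' \<le> t' + 3" for t''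
      using that e1 ok_mono unfolding \<epsilon>_def by blast
    then show "ok (phases_body # While (!. (Var 2 <. Var 8) &. !. (Var 31)) phases_body # cs) s' (Suc t') e'"
      by (subst phases_body_def) simp
  qed
qed

end

section \<open>Choice of the parameters and the final estimates\<close>

section \<open>The algorithm\<close>

definition sample_count_body :: "nat \<Rightarrow> com" where
  "sample_count_body K = (32 :=. Var 32 /. Const 2;; 3 :=. Var 3 +. Const K)"

text \<open>Halving the input size until it vanishes counts its binary length \<open>b\<close>,
  which makes the number of samples \<open>K * b\<close>.\<close>

definition sample_count :: "nat \<Rightarrow> com" where
  "sample_count K = (32 :=. Var 0 +. Var 1 +. Const 1;; While (Var 32) (sample_count_body K))"

text \<open>The comparison of \<open>k\<close> with the total length comes first: it settles large
  \<open>k\<close>, and afterwards sums of \<open>k\<close> and a length cannot wrap around. Lengths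
  that differ by more than \<open>k\<close> leave the default answer NO. The answer stays in
  variable 31 until the end because variable 0 still holds a length.\<close>

definition gap_algorithm :: "nat \<Rightarrow> com" where
  "gap_algorithm K =
    (((sample_count K;; 4 :=. Var 2 /. Const 2);;
      If (Var 2 <. Var 0 +. Var 1)
        (If (Var 0 +. Var 2 <. Var 1) Skip (If (Var 1 +. Var 2 <. Var 0) Skip phases))
        (31 :=. Const 1));;
     0 :=. Var 31)"

lemma (in gap_ram) total_cost_le:
  "real total_cost \<le> 3000 * real T * (real n / (real k + 1) + real k ^ 2 + 1)"
proof -
  have "\<beta> * h \<le> T * h" using beta_le by simp
  moreover have "1 * h \<le> T * h" using T_pos by (intro mult_le_mono1) simp
  moreover have "4 * group_cost = 20 * (\<beta> * h) + 1200 * h + 800" by (simp add: group_cost_def)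
  ultimately have "96 * T + 4 * group_cost + 250 \<le> 1220 * (T * h) + 1220 * T"
    using T_pos by linarith
  also have "\<dots> \<le> 1220 * (T * k) + 1220 * T" using h_def by simp
  also have "\<dots> = 1220 * T * (k + 1)" by simp
  finally have "(k + 1) * (96 * T + 4 * group_cost + 250) \<le> (k + 1) * (1220 * T * (k + 1))" by (rule mult_le_mono2)
  then have "total_cost \<le> 96 * (T * (n div (h + 1))) + (k + 1) * (1220 * T * (k + 1)) + 10 * T"
    using T_pos unfolding total_cost_def by linarith
  then have "real total_cost \<le> real (96 * (T * (n div (h + 1))) + (k + 1) * (1220 * T * (k + 1)) + 10 * T)"
    by (rule of_nat_mono)
  also have "\<dots> = real T * (96 * real (n div (h + 1)) + 1220 * (real k + 1) ^ 2 + 10)"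
    by (simp add: power2_eq_square algebra_simps)
  also have "\<dots> \<le> real T * (3000 * (real n / (real k + 1) + real k ^ 2 + 1))"
  proof (intro mult_left_mono)
    have "real (n div (h + 1)) \<le> real n / real (h + 1)" by (rule of_nat_div_le_of_nat)
    also have "\<dots> \<le> real n / ((real k + 1) / 2)"
    proof (intro divide_left_mono)
      have "k + 1 \<le> 2 * (h + 1)" using h_def by simp
      then have "real (k + 1) \<le> real (2 * (h + 1))" by (rule of_nat_mono)
      then show "(real k + 1) / 2 \<le> real (h + 1)" by simp
    qed auto
    finally have 1: "real (n div (h + 1)) \<le> 2 * (real n / (real k + 1))" by (simp add: mult.commute)
    have "0 \<le> (real k - 1) ^ 2" by simp
    then have 2: "(real k + 1) ^ 2 \<le> 2 * real k ^ 2 + 2" by (simp add: power2_eq_square algebra_simps)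
    have 3: "0 \<le> real n / (real k + 1)" "0 \<le> real k ^ 2" by auto
    have "96 * real (n div (h + 1)) + 1220 * (real k + 1) ^ 2 + 10 \<le>
       192 * (real n / (real k + 1)) + 2440 * real k ^ 2 + 2450" using 1 2 by linarith
    also have "\<dots> \<le> 3000 * (real n / (real k + 1) + real k ^ 2 + 1)" using 3 unfolding distrib_left by linarith
    finally show "96 * real (n div (h + 1)) + 1220 * (real k + 1) ^ 2 + 10 \<le> 3000 * (real n / (real k + 1) + real k ^ 2 + 1)" .
  qed simp
  finally show ?thesis by (simp add: mult_ac)
qed

context word_ram
begin

lemma ok_sample_count:
  assumes s: "vars s 0 = length X" "vars s 1 = length Y" "vars s 3 = 0" and K: "0 < K"
    and big: "(K + 16) * (length X + length Y + 2) < cap"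
    and post: "\<And>s' t' b. frame {3, 32} s s' \<Longrightarrow> vars s' 3 = K * b \<Longrightarrow> 0 < b \<Longrightarrow> length X + length Y + 1 < 2 ^ b \<Longrightarrow>
      2 ^ (b - 1) \<le> length X + length Y + 1 \<Longrightarrow> t' \<le> t + 4 * b + 10 \<Longrightarrow> ok cs s' t' e"
  shows "ok (sample_count K # cs) s t e"
proof -
  define N where "N = length X + length Y + 1"
  define I where "I = (\<lambda>s' t' e'. frame {3, 32} s s' \<and> e' = e \<and> (\<exists>b. vars s' 32 = N div 2 ^ b \<and> vars s' 3 = K * b \<and>
     (0 < b \<longrightarrow> 2 ^ (b - 1) \<le> N) \<and> t' \<le> t + 4 * b + 5))"
  have big': "(K + 16) * (N + 1) < cap" using big by (simp add: N_def)
  then have big2: "K * N + K + 16 * N + 16 < cap" by (simp add: algebra_simps)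
  have cap: "1 < cap" "2 < cap" "K < cap" "length X + length Y + 1 < cap" using big2 by (auto simp: N_def)
  have loop: "ok (While (Var 32) (sample_count_body K) # cs) s' t' e'" if "I s' t' e'" for s' t' e'
  proof (rule ok_whileI[where I = I and \<mu> = "\<lambda>s'. vars s' 32", OF that])
    fix s' t' e' assume I: "I s' t' e'" and c: "expr_val w X Y s' (Var 32) = 0"
    obtain b where b: "frame {3, 32} s s'" "e' = e" "vars s' 32 = N div 2 ^ b" "vars s' 3 = K * b"
      "0 < b \<longrightarrow> 2 ^ (b - 1) \<le> N" "t' \<le> t + 4 * b + 5" using I by (auto simp: I_def)
    have "N < 2 ^ b" using c b(3) by (simp add: div_eq_0_iff)
    moreover have "b \<noteq> 0" using calculation by (intro notI) (simp add: N_def)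
    ultimately have "ok cs s' (Suc t') e" using b by (intro post[of s' b]) (auto simp: N_def)
    then show "ok cs s' (Suc t') e'" using b by simp
  next
    fix s' t' e' assume I: "I s' t' e'" and c: "expr_val w X Y s' (Var 32) \<noteq> 0"
      and IH: "\<And>s'' t'' e''. I s'' t'' e'' \<Longrightarrow> vars s'' 32 < vars s' 32 \<Longrightarrow> ok (While (Var 32) (sample_count_body K) # cs) s'' t'' e''"
    obtain b where b: "frame {3, 32} s s'" "e' = e" "vars s' 32 = N div 2 ^ b" "vars s' 3 = K * b"
      "0 < b \<longrightarrow> 2 ^ (b - 1) \<le> N" "t' \<le> t + 4 * b + 5" using I by (auto simp: I_def)
    have N: "2 ^ b \<le> N" using c b(3) by (simp add: div_eq_0_iff not_less)
    have "b < 2 ^ b" by (rule less_exp)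
    then have "b \<le> N" using N by linarith
    then have "K * b \<le> K * N" by simp
    then have lt: "K * b + K < cap" using big2 by linarith
    let ?s = "s'\<lparr>vars := (vars s')(32 := N div 2 ^ b div 2, 3 := K * b + K)\<rparr>"
    have "N div 2 ^ b div 2 = N div 2 ^ Suc b" by (metis div_mult2_eq power_Suc2)
    then have "I ?s t'' e" if "t'' \<le> t' + 4" for t''
      unfolding I_def using b N that by (auto simp del: power_Suc intro!: exI[of _ "Suc b"])
    then have "ok (While (Var 32) (sample_count_body K) # cs) ?s t'' e" if "t'' \<le> t' + 4" for t''
      using that c b(3) by (intro IH) auto
    then show "ok (sample_count_body K # While (Var 32) (sample_count_body K) # cs) s' (Suc t') e'"
      using b(2-4) cap lt by (subst sample_count_body_def) simp
  qed
  have "I (s\<lparr>vars := (vars s)(32 := N)\<rparr>) t' e" if "t' \<le> t + 5" for t'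
    unfolding I_def using that s by (auto simp: frame_refl intro!: exI[of _ 0])
  from loop[OF this] show ?thesis unfolding sample_count_def using s cap by (simp add: N_def)
qed

text \<open>The binary length \<open>b\<close> is computed at run time, so time and error are
  assumed to be bounded for every value that the size of the input allows.\<close>

lemma ok_gap_algorithm:
  assumes s: "vars s = (\<lambda>_. 0)(0 := length X, 1 := length Y, 2 := k)" and K: "0 < K" and k: "k < cap"
    and big: "(K + 16) * (length X + length Y + 2) < cap"
    and G: "\<And>s. (ED X Y \<le> k \<longrightarrow> vars s 0 \<noteq> 0) \<Longrightarrow> ((3 * k + 5) * k < ED X Y \<longrightarrow> vars s 0 = 0) \<Longrightarrow> G s"
    and time: "\<And>b. 0 < b \<Longrightarrow> 2 ^ (b - 1) \<le> length X + length Y + 1 \<Longrightarrow> 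
      real (4 * b + 30) + 3000 * real (K * b) * (real (length X) / (real k + 1) + real k ^ 2 + 1) \<le> real tmax"
    and e: "0 \<le> e" 
    and err: "\<And>b. length X + length Y + 1 < 2 ^ b \<Longrightarrow> k < length X + length Y \<Longrightarrow>
      real (k + 1) * (real (2 * (2 * k + 1)) * exp (- real (K * b))) \<le> e"
  shows "ok [gap_algorithm K] s 0 e"
proof -
  let ?R = "[4 :=. Var 2 /. Const 2,
      If (Var 2 <. Var 0 +. Var 1)
        (If (Var 0 +. Var 2 <. Var 1) Skip (If (Var 1 +. Var 2 <. Var 0) Skip phases))
        (31 :=. Const 1),
     0 :=. Var 31]"
  define N where "N = length X + length Y + 1"
  have big2: "K * N + K + 16 * N + 16 < cap" using big by (simp add: algebra_simps N_def)
  have "ok (sample_count K # ?R) s t e" if t: "t \<le> 3" for t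
  proof (rule ok_sample_count[OF _ _ _ K big])
    show "vars s 0 = length X" "vars s 1 = length Y" "vars s 3 = 0" using s by auto
    fix s1 t1 b assume 1: "frame {3, 32} s s1" "vars s1 3 = K * b" "0 < b" "length X + length Y + 1 < 2 ^ b"
      "2 ^ (b - 1) \<le> length X + length Y + 1" "t1 \<le> t + 4 * b + 10"
    have vs: "vars s1 0 = length X" "vars s1 1 = length Y" "vars s1 2 = k" "vars s1 6 = 0" "vars s1 8 = 0" "vars s1 31 = 0"
      using 1(1) s by (auto simp: frame_def)
    have cap: "1 < cap" "2 < cap" "length X + length Y < cap" using big2 by (auto simp: N_def)
    have pos: "0 \<le> 3000 * real (K * b) * (real (length X) / (real k + 1) + real k ^ 2 + 1)" by simp
    then have tm: "t1 + 10 \<le> tmax" using time[OF 1(3,5)] 1(6) t by linarith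
    show "ok ?R s1 t1 e"
    proof (cases "k < length X + length Y")
      case False
      have "ED X Y \<le> k" using ED_max[of X Y] False by linarith
      moreover have "k \<le> (3 * k + 5) * k" by simp
      ultimately have "\<not> (3 * k + 5) * k < ED X Y" by linarith
      then show ?thesis using vs cap False k tm e by (auto intro!: ok_halt G)
    next
      case True
      have kc: "length X + k < cap" "length Y + k < cap" using True big2 by (auto simp: N_def)
      show ?thesis
      proof (cases "length X + k < length Y \<or> length Y + k < length X")
        case far: True
        then have "k < ED X Y" using ED_length(1)[of X Y] ED_length(2)[where A = X and B = Y] by linarith
        then show ?thesis using vs cap True kc far tm e by (auto intro!: ok_halt G)
      next
        case False
        have "b - 1 < 2 ^ (b - 1)" by (rule less_exp)
        then have "b \<le> N" using 1(5) unfolding N_def by linarith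
        then have "K * b \<le> K * N" by simp
        interpret gap_ram w X Y G tmax k "k div 2" "K * b" b
        proof
          show "16 * (length X + length Y + 1) + K * b < cap" using big2 \<open>K * b \<le> K * N\<close> unfolding N_def by linarith
          show "b \<le> K * b" using K by simp
        qed (use 1(3,4) K True in auto)
        let ?s = "s1\<lparr>vars := (vars s1)(4 := k div 2)\<rparr>"
        have "ok (phases # [0 :=. Var 31]) ?s t2 (0 + real (k + 1) * (real (2 * (2 * k + 1)) * exp (- real (K * b))))"
          if t2: "t2 \<le> t1 + 8" for t2
        proof (rule ok_phases)
          fix s3 :: store and t3 f assume 3: "vars s3 31 = of_bool f" "ED X Y \<le> k \<Longrightarrow> f" "f \<Longrightarrow> ED X Y \<le> (3 * k + 5) * k" "t3 \<le> t2 + total_cost"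
          have "real t3 + 1 \<le> real tmax"
          proof -
            have "real t3 \<le> real (4 * b + 21) + real total_cost" using 3(4) t2 1(6) t by linarith
            then show ?thesis using total_cost_le time[OF 1(3,5)] by linarith
          qed
          then have "Suc t3 \<le> tmax" by linarith
          then show "ok [0 :=. Var 31] s3 t3 0" using 3(1-3) by (auto intro!: ok_halt G)
        qed (use vs 1(2) False in auto)
        moreover have "0 + real (k + 1) * (real (2 * (2 * k + 1)) * exp (- real (K * b))) \<le> e" using err[OF 1(4) True] by simp
        ultimately have "ok (phases # [0 :=. Var 31]) ?s t2 e" if "t2 \<le> t1 + 8" for t2
          using that ok_mono by blast
        then show ?thesis using vs cap True kc False by simp
      qed
    qed
  qed
  then show ?thesis by (simp add: gap_algorithm_def)
qed

end

theorem theorem3p3: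
  "\<forall>c::nat. \<exists>(P::com) (a::nat) (C::real) (d::nat).
     \<forall>(X::nat list) (Y::nat list) (k::nat) (w::nat). valid_word_size a w X Y k \<longrightarrow>
       prob_halts_within w P X Y k
         (C * log 2 (real (input_size X Y) + 1) ^ d *
            (1 / (real k + 1) * real (length X) + real k ^ 2 + 1))
         (correct_answers X Y k)
       \<ge> 1 - 1 / real (input_size X Y) ^ c"
proof (intro allI)
  fix c :: nat
  \<comment> \<open>The union bound charges \<open>(k + 1) * (2 * (2 * k + 1))\<close> failures of
    probability at most \<open>N ^ (-K)\<close>; this count is at most \<open>N ^ 4\<close>.\<close>
  define K where "K = c + 4"
  show "\<exists>(P::com) (a::nat) (C::real) (d::nat).
     \<forall>(X::nat list) (Y::nat list) (k::nat) (w::nat). valid_word_size a w X Y k \<longrightarrow>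
       prob_halts_within w P X Y k
         (C * log 2 (real (input_size X Y) + 1) ^ d *
            (1 / (real k + 1) * real (length X) + real k ^ 2 + 1))
         (correct_answers X Y k)
       \<ge> 1 - 1 / real (input_size X Y) ^ c"
  \<comment> \<open>The witnesses stay schematic until the end: \<open>gap_algorithm K\<close>,
    \<open>K + 20\<close>, \<open>6000 * real K + 100\<close> and 1.\<close>
  proof (intro exI allI impI)
    fix X Y :: "nat list" and k w :: nat
    assume valid: "valid_word_size (K + 20) w X Y k"
    define N where "N = input_size X Y"
    have N: "1 \<le> N" "N = length X + length Y + 1" by (auto simp: N_def input_size_def)
    define W where "W = real (length X) / (real k + 1) + real k ^ 2 + 1"
    have W: "1 \<le> W" by (simp add: W_def)
    define L where "L = log 2 (real N + 1)"
    have L: "1 \<le> L" using N by (simp add: L_def le_log_iff)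
    define tm where "tm = nat \<lfloor>(6000 * real K + 100) * L ^ 1 * W\<rfloor>"
    define G where "G s \<longleftrightarrow> (ED X Y \<le> k \<longrightarrow> vars s 0 \<noteq> 0) \<and> ((3 * k + 5) * k < ED X Y \<longrightarrow> vars s 0 = 0)" for s :: store
    interpret word_ram w X Y G tm .
    have cap_ge: "(N + 1) ^ (K + 20) \<le> cap"
    proof -
      have "real (K + 20) * log 2 (real N + 1) \<le> real w" using valid by (simp add: valid_word_size_def N_def add.commute)
      then have "2 powr (real (K + 20) * log 2 (real N + 1)) \<le> 2 powr real w" by simp
      also have "2 powr (real (K + 20) * log 2 (real N + 1)) = (real N + 1) ^ (K + 20)"
        by (simp add: mult.commute[of _ "log 2 _"] powr_powr[symmetric] powr_realpow del: of_nat_add)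
      also have "2 powr real w = real cap" by (simp add: cap_def powr_realpow)
      finally have "real ((N + 1) ^ (K + 20)) \<le> real cap" by (simp add: add.commute)
      then show ?thesis by (simp only: of_nat_le_iff)
    qed
    have big: "(K + 16) * (length X + length Y + 2) < cap"
    proof -
      \<comment> \<open>Since \<open>N + 1 \<ge> 2\<close> even for empty strings, a power of
        \<open>N + 1\<close> dominates the constant \<open>K + 16\<close> as well.\<close>
      have "K + 16 < 2 ^ (K + 16)" by (rule less_exp)
      also have "\<dots> \<le> (N + 1) ^ (K + 16)" using N by (intro power_mono) auto
      finally have "(K + 16) * (N + 1) < (N + 1) ^ (K + 16) * (N + 1)" by (rule mult_less_mono1) simp
      also have "\<dots> = (N + 1) ^ Suc (K + 16)" by (simp only: power_Suc2)
      also have "\<dots> \<le> (N + 1) ^ (K + 20)" by (intro power_increasing) auto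
      finally show ?thesis using cap_ge N by simp
    qed
    have "ok [gap_algorithm K] (snd (init_config (gap_algorithm K) X Y k)) 0 (1 / real N ^ c)"
    proof (rule ok_gap_algorithm[where k = k])
      show "0 < K" by (simp add: K_def)
      show "k < cap" using valid by (simp add: valid_word_size_def cap_def)
      show "(K + 16) * (length X + length Y + 2) < cap" by fact
      show "G s" if "ED X Y \<le> k \<longrightarrow> vars s 0 \<noteq> 0" "(3 * k + 5) * k < ED X Y \<longrightarrow> vars s 0 = 0" for s
        using that by (simp add: G_def)
    next
      fix b :: nat assume b: "0 < b" "2 ^ (b - 1) \<le> length X + length Y + 1"
      have "2 ^ (b - 1) \<le> N + 1" using b N by simp
      then have "real (2 ^ (b - 1)) \<le> real (N + 1)" by (rule of_nat_mono)
      then have "(2::real) ^ (b - 1) \<le> real N + 1" by simp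
      then have "real (b - 1) \<le> L" unfolding L_def by (subst le_log_iff) (auto simp: powr_realpow)
      then have bL: "real b \<le> 2 * L" using L b(1) by linarith
      have LW: "L \<le> L * W" "1 \<le> L * W"
        using L W mult_left_mono[of 1 W L] by linarith+
      have "real (4 * b + 30) + 3000 * real (K * b) * W \<le> (8 * L + 30) + 3000 * (real K * (2 * L)) * W"
      proof (intro add_mono mult_right_mono mult_left_mono)
        have "real K * real b \<le> real K * (2 * L)" using bL by (intro mult_left_mono) auto
        then show "real (K * b) \<le> real K * (2 * L)" by simp
      qed (use bL W in auto)
      also have "\<dots> \<le> (6000 * real K + 99) * L ^ 1 * W"
        using LW by (simp add: algebra_simps)
      \<comment> \<open>The step from 99 to 100 makes up for the floor, as \<open>L * W\<close> is
        at least 1.\<close>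
      also have "\<dots> \<le> real tm"
        using LW(2) unfolding tm_def by (simp add: algebra_simps) linarith
      finally show "real (4 * b + 30) + 3000 * real (K * b) * (real (length X) / (real k + 1) + real k ^ 2 + 1) \<le> real tm"
        unfolding W_def .
    next
      fix b assume b: "length X + length Y + 1 < 2 ^ b" and k: "k < length X + length Y"
      have N2: "2 \<le> N" "real k + 1 \<le> real N" "2 * real k + 1 \<le> 2 * real N" using k N by auto
      have "exp (- 1) \<le> (1 / 2 :: real)"
        using exp_ge_add_one_self[of "1 :: real"] by (simp add: exp_minus field_simps)
      then have "exp (- 1) ^ (K * b) \<le> (1 / 2 :: real) ^ (K * b)" by (intro power_mono) auto
      moreover have "exp (- real (K * b)) = exp (- 1) ^ (K * b)"
        using exp_of_nat_mult[of "K * b" "- 1 :: real"] by simp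
      ultimately have "exp (- real (K * b)) \<le> (1 / 2) ^ (K * b)" by (simp only:)
      also have "\<dots> = (1 / 2 ^ b) ^ K" by (simp add: power_mult[symmetric] power_one_over mult.commute)
      also have "\<dots> \<le> (1 / real N) ^ K"
      proof (intro power_mono divide_left_mono)
        have "N \<le> 2 ^ b" using b N by simp
        then have "real N \<le> real (2 ^ b)" by (rule of_nat_mono)
        then show "real N \<le> 2 ^ b" by simp
      qed (use N in auto)
      finally have ex: "exp (- real (K * b)) \<le> (1 / real N) ^ K" .
      have "real (k + 1) * (real (2 * (2 * k + 1)) * exp (- real (K * b))) \<le> real N * (4 * real N * (1 / real N) ^ K)"
        using N2 ex by (intro mult_mono) auto
      also have "\<dots> \<le> real N * (real N ^ 3 * (1 / real N) ^ K)"
      proof (intro mult_left_mono mult_right_mono)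
        have "2 * 2 \<le> real N * real N" using N2 by (intro mult_mono) auto
        then have "4 * real N \<le> real N * real N * real N" by (intro mult_right_mono) auto
        then show "4 * real N \<le> real N ^ 3" by (simp add: power3_eq_cube)
      qed auto
      also have "\<dots> = 1 / real N ^ c"
        using N2 by (simp add: K_def power_add field_simps power_numeral_reduce)
      finally show "real (k + 1) * (real (2 * (2 * k + 1)) * exp (- real (K * b))) \<le> 1 / real N ^ c" .
    qed (simp_all add: init_config_def)
    from ok_sound[OF this] have "1 - 1 / real N ^ c \<le> measure_pmf.prob (run w X Y tm (init_config (gap_algorithm K) X Y k))
        {cfg. halted cfg \<and> G (snd cfg)}"
      by (simp add: init_config_def)
    also have "{cfg. halted cfg \<and> G (snd cfg)} = {cfg \<in> correct_answers X Y k. halted cfg}"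
      by (auto simp: G_def correct_answers_def returns_YES_def returns_NO_def)
    finally show "prob_halts_within w (gap_algorithm K) X Y k
         ((6000 * real K + 100) * log 2 (real (input_size X Y) + 1) ^ 1 *
            (1 / (real k + 1) * real (length X) + real k ^ 2 + 1))
         (correct_answers X Y k) \<ge> 1 - 1 / real (input_size X Y) ^ c"
      by (simp add: prob_halts_within_def tm_def L_def W_def N_def)
  qed
qed

end
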